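(* Let $\tau$ be a complex number with $\operatorname{Im}\tau>0$, let $E=\mathbb C/(\mathbb Z+\mathbb Z\tau)$, and let $K$ be the field of rational (meromorphic) functions on $E$. Fix an embedding of $E$ into $\mathbb P^2(\mathbb C)$ as a plane cubic curve. Then for every $f\in K\setminus\{0,1\}$, the element $\beta(f,1-f)\in\mathbb Z[E]^-$ lies in the subgroup of $\mathbb Z[E]^-$ generated by all elements $\beta(\varphi,1-\varphi)$, where $\varphi$ ranges over the functions $h_l/h_m$ (restricted to $E$) attached to triples of distinct lines $l,m,n\subset\mathbb P^2(\mathbb C)$ passing through a common point not lying on $E$, with homogeneous linear equations $h_l,h_m,h_n$ satisfying $h_m=h_n+h_l$ (so that $1-\varphi=h_n/h_m$).
   Context: $E$ carries its group law from $\mathbb C/(\mathbb Z+\mathbb Z\tau)$. $\mathbb Z[E]$ is the free abelian group on the points of $E$ (generators written $[\xi]$), and $\mathbb Z[E]^-$ is its quotient by the subgroup generated by all $[\xi]+[-\xi]$, $\xi\in E$ (the "antisymmetry relations"). For nonzero $f,g\in K$ with divisors $(f)=\sum_i n_i[x_i]$ and $(g)=\sum_j m_j[y_j]$, set $\beta(f,g)=\sum_{i,j}n_im_j[x_i-y_j]\in\mathbb Z[E]^-$. For a non-constant $f$ of degree $n$ with $(f)=\sum_{i=1}^n([\alpha_i]-[\gamma_i])$ and $(1-f)=\sum_{i=1}^n([\beta_i]-[\gamma_i])$, the element $\beta(f,1-f)$ encodes the elliptic Bloch relation $\sum_{i,j}\big(D_\tau(\alpha_i-\beta_j)+D_\tau(\beta_i-\gamma_j)+D_\tau(\gamma_i-\alpha_j)\big)=0$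 for Bloch's elliptic dilogarithm $D_\tau(\xi)=\sum_{n\in\mathbb Z}D(e^{2\pi i\xi+2\pi i\tau n})$, where $D(z)=\operatorname{Im}\mathrm{Li}_2(z)+\arg(1-z)\ln|z|$ is the Bloch–Wigner dilogarithm; $D_\tau$ satisfies $D_\tau(\xi)+D_\tau(-\xi)=0$ and thus induces a homomorphism $\mathbb Z[E]^-\to\mathbb R$. The generators $\beta(h_l/h_m,h_n/h_m)$ encode the relation $\sum_{i,j=1}^3\big(D_\tau(\alpha_i-\beta_j)+D_\tau(\beta_i-\gamma_j)+D_\tau(\gamma_i-\alpha_j)\big)=0$, where $\alpha_i,\beta_i,\gamma_i$ are the intersection points (with multiplicity) of $l,n,m$ respectively with $E$. *)

theory Defs
  imports
    "HOL-Complex_Analysis.Complex_Analysis"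
    "HOL-Algebra.Free_Abelian_Groups"
begin

definition complex_group :: "complex monoid" where
  "complex_group = \<lparr>carrier = UNIV, monoid.mult = (+), one = 0\<rparr>"

definition period_lattice :: "complex \<Rightarrow> complex set" where
  "period_lattice \<tau> = {of_int a + of_int b * \<tau> | a b. True}"

definition elliptic_curve :: "complex \<Rightarrow> complex set monoid" where
  "elliptic_curve \<tau> = complex_group Mod period_lattice \<tau>"

definition pt :: "complex \<Rightarrow> complex \<Rightarrow> complex set" where
  "pt \<tau> z = period_lattice \<tau> #>\<^bsub>complex_group\<^esub> z"

text \<open>
  Functions on the curve are represented by doubly periodic functions on the plane, normalised
  by removing all removable singularities and taking the value \<open>0\<close> at poles.  With this
  normalisation distinct elements of the set are distinct meromorphic functions.
\<close>
definition function_field :: "complex \<Rightarrow> (complex \<Rightarrow> complex) set" where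
  "function_field \<tau> =
     {f. f nicely_meromorphic_on UNIV \<and> (\<forall>w\<in>period_lattice \<tau>. \<forall>z. f (z + w) = f z)}"

text \<open>
  \<^const>\<open>zorder\<close> depends only on the values in a punctured neighbourhood, so the divisor of a
  function such as \<open>\<lambda>z. 1 - f z\<close> is correct even though its value at a pole of \<open>f\<close> need not
  be the normalised one.
\<close>
definition ord_at :: "(complex \<Rightarrow> complex) \<Rightarrow> complex set \<Rightarrow> int" where
  "ord_at f x = zorder f (SOME z. z \<in> x)"

definition divisor :: "complex \<Rightarrow> (complex \<Rightarrow> complex) \<Rightarrow> complex set \<Rightarrow>\<^sub>0 int" where
  "divisor \<tau> f =
     (\<Sum>x\<in>{x \<in> carrier (elliptic_curve \<tau>). ord_at f x \<noteq> 0}. frag_cmul (ord_at f x) (frag_of x))"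

definition point_diff :: "complex \<Rightarrow> complex set \<Rightarrow> complex set \<Rightarrow> complex set" where
  "point_diff \<tau> x y = x \<otimes>\<^bsub>elliptic_curve \<tau>\<^esub> (inv\<^bsub>elliptic_curve \<tau>\<^esub> y)"

definition ZE :: "complex \<Rightarrow> (complex set \<Rightarrow>\<^sub>0 int) monoid" where
  "ZE \<tau> = free_Abelian_group (carrier (elliptic_curve \<tau>))"

definition antisymmetry_relations :: "complex \<Rightarrow> (complex set \<Rightarrow>\<^sub>0 int) set" where
  "antisymmetry_relations \<tau> =
     generate (ZE \<tau>)
       {frag_of \<xi> + frag_of (inv\<^bsub>elliptic_curve \<tau>\<^esub> \<xi>) | \<xi>. \<xi> \<in> carrier (elliptic_curve \<tau>)}"

definition ZE_minus :: "complex \<Rightarrow> (complex set \<Rightarrow>\<^sub>0 int) set monoid" where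
  "ZE_minus \<tau> = ZE \<tau> Mod antisymmetry_relations \<tau>"

text \<open>The bilinear extension of \<open>([x], [y]) \<mapsto> [x - y]\<close> at the two divisors, as a coset.\<close>
definition bloch_beta ::
  "complex \<Rightarrow> (complex \<Rightarrow> complex) \<Rightarrow> (complex \<Rightarrow> complex) \<Rightarrow> (complex set \<Rightarrow>\<^sub>0 int) set" where
  "bloch_beta \<tau> f g =
     antisymmetry_relations \<tau> #>\<^bsub>ZE \<tau>\<^esub>
       frag_extend (\<lambda>x. frag_extend (\<lambda>y. frag_of (point_diff \<tau> x y)) (divisor \<tau> g)) (divisor \<tau> f)"

text \<open>
  Points of the projective plane are the one-dimensional subspaces of \<open>\<complex>\<^sup>3\<close>; a system of
  homogeneous coordinates of a point is any nonzero vector in it.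
\<close>
definition proj_plane :: "(complex ^ 3) set set" where
  "proj_plane = {vec.span {x} | x. x \<noteq> 0}"

definition hom_coords :: "(complex ^ 3) set \<Rightarrow> complex ^ 3" where
  "hom_coords p = (SOME x. x \<in> p \<and> x \<noteq> 0)"

definition cubic_form :: "(nat \<Rightarrow> nat \<Rightarrow> complex) \<Rightarrow> complex ^ 3 \<Rightarrow> complex" where
  "cubic_form c x = (\<Sum>i\<le>3. \<Sum>j\<le>3 - i. c i j * x $ 1 ^ i * x $ 2 ^ j * x $ 3 ^ (3 - i - j))"

definition plane_cubic :: "(complex ^ 3) set set \<Rightarrow> bool" where
  "plane_cubic C \<longleftrightarrow>
     (\<exists>c. (\<exists>i j. i + j \<le> 3 \<and> c i j \<noteq> 0) \<and>
          C = {p \<in> proj_plane. \<forall>x\<in>p. cubic_form c x = 0})"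

definition local_lift ::
  "complex \<Rightarrow> (complex set \<Rightarrow> (complex ^ 3) set) \<Rightarrow> complex set \<Rightarrow> (complex \<Rightarrow> complex ^ 3) \<Rightarrow> bool"
where
  "local_lift \<tau> \<Phi> U F \<longleftrightarrow>
     open U \<and> (\<forall>i. (\<lambda>z. F z $ i) holomorphic_on U) \<and>
     (\<forall>z\<in>U. F z \<noteq> 0 \<and> \<Phi> (pt \<tau> z) = vec.span {F z})"

text \<open>
  A holomorphic embedding: holomorphic, injective, and immersive.  In homogeneous coordinates
  \<open>F\<close> the differential of the map to the projective plane is injective at \<open>z\<close> iff \<open>F' z\<close> is
  not a multiple of \<open>F z\<close>.  The source is compact, so this is a homeomorphism onto its image.
\<close>
definition holomorphic_embedding ::
  "complex \<Rightarrow> (complex set \<Rightarrow> (complex ^ 3) set) \<Rightarrow> bool" where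
  "holomorphic_embedding \<tau> \<Phi> \<longleftrightarrow>
     inj_on \<Phi> (carrier (elliptic_curve \<tau>)) \<and>
     (\<forall>z. \<exists>U F. z \<in> U \<and> local_lift \<tau> \<Phi> U F \<and>
        (\<chi> i. deriv (\<lambda>w. F w $ i) z) \<notin> vec.span {F z})"

definition plane_cubic_embedding ::
  "complex \<Rightarrow> (complex set \<Rightarrow> (complex ^ 3) set) \<Rightarrow> bool" where
  "plane_cubic_embedding \<tau> \<Phi> \<longleftrightarrow>
     holomorphic_embedding \<tau> \<Phi> \<and> plane_cubic (\<Phi> ` carrier (elliptic_curve \<tau>))"

definition line_equation :: "(complex ^ 3 \<Rightarrow> complex) \<Rightarrow> (complex ^ 3) set set \<Rightarrow> bool" where
  "line_equation h l \<longleftrightarrow>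
     Vector_Spaces.linear (*s) (*) h \<and> (\<exists>x. h x \<noteq> 0) \<and>
     l = {p \<in> proj_plane. \<forall>x\<in>p. h x = 0}"

text \<open>
  The restriction of \<open>h / k\<close> to the curve; the quotient does not depend on the choice of
  homogeneous coordinates.
\<close>
definition form_ratio ::
  "complex \<Rightarrow> (complex set \<Rightarrow> (complex ^ 3) set) \<Rightarrow> (complex ^ 3 \<Rightarrow> complex) \<Rightarrow>
     (complex ^ 3 \<Rightarrow> complex) \<Rightarrow> complex \<Rightarrow> complex" where
  "form_ratio \<tau> \<Phi> h k z = (let x = hom_coords (\<Phi> (pt \<tau> z)) in h x / k x)"

definition line_functions ::
  "complex \<Rightarrow> (complex set \<Rightarrow> (complex ^ 3) set) \<Rightarrow> (complex \<Rightarrow> complex) set" where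
  "line_functions \<tau> \<Phi> =
     {form_ratio \<tau> \<Phi> hl hm | hl hm. \<exists>hn l m n P.
        line_equation hl l \<and> line_equation hm m \<and> line_equation hn n \<and>
        l \<noteq> m \<and> m \<noteq> n \<and> l \<noteq> n \<and>
        P \<in> l \<and> P \<in> m \<and> P \<in> n \<and> P \<notin> \<Phi> ` carrier (elliptic_curve \<tau>) \<and>
        (\<forall>x. hm x = hn x + hl x)}"

end

(*
  Elliptic functions are quotients of sections F with F(z+1) = F(z), F(z+\<tau>) = c e(-n z) F(z).  By
  Liouville such an F is, up to an exponential, a product of n translates of one theta function, and c
  determines the sum of its zeros.  For F + G + K = 0 write T(F,G,K) for \<beta>(-F/K, -G/K); every
  \<beta>(f, 1-f) has this shape, and T does not change if a common factor is cancelled.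

  The proof reduces all T to degree 3 by induction on n.  Degrees \<le> 2 vanish by antisymmetry.  For
  n \<ge> 4 take a second relation A + B + C = 0 of degree m \<le> 3 whose terms share zeros with F, G, K,
  two with each (m = 3), or two, two and one (m = 2).  The five-term relation expresses T(F,G,K) by
  T(A,B,C) and three terms of degree n + m, each of which has more than m common zeros, so that
  cancelling leaves degree < n.  The auxiliary relation exists because the three lines spanned by the
  prescribed pairs of zeros are concurrent for a suitable embedding of degree 3.

  In degree 3, \<beta> is invariant under translation, and after a translation the pencil spanned by F and
  G consists of linear forms of the given embedding, i.e. of the lines through a point off the curve.
*)

theory Submission
  imports Defs
begin

section \<open>Theta function\<close>

text \<open>A five-term step replaces degree \<open>n\<close> by \<open>n + m - p - q\<close>, where
  \<open>p\<close> and \<open>q\<close> count shared zeros. A gain requires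
  \<open>p + q > m\<close>, and the auxiliary relation must itself have degree \<open>m < n\<close>;
  with \<open>m = 3\<close> and two shared zeros per term this works from \<open>n = 4\<close> on.
  Concurrency is one equation in the multiplier of the auxiliary relation, namely the vanishing of a
  theta section of degree 2, which always has a solution. The construction asks for two distinct
  zeros of the third term; a term with a single multiple zero is handled through a fourth member of
  the pencil.

  The five-term identity needs an alternating form, while antisymmetry alone controls only twice the
  diagonal. On divisors of degree 0 the diagonal is, modulo antisymmetry, an even multiple of [0],
  and 2[0] is a relation.

  The degree of the given embedding is not part of the data. It is at most 3 because a line through
  a point off the cubic meets it in at most 3 points, and at least 3 because injectivity and
  immersivity forbid fewer sections. Translation by \<open>t\<close> multiplies multipliers in
  degree 3 by \<open>ee (3 * t)\<close>, so each can be moved to that of the embedding.\<close>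

definition ee :: "complex \<Rightarrow> complex" where
  "ee z = exp (2 * of_real pi * \<i> * z)"

lemma ee_0 [simp]: "ee 0 = 1"
  by (simp add: ee_def)

lemma ee_nonzero [simp]: "ee z \<noteq> 0"
  by (simp add: ee_def)

lemma ee_add: "ee (a + b) = ee a * ee b"
  by (simp add: ee_def algebra_simps exp_add)

lemma ee_minus: "ee (- a) = inverse (ee a)"
  by (simp add: ee_def exp_minus)

lemma ee_diff: "ee (a - b) = ee a / ee b"
  by (simp add: ee_def algebra_simps exp_diff)

lemma ee_eq_1_iff: "ee z = 1 \<longleftrightarrow> z \<in> \<int>"
proof -
  have "ee z = 1 \<longleftrightarrow> (\<exists>n::int. Re z = of_int n) \<and> Im z = 0"
    by (auto simp: ee_def exp_eq_1)
  also have "\<dots> \<longleftrightarrow> z \<in> \<int>"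
    by (auto simp: Ints_def complex_eq_iff)
  finally show ?thesis .
qed

lemma ee_of_int [simp]: "ee (of_int k) = 1"
  by (simp add: ee_eq_1_iff)

lemma ee_1 [simp]: "ee 1 = 1"
  using ee_of_int[of 1] by simp

lemma ee_surj: "w \<noteq> 0 \<Longrightarrow> \<exists>z. ee z = w"
  by (rule exI[of _ "ln w / (2 * of_real pi * \<i>)"]) (simp add: ee_def)

lemma ee_of_nat_mult: "ee (of_nat n * z) = ee z ^ n"
  by (simp add: ee_def exp_of_nat_mult[symmetric] algebra_simps)

lemma ee_has_field_derivative [derivative_intros]:
  "(f has_field_derivative f') (at z) \<Longrightarrow>
     ((\<lambda>z. ee (f z)) has_field_derivative (2 * of_real pi * \<i> * ee (f z) * f')) (at z)"
  unfolding ee_def by (auto intro!: derivative_eq_intros)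

lemma ee_holomorphic [holomorphic_intros]:
  "f holomorphic_on A \<Longrightarrow> (\<lambda>z. ee (f z)) holomorphic_on A"
  unfolding ee_def by (intro holomorphic_intros)

locale torus =
  fixes \<tau> :: complex
  assumes Im_tau_pos: "Im \<tau> > 0"
begin

abbreviation "\<Lambda> \<equiv> period_lattice \<tau>"

lemma lattice_0 [simp]: "0 \<in> \<Lambda>"
  unfolding period_lattice_def by (rule CollectI, rule exI[of _ 0], rule exI[of _ 0]) simp

lemma lattice_1 [simp]: "1 \<in> \<Lambda>"
  unfolding period_lattice_def by (rule CollectI, rule exI[of _ 1], rule exI[of _ 0]) simp

lemma lattice_tau [simp]: "\<tau> \<in> \<Lambda>"
  unfolding period_lattice_def by (rule CollectI, rule exI[of _ 0], rule exI[of _ 1]) simp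

lemma lattice_add: "a \<in> \<Lambda> \<Longrightarrow> b \<in> \<Lambda> \<Longrightarrow> a + b \<in> \<Lambda>"
proof -
  assume "a \<in> \<Lambda>" "b \<in> \<Lambda>"
  then obtain i j k l where "a = of_int i + of_int j * \<tau>" "b = of_int k + of_int l * \<tau>"
    unfolding period_lattice_def by blast
  hence "a + b = of_int (i + k) + of_int (j + l) * \<tau>"
    by (simp add: algebra_simps)
  thus ?thesis unfolding period_lattice_def by blast
qed

lemma lattice_uminus: "a \<in> \<Lambda> \<Longrightarrow> - a \<in> \<Lambda>"
proof -
  assume "a \<in> \<Lambda>"
  then obtain i j where "a = of_int i + of_int j * \<tau>"
    unfolding period_lattice_def by blast
  hence "- a = of_int (- i) + of_int (- j) * \<tau>" by simp
  thus ?thesis unfolding period_lattice_def by blast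
qed

lemma lattice_uminus_iff: "- a \<in> \<Lambda> \<longleftrightarrow> a \<in> \<Lambda>"
  using lattice_uminus[of a] lattice_uminus[of "- a"] by auto

lemma lattice_diff: "a \<in> \<Lambda> \<Longrightarrow> b \<in> \<Lambda> \<Longrightarrow> a - b \<in> \<Lambda>"
  using lattice_add[of a "- b"] lattice_uminus[of b] by simp

lemma lattice_minus_commute: "a - b \<in> \<Lambda> \<longleftrightarrow> b - a \<in> \<Lambda>"
  using lattice_uminus_iff[of "a - b"] by simp

lemma lattice_iff: "w \<in> \<Lambda> \<longleftrightarrow> (\<exists>n::int. w - of_int n * \<tau> \<in> \<int>)"
proof
  assume "w \<in> \<Lambda>"
  then obtain a b where "w = of_int a + of_int b * \<tau>"
    unfolding period_lattice_def by blast
  thus "\<exists>n::int. w - of_int n * \<tau> \<in> \<int>" by (intro exI[of _ b]) auto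
next
  assume "\<exists>n::int. w - of_int n * \<tau> \<in> \<int>"
  then obtain n :: int and m where "w - of_int n * \<tau> = of_int m"
    by (auto elim!: Ints_cases)
  hence "w = of_int m + of_int n * \<tau>" by (simp add: algebra_simps)
  thus "w \<in> \<Lambda>" unfolding period_lattice_def by blast
qed

lemma half_not_in_lattice: "1 / 2 \<notin> \<Lambda>"
proof
  assume "1 / 2 \<in> \<Lambda>"
  then obtain a b where ab: "1 / 2 = of_int a + of_int b * \<tau>"
    unfolding period_lattice_def by blast
  from ab have "Im (1 / 2) = Im (of_int a + of_int b * \<tau>)" by (rule arg_cong)
  hence "b = 0" using Im_tau_pos by simp
  with ab have "of_int (2 * a) = (of_int 1 :: complex)" by (simp add: field_simps)
  hence "2 * a = 1" by (simp only: of_int_eq_iff)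
  thus False by presburger
qed

definition nome :: complex where "nome = ee \<tau>"

lemma nome_nonzero [simp]: "nome \<noteq> 0"
  by (simp add: nome_def)

lemma norm_nome_less_1: "norm nome < 1"
  using Im_tau_pos by (simp add: nome_def ee_def)

text \<open>The q-Pochhammer symbol (w; q) of infinite length, with q = \<open>nome\<close>.\<close>

definition qprod :: "complex \<Rightarrow> complex" where
  "qprod w = prodinf (\<lambda>n. 1 - nome ^ n * w)"

lemma qprod_convergent: "convergent_prod (\<lambda>n. 1 - nome ^ n * w)"
proof -
  have "summable (\<lambda>n. norm w * norm nome ^ n)"
    by (intro summable_mult summable_geometric) (use norm_nome_less_1 in auto)
  also have "(\<lambda>n. norm w * norm nome ^ n) = (\<lambda>n. norm (1 - nome ^ n * w - 1))"
    by (simp add: norm_mult norm_power mult.commute)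
  finally have "abs_convergent_prod (\<lambda>n. 1 - nome ^ n * w)"
    by (rule summable_imp_abs_convergent_prod)
  thus ?thesis by (rule abs_convergent_prod_imp_convergent_prod)
qed

lemma qprod_uniform_limit:
  "uniform_limit (cball 0 R) (\<lambda>N w. \<Prod>n<N. 1 - nome ^ n * w) qprod sequentially"
proof -
  have "uniformly_convergent_on (cball 0 R) (\<lambda>N w. \<Prod>n<N. 1 - nome ^ n * w)"
  proof (rule uniformly_convergent_on_prod')
    show "uniformly_convergent_on (cball 0 R) (\<lambda>N w. \<Sum>n<N. norm (1 - nome ^ n * w - 1))"
    proof (rule Weierstrass_m_test'_ev)
      show "\<forall>\<^sub>F n in sequentially. \<forall>w\<in>cball 0 R. norm (norm (1 - nome ^ n * w - 1)) \<le> R * norm nome ^ n"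
      proof (intro always_eventually allI ballI)
        fix n and w :: complex assume "w \<in> cball 0 R"
        hence "norm nome ^ n * norm w \<le> norm nome ^ n * R"
          by (intro mult_left_mono) auto
        thus "norm (norm (1 - nome ^ n * w - 1)) \<le> R * norm nome ^ n"
          by (simp add: norm_mult norm_power mult.commute)
      qed
      show "summable (\<lambda>n. R * norm nome ^ n)"
        by (intro summable_mult summable_geometric) (use norm_nome_less_1 in auto)
    qed
  qed (auto intro!: continuous_intros)
  then obtain g where g: "uniform_limit (cball 0 R) (\<lambda>N w. \<Prod>n<N. 1 - nome ^ n * w) g at_top"
    by (auto simp: uniformly_convergent_on_def)
  also have "?this \<longleftrightarrow> uniform_limit (cball 0 R) (\<lambda>N w. \<Prod>n<N. 1 - nome ^ n * w) qprod at_top"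
  proof (intro uniform_limit_cong)
    fix w :: complex assume w: "w \<in> cball 0 R"
    have "(\<lambda>N. \<Prod>n<Suc N. 1 - nome ^ n * w) \<longlonglongrightarrow> g w"
      by (rule LIMSEQ_Suc[OF tendsto_uniform_limitI[OF g w]])
    moreover have "(\<lambda>N. \<Prod>n<Suc N. 1 - nome ^ n * w) \<longlonglongrightarrow> qprod w"
      using convergent_prod_LIMSEQ[OF qprod_convergent[of w]]
      unfolding lessThan_Suc_atMost qprod_def by simp
    ultimately show "g w = qprod w"
      using tendsto_unique by force
  qed auto
  finally show ?thesis .
qed

lemma qprod_entire: "qprod holomorphic_on UNIV"
proof (rule holomorphic_uniform_sequence)
  fix z :: complex
  have "uniform_limit (cball z 1) (\<lambda>N w. \<Prod>n<N. 1 - nome ^ n * w) qprod sequentially"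
    by (rule uniform_limit_on_subset[OF qprod_uniform_limit[of "norm z + 1"]])
       (simp add: cball_subset_cball_iff)
  thus "\<exists>d>0. cball z d \<subseteq> UNIV \<and>
          uniform_limit (cball z d) (\<lambda>N w. \<Prod>n<N. 1 - nome ^ n * w) qprod sequentially"
    by (intro exI[of _ 1]) auto
qed (auto intro!: holomorphic_intros)

lemma qprod_holomorphic [holomorphic_intros]:
  "f holomorphic_on A \<Longrightarrow> (\<lambda>z. qprod (f z)) holomorphic_on A"
  using holomorphic_on_compose_gen[of f A qprod UNIV] qprod_entire by (auto simp: o_def)

lemma qprod_eq_0_iff: "qprod w = 0 \<longleftrightarrow> (\<exists>n. nome ^ n * w = 1)"
proof -
  have "(\<lambda>n. 1 - nome ^ n * w) has_prod qprod w"
    using qprod_convergent[of w] unfolding qprod_def by (simp add: convergent_prod_has_prod)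
  thus ?thesis by (subst has_prod_eq_0_iff) auto
qed

lemma qprod_unfold: "qprod w = (1 - w) * qprod (nome * w)"
proof (cases "w = 1")
  case True
  hence "qprod w = 0" unfolding qprod_eq_0_iff by (intro exI[of _ 0]) simp
  with True show ?thesis by simp
next
  case False
  have "qprod w = prodinf (\<lambda>n. 1 - nome ^ (n + 1) * w) * (\<Prod>n<1. 1 - nome ^ n * w)"
    unfolding qprod_def
    by (rule prodinf_split_initial_segment[OF qprod_convergent]) (use False in auto)
  thus ?thesis by (simp add: qprod_def algebra_simps)
qed

text \<open>The Jacobi theta product without its constant factor. The second product starts at the
  first power of \<open>nome\<close>, so that \<open>1 - ee z\<close> occurs only once and the zeros
  on the lattice are simple. The period 1 is exact; all quasi-periodicity sits in
  \<open>\<tau>\<close>.\<close>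

definition theta :: "complex \<Rightarrow> complex" where
  "theta z = qprod (ee z) * qprod (nome / ee z)"

lemma theta_holomorphic [holomorphic_intros]:
  "f holomorphic_on A \<Longrightarrow> (\<lambda>z. theta (f z)) holomorphic_on A"
  unfolding theta_def by (intro holomorphic_intros) auto

lemma theta_add_1: "theta (z + 1) = theta z"
  by (simp add: theta_def ee_add)

lemma theta_add_tau: "theta (z + \<tau>) = - ee (- z) * theta z"
proof -
  define u where "u = ee z"
  have [simp]: "u \<noteq> 0" by (simp add: u_def)
  have 1: "qprod u = (1 - u) * qprod (nome * u)"
    by (rule qprod_unfold)
  have 2: "qprod (1 / u) = (1 - 1 / u) * qprod (nome / u)"
    using qprod_unfold[of "1 / u"] by simp
  have "theta (z + \<tau>) = qprod (nome * u) * qprod (1 / u)"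
    by (simp add: theta_def ee_add nome_def[symmetric] u_def mult.commute)
  also have "\<dots> = - (1 / u) * ((1 - u) * qprod (nome * u) * qprod (nome / u))"
    unfolding 2 by (simp add: field_simps)
  also have "\<dots> = - ee (- z) * theta z"
    using 1 by (simp add: theta_def u_def[symmetric] ee_minus divide_inverse)
  finally show ?thesis .
qed

text \<open>The first product vanishes at the lattice points whose \<open>\<tau>\<close>-coordinate
  is at most 0, the second at those where it is positive.\<close>

lemma theta_eq_0_iff: "theta z = 0 \<longleftrightarrow> z \<in> \<Lambda>"
proof -
  have 1: "nome ^ n * ee z = 1 \<longleftrightarrow> z - of_int (- int n) * \<tau> \<in> \<int>" for n
  proof -
    have "nome ^ n * ee z = ee (z - of_int (- int n) * \<tau>)"
      by (simp add: nome_def ee_of_nat_mult[symmetric] ee_add[symmetric] algebra_simps)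
    thus ?thesis by (simp add: ee_eq_1_iff)
  qed
  have 2: "nome ^ n * (nome / ee z) = 1 \<longleftrightarrow> z - of_int (int (Suc n)) * \<tau> \<in> \<int>" for n
  proof -
    have "nome ^ n * (nome / ee z) = ee (of_nat (Suc n) * \<tau>) / ee z"
      by (simp add: nome_def ee_of_nat_mult[symmetric] ee_add[symmetric] algebra_simps)
    also have "\<dots> = ee (- (z - of_int (int (Suc n)) * \<tau>))"
      by (simp add: ee_diff[symmetric])
    finally show ?thesis by (simp only: ee_eq_1_iff minus_in_Ints_iff)
  qed
  have "theta z = 0 \<longleftrightarrow> (\<exists>n. z - of_int (- int n) * \<tau> \<in> \<int>) \<or>
                       (\<exists>n. z - of_int (int (Suc n)) * \<tau> \<in> \<int>)"
    unfolding theta_def mult_eq_0_iff qprod_eq_0_iff 1 2 ..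
  also have "\<dots> \<longleftrightarrow> (\<exists>n::int. z - of_int n * \<tau> \<in> \<int>)"
  proof (safe)
    fix k :: int assume k: "z - of_int k * \<tau> \<in> \<int>"
      and nk: "\<nexists>n. z - of_int (int (Suc n)) * \<tau> \<in> \<int>"
    have "k \<le> 0"
    proof (rule ccontr)
      assume "\<not> k \<le> 0"
      hence "int (Suc (nat (k - 1))) = k" by auto
      hence "\<exists>n. z - of_int (int (Suc n)) * \<tau> \<in> \<int>"
        using k by (intro exI[of _ "nat (k - 1)"]) (simp only:)
      with nk show False by blast
    qed
    hence "- int (nat (- k)) = k" by auto
    thus "\<exists>n. z - of_int (- int n) * \<tau> \<in> \<int>"
      using k by (intro exI[of _ "nat (- k)"]) (simp only:)
  qed blast+
  also have "\<dots> \<longleftrightarrow> z \<in> \<Lambda>" by (rule lattice_iff[symmetric])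
  finally show ?thesis .
qed

lemma theta_0 [simp]: "theta 0 = 0"
  by (simp add: theta_eq_0_iff)

text \<open>Isolates the only factor of the product that vanishes at 0, so that the derivative there
  can be read off.\<close>

lemma theta_factor_at_0:
  obtains g where "g holomorphic_on UNIV" "g 0 \<noteq> 0" "\<And>z. theta z = (1 - ee z) * g z"
proof
  show "(\<lambda>z. qprod (nome * ee z) * qprod (nome / ee z)) holomorphic_on UNIV"
    by (intro holomorphic_intros) auto
  have "qprod nome \<noteq> 0"
  proof
    assume "qprod nome = 0"
    then obtain n where "nome ^ Suc n = 1" by (auto simp: qprod_eq_0_iff mult.commute)
    hence "norm nome ^ Suc n = 1" by (metis norm_one norm_power)
    moreover have "norm nome ^ Suc n < 1"
      by (intro power_Suc_less_one) (use norm_nome_less_1 in auto)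
    ultimately show False by simp
  qed
  thus "qprod (nome * ee 0) * qprod (nome / ee 0) \<noteq> 0" by simp
  show "theta z = (1 - ee z) * (qprod (nome * ee z) * qprod (nome / ee z))" for z
    unfolding theta_def by (subst qprod_unfold) simp
qed

lemma deriv_theta_0: "deriv theta 0 \<noteq> 0"
proof -
  obtain g where g: "g holomorphic_on UNIV" "g 0 \<noteq> 0" "\<And>z. theta z = (1 - ee z) * g z"
    by (rule theta_factor_at_0) blast
  have gd: "(g has_field_derivative deriv g 0) (at 0)"
    using g(1) by (simp add: holomorphic_derivI)
  have "((\<lambda>z. (1 - ee z) * g z) has_field_derivative
          - (2 * of_real pi * \<i> * g 0)) (at 0)"
    by (auto intro!: derivative_eq_intros gd)
  also have "(\<lambda>z. (1 - ee z) * g z) = theta" using g(3) by auto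
  finally have "deriv theta 0 = - (2 * of_real pi * \<i> * g 0)" by (rule DERIV_imp_deriv)
  thus ?thesis using g(2) by simp
qed

end

section \<open>Sections of theta type\<close>

lemma entire_mult_cancel:
  fixes F A B :: "complex \<Rightarrow> complex"
  assumes hol: "F holomorphic_on UNIV" "A holomorphic_on UNIV" "B holomorphic_on UNIV"
    and nz: "F \<noteq> (\<lambda>_. 0)" and eq: "\<And>z. F z * A z = F z * B z"
  shows "A = B"
proof
  fix z
  obtain z0 where z0: "F z0 \<noteq> 0" using nz by auto
  have "open (UNIV \<inter> F -` (- {0}))"
    by (intro continuous_open_preimage holomorphic_on_imp_continuous_on hol) auto
  hence "open (F -` (- {0}))" by simp
  thus "A z = B z"
    by (rule analytic_continuation_open[of "F -` (- {0})" UNIV A B])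
       (use z0 hol eq in auto)
qed

lemma entire_mult_nonzero:
  fixes F G :: "complex \<Rightarrow> complex"
  assumes "F holomorphic_on UNIV" "G holomorphic_on UNIV" "F \<noteq> (\<lambda>_. 0)" "G \<noteq> (\<lambda>_. 0)"
  shows "(\<lambda>z. F z * G z) \<noteq> (\<lambda>_. 0)"
proof
  assume "(\<lambda>z. F z * G z) = (\<lambda>_. 0)"
  hence "G = (\<lambda>_. 0)"
    by (intro entire_mult_cancel[of F]) (use assms in \<open>auto dest: fun_cong\<close>)
  with assms show False by simp
qed

lemma entire_eventually_nonzero:
  fixes F :: "complex \<Rightarrow> complex"
  assumes "F holomorphic_on UNIV" "F \<noteq> (\<lambda>_. 0)"
  shows "eventually (\<lambda>w. F w \<noteq> 0) (at z)"
proof -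
  obtain z0 where "F z0 \<noteq> 0" using assms(2) by auto
  thus ?thesis
    using non_zero_neighbour_alt[OF assms(1) open_UNIV connected_UNIV, of z z0] by auto
qed

text \<open>Because the zeros of \<open>G\<close> are simple, l'Hopital's rule gives the quotient a
  limit at each of them, so all its singularities are removable.\<close>

lemma entire_divide_simple_zeros:
  fixes F G :: "complex \<Rightarrow> complex"
  assumes hol: "F holomorphic_on UNIV" "G holomorphic_on UNIV" and nz: "G \<noteq> (\<lambda>_. 0)"
    and zeros: "\<And>z. G z = 0 \<Longrightarrow> F z = 0 \<and> deriv G z \<noteq> 0"
  obtains H where "H holomorphic_on UNIV" "\<And>z. F z = G z * H z"
proof -
  define H where "H = remove_sings (\<lambda>z. F z / G z)"
  have "F analytic_on UNIV" "G analytic_on UNIV"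
    using hol by (simp_all add: analytic_on_open)
  hence FG: "F analytic_on S" "G analytic_on S" for S
    by (auto intro: analytic_on_subset)
  have an: "(\<lambda>z. F z / G z) analytic_on {z}" if "G z \<noteq> 0" for z
    using that by (auto intro!: analytic_intros FG)
  have lim: "\<exists>c. (\<lambda>z. F z / G z) \<midarrow>z\<rightarrow> c" for z
  proof (cases "G z = 0")
    case True
    have "(\<lambda>w. F w / G w) \<midarrow>z\<rightarrow> deriv F z / deriv G z"
      by (rule lhopital_complex_simple[of _ "deriv F z" _ _ "deriv G z"])
         (use True zeros[OF True] hol in \<open>auto simp: holomorphic_derivI\<close>)
    thus ?thesis by blast
  next
    case False
    show ?thesis using analytic_at_imp_isCont[OF an[OF False]] by (auto simp: isCont_def)
  qed
  have mero: "(\<lambda>z. F z / G z) meromorphic_on UNIV"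
    by (intro meromorphic_intros analytic_on_imp_meromorphic_on FG)
  have "H analytic_on {z}" for z
    unfolding H_def using remove_sings_analytic_at lim[of z] mero
    by (metis meromorphic_on_isolated_singularity meromorphic_on_subset top_greatest)
  hence "H analytic_on UNIV"
    using analytic_on_analytic_at by blast
  hence "H holomorphic_on UNIV" by (rule analytic_imp_holomorphic)
  moreover have "F z = G z * H z" for z
    using an[of z] zeros[of z] by (cases "G z = 0") (auto simp: H_def)
  ultimately show ?thesis by (rule that)
qed

context torus
begin

text \<open>Differences as the single closure step cover sums and negatives at once, so that each
  use has to treat one composition only.\<close>

lemma lattice_induct [consumes 1, case_names one tau diff]:
  assumes "w \<in> \<Lambda>" "P 1" "P \<tau>" "\<And>a b. P a \<Longrightarrow> P b \<Longrightarrow> P (a - b)"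
  shows "P w"
proof -
  have P0: "P 0" using assms(4)[OF assms(2,2)] by simp
  have neg: "P (- a)" if "P a" for a using assms(4)[OF P0 that] by simp
  have add: "P (a + b)" if "P a" "P b" for a b
    using assms(4)[OF that(1) neg[OF that(2)]] by simp
  have nat: "P (of_nat n * a)" if "P a" for n a
    by (induction n) (auto simp: algebra_simps intro: P0 add that)
  have int: "P (of_int n * a)" if "P a" for n a
    by (cases n rule: int_cases2) (use nat[OF that] neg[OF nat[OF that]] in auto)
  obtain a b where "w = of_int a * 1 + of_int b * \<tau>"
    using assms(1) unfolding period_lattice_def by auto
  thus ?thesis by (auto intro!: add int assms(2,3) simp del: mult_1_right)
qed

text \<open>Closed, hence compact, at the price that classes on the boundary have several
  representatives.\<close>

definition fund_domain :: "complex set" where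
  "fund_domain = (\<lambda>(s, t). of_real s + of_real t * \<tau>) ` ({0..1} \<times> {0..1})"

lemma compact_fund_domain: "compact fund_domain"
  unfolding fund_domain_def
  by (intro compact_continuous_image compact_Times)
     (auto simp: case_prod_unfold intro!: continuous_intros)

lemma lattice_translate_fund_domain:
  obtains w where "w \<in> \<Lambda>" "z + w \<in> fund_domain"
proof -
  define t where "t = Im z / Im \<tau>"
  define s where "s = Re z - t * Re \<tau>"
  have z: "z = of_real s + of_real t * \<tau>"
    using Im_tau_pos by (simp add: complex_eq_iff s_def t_def)
  define w where "w = of_int (- \<lfloor>s\<rfloor>) + of_int (- \<lfloor>t\<rfloor>) * \<tau>"
  have "z + w = of_real (frac s) + of_real (frac t) * \<tau>"
    by (simp add: z w_def frac_def algebra_simps)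
  hence "z + w \<in> fund_domain"
    unfolding fund_domain_def using frac_lt_1[of s] frac_lt_1[of t]
    by (intro image_eqI[of _ _ "(frac s, frac t)"]) (auto intro: less_imp_le)
  moreover have "w \<in> \<Lambda>" unfolding period_lattice_def w_def by blast
  ultimately show ?thesis using that by blast
qed

text \<open>Sections of a line bundle of degree \<open>n\<close> on the torus, pulled back to the
  plane; \<open>c\<close> fixes the multiplier within the degree. With \<open>c \<noteq> 0\<close>
  inside the set, membership alone permits division by the multiplier.\<close>

definition sect :: "int \<Rightarrow> complex \<Rightarrow> (complex \<Rightarrow> complex) set" where
  "sect n c = {F. c \<noteq> 0 \<and> F holomorphic_on UNIV \<and> (\<forall>z. F (z + 1) = F z) \<and>
                  (\<forall>z. F (z + \<tau>) = c * ee (- (of_int n * z)) * F z)}"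

lemma sectD:
  assumes "F \<in> sect n c"
  shows "c \<noteq> 0" "F holomorphic_on UNIV" "F (z + 1) = F z"
    "F (z + \<tau>) = c * ee (- (of_int n * z)) * F z"
  using assms by (auto simp: sect_def)

lemma sect_mult:
  assumes "F \<in> sect n c" "G \<in> sect m d"
  shows "(\<lambda>z. F z * G z) \<in> sect (n + m) (c * d)"
proof -
  have "ee (- (of_int (n + m) * z)) = ee (- (of_int n * z)) * ee (- (of_int m * z))" for z
    by (simp add: ee_add[symmetric] algebra_simps)
  thus ?thesis
    using assms unfolding sect_def by (auto intro!: holomorphic_intros)
qed

lemma sect_mult':
  assumes "F \<in> sect n c" "G \<in> sect m d" "k = n + m" "e = c * d"
  shows "(\<lambda>z. F z * G z) \<in> sect k e"
  using sect_mult[OF assms(1,2)] assms(3,4) by simp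

lemma sect_lincomb:
  assumes "F \<in> sect n c" "G \<in> sect n c"
  shows "(\<lambda>z. a * F z + b * G z) \<in> sect n c"
  using assms unfolding sect_def
  by (auto simp: algebra_simps intro!: holomorphic_intros)

lemma sect_cmult: "F \<in> sect n c \<Longrightarrow> (\<lambda>z. a * F z) \<in> sect n c"
  using sect_lincomb[of F n c F a 0] by simp

lemma sect_uminus: "F \<in> sect n c \<Longrightarrow> (\<lambda>z. - F z) \<in> sect n c"
  using sect_cmult[of F n c "-1"] by simp

lemma sect_add: "F \<in> sect n c \<Longrightarrow> G \<in> sect n c \<Longrightarrow> (\<lambda>z. F z + G z) \<in> sect n c"
  using sect_lincomb[of F n c G 1 1] by simp

lemma sect_diff: "F \<in> sect n c \<Longrightarrow> G \<in> sect n c \<Longrightarrow> (\<lambda>z. F z - G z) \<in> sect n c"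
  using sect_lincomb[of F n c G 1 "-1"] by simp

lemma sect_0_const: "(\<lambda>_. a) \<in> sect 0 1"
  by (simp add: sect_def)

lemma theta_sect: "(\<lambda>z. theta (z - a)) \<in> sect 1 (- ee a)"
proof -
  have "theta (z + 1 - a) = theta (z - a)" for z
    using theta_add_1[of "z - a"] by (simp add: algebra_simps)
  moreover have "theta (z + \<tau> - a) = - ee a * ee (- z) * theta (z - a)" for z
  proof -
    have "theta (z + \<tau> - a) = theta (z - a + \<tau>)" by (simp add: algebra_simps)
    thus ?thesis by (simp add: theta_add_tau ee_diff ee_minus divide_inverse)
  qed
  ultimately show ?thesis by (auto simp: sect_def intro!: holomorphic_intros)
qed

lemma theta_nonzero: "(\<lambda>z. theta (z - a)) \<noteq> (\<lambda>_. 0)"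
proof
  assume "(\<lambda>z. theta (z - a)) = (\<lambda>_. 0)"
  hence "theta (a + 1 / 2 - a) = 0" by (rule fun_cong)
  thus False using half_not_in_lattice by (simp add: theta_eq_0_iff)
qed

text \<open>For a general period only the shape of the factor matters: it has no zeros, so zero sets
  of sections are invariant under the lattice.\<close>

lemma sect_lattice:
  assumes "F \<in> sect n c" "w \<in> \<Lambda>"
  shows "\<exists>k C. C \<noteq> 0 \<and> (\<forall>z. F (z + w) = C * ee (of_int k * z) * F z)"
  using assms(2)
proof (induction rule: lattice_induct)
  case one
  show ?case by (rule exI[of _ 0], rule exI[of _ 1]) (simp add: sectD[OF assms(1)])
next
  case tau
  show ?case
    by (rule exI[of _ "- n"], rule exI[of _ c]) (simp add: sectD[OF assms(1)])
next
  case (diff a b)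
  then obtain k C l D where
    a: "C \<noteq> 0" "\<And>z. F (z + a) = C * ee (of_int k * z) * F z" and
    b: "D \<noteq> 0" "\<And>z. F (z + b) = D * ee (of_int l * z) * F z" by auto
  have "F (z + (a - b)) = (C / D * ee (of_int (l - k) * b)) * ee (of_int (k - l) * z) * F z" for z
  proof -
    have "F (z + (a - b)) = C * ee (of_int k * (z - b)) * F (z - b)"
      using a(2)[of "z - b"] by (simp add: algebra_simps)
    moreover have "F z = D * ee (of_int l * (z - b)) * F (z - b)"
      using b(2)[of "z - b"] by simp
    hence "F (z - b) = F z / (D * ee (of_int l * (z - b)))"
      using b(1) by (simp add: field_simps)
    ultimately have "F (z + (a - b)) = C / D * (ee (of_int k * (z - b)) / ee (of_int l * (z - b))) * F z"
      using b(1) by (simp add: field_simps)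
    also have "ee (of_int k * (z - b)) / ee (of_int l * (z - b)) =
                 ee (of_int (l - k) * b) * ee (of_int (k - l) * z)"
      by (simp add: ee_diff[symmetric] ee_add[symmetric] algebra_simps)
    finally show ?thesis by (simp add: mult_ac)
  qed
  thus ?case using a(1) b(1)
    by (intro exI[of _ "k - l"] exI[of _ "C / D * ee (of_int (l - k) * b)"]) simp
qed

lemma sect_zero_lattice:
  assumes "F \<in> sect n c" "z - z' \<in> \<Lambda>"
  shows "F z = 0 \<longleftrightarrow> F z' = 0"
proof -
  obtain k C where "C \<noteq> 0" "\<forall>u. F (u + (z - z')) = C * ee (of_int k * u) * F u"
    using sect_lattice[OF assms] by blast
  thus ?thesis by (metis add_diff_cancel_left' diff_add_cancel add.commute ee_nonzero mult_eq_0_iff)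
qed

text \<open>The transformation law is differentiated at 0. Since \<open>theta\<close> vanishes
  there, the derivative of the exponential factor drops out.\<close>

lemma deriv_theta_lattice: "w \<in> \<Lambda> \<Longrightarrow> deriv theta w \<noteq> 0"
proof -
  assume w: "w \<in> \<Lambda>"
  have "theta \<in> sect 1 (-1)" using theta_sect[of 0] by simp
  then obtain k C where C: "C \<noteq> 0" "\<And>u. theta (u + w) = C * ee (of_int k * u) * theta u"
    using sect_lattice[OF _ w] by blast
  have d0: "(theta has_field_derivative deriv theta 0) (at 0)"
    by (intro holomorphic_derivI[of _ UNIV] holomorphic_intros) auto
  have dw: "(theta has_field_derivative deriv theta w) (at (0 + w))"
    by (simp, intro holomorphic_derivI[of _ UNIV] holomorphic_intros) auto
  have "((\<lambda>u. theta (u + w)) has_field_derivative deriv theta w) (at 0)"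
    using dw by (subst (asm) DERIV_shift)
  moreover have "((\<lambda>u. C * ee (of_int k * u) * theta u) has_field_derivative C * deriv theta 0) (at 0)"
    by (auto intro!: derivative_eq_intros d0)
  ultimately have "deriv theta w = C * deriv theta 0"
    unfolding C(2) by (rule DERIV_unique)
  thus ?thesis using C(1) deriv_theta_0 by simp
qed

lemma deriv_theta_shift:
  assumes "theta (z - a) = 0" shows "deriv (\<lambda>z. theta (z - a)) z \<noteq> 0"
proof -
  have "(theta has_field_derivative deriv theta (z - a)) (at (z - a))"
    by (intro holomorphic_derivI[of _ UNIV] holomorphic_intros) auto
  hence "((\<lambda>z. theta (z - a)) has_field_derivative deriv theta (z - a)) (at z)"
    using DERIV_shift[of theta "deriv theta (z - a)" z "- a"] by simp
  hence "deriv (\<lambda>z. theta (z - a)) z = deriv theta (z - a)" by (rule DERIV_imp_deriv)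
  thus ?thesis using assms deriv_theta_lattice by (simp add: theta_eq_0_iff)
qed

lemma zorder_theta: "zorder (\<lambda>z. theta (z - a)) z = (if z - a \<in> \<Lambda> then 1 else 0)"
proof -
  have an: "(\<lambda>z. theta (z - a)) analytic_on {z}"
    by (rule analytic_on_subset[of _ UNIV]) (auto simp: analytic_on_open intro!: holomorphic_intros)
  show ?thesis
  proof (cases "z - a \<in> \<Lambda>")
    case True
    hence "theta (z - a) = 0" by (simp add: theta_eq_0_iff)
    hence "zorder (\<lambda>z. theta (z - a)) z = 1"
      by (intro zorder_zero_eqI'[OF an]) (auto simp: deriv_theta_shift)
    with True show ?thesis by simp
  next
    case False
    thus ?thesis using zorder_eq_0I[OF an] by (simp add: theta_eq_0_iff)
  qed
qed

text \<open>Both transformation laws hold after multiplication by \<open>G\<close>, and a nonzero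
  entire factor cancels.\<close>

lemma sect_quotient:
  assumes "F \<in> sect n c" "G \<in> sect m d" "G \<noteq> (\<lambda>_. 0)"
    and H: "H holomorphic_on UNIV" and FGH: "\<And>z. F z = G z * H z"
  shows "H \<in> sect (n - m) (c / d)"
proof -
  note F = sectD[OF assms(1)] and G = sectD[OF assms(2)]
  have shift: "(\<lambda>z. H (z + w)) holomorphic_on UNIV" for w
  proof -
    have "(\<lambda>z. z + w) holomorphic_on UNIV" by (intro holomorphic_intros)
    from holomorphic_on_compose_gen[OF this H] show ?thesis by (simp add: o_def)
  qed
  have "(\<lambda>z. H (z + 1)) = H"
  proof (rule entire_mult_cancel[of G])
    show "G z * H (z + 1) = G z * H z" for z
      using F(3)[of z] G(3)[of z] FGH[of z] FGH[of "z + 1"] by simp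
  qed (use assms shift G in auto)
  moreover have "(\<lambda>z. H (z + \<tau>)) = (\<lambda>z. c / d * ee (- (of_int (n - m) * z)) * H z)"
  proof (rule entire_mult_cancel[of G])
    fix z
    have "d * ee (- (of_int m * z)) * (G z * H (z + \<tau>)) = c * ee (- (of_int n * z)) * (G z * H z)"
      using F(4)[of z] G(4)[of z] FGH[of z] FGH[of "z + \<tau>"] by simp
    hence "G z * H (z + \<tau>) = (c / d * (ee (- (of_int n * z)) / ee (- (of_int m * z)))) * (G z * H z)"
      using G(1) by (simp add: field_simps)
    also have "ee (- (of_int n * z)) / ee (- (of_int m * z)) = ee (- (of_int (n - m) * z))"
      by (simp add: ee_diff[symmetric] algebra_simps)
    finally show "G z * H (z + \<tau>) = G z * (c / d * ee (- (of_int (n - m) * z)) * H z)"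
      by (simp add: mult_ac)
  qed (use assms shift G in \<open>auto intro!: holomorphic_intros\<close>)
  ultimately show ?thesis
    unfolding sect_def using F(1) G(1) H by (auto dest: fun_cong)
qed

lemma sect_divide_theta:
  assumes "F \<in> sect n c" "F a = 0"
  obtains F1 where "F1 \<in> sect (n - 1) (c / - ee a)" "F = (\<lambda>z. theta (z - a) * F1 z)"
proof -
  obtain F1 where F1: "F1 holomorphic_on UNIV" "\<And>z. F z = theta (z - a) * F1 z"
  proof (rule entire_divide_simple_zeros[of F "\<lambda>z. theta (z - a)"])
    fix z assume z: "theta (z - a) = 0"
    hence "F z = 0" using sect_zero_lattice[OF assms(1), of z a] assms(2) by (simp add: theta_eq_0_iff)
    with deriv_theta_shift[OF z] show "F z = 0 \<and> deriv (\<lambda>z. theta (z - a)) z \<noteq> 0" by blast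
  qed (use sectD[OF assms(1)] theta_nonzero in \<open>auto intro!: holomorphic_intros\<close>)
  have "F1 \<in> sect (n - 1) (c / - ee a)"
    by (rule sect_quotient[OF assms(1) theta_sect theta_nonzero F1])
  with F1(2) show ?thesis by (intro that) auto
qed

lemma sect_0:
  assumes "F \<in> sect 0 c"
  obtains K k where "F = (\<lambda>z. K * ee (of_int k * z))"
proof -
  note F = sectD[OF assms]
  define y where "y = ln (norm c) / Im \<tau>"
  \<comment> \<open>With this choice of \<open>y\<close> the modulus of \<open>g\<close> is doubly periodic, hence bounded.\<close>
  define g where "g = (\<lambda>z. F z * exp (\<i> * of_real y * z))"
  have g_per: "\<forall>z. norm (g (z + w)) = norm (g z)" if "w \<in> \<Lambda>" for w
    using that
  proof (induction rule: lattice_induct)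
    case one
    have "norm (exp (\<i> * of_real y * (z + 1))) = norm (exp (\<i> * of_real y * z))" for z
      by simp
    thus ?case by (simp add: g_def F(3) norm_mult)
  next
    case tau
    have "norm (exp (\<i> * of_real y * \<tau>)) = 1 / norm c"
      using Im_tau_pos F(1) by (simp add: y_def exp_minus field_simps)
    moreover have "exp (\<i> * of_real y * (z + \<tau>)) = exp (\<i> * of_real y * z) * exp (\<i> * of_real y * \<tau>)" for z
      by (simp add: algebra_simps exp_add)
    ultimately show ?case using F(1) by (simp add: g_def F(4) norm_mult)
  next
    case (diff a b)
    show ?case
    proof
      fix z
      have "norm (g (z + (a - b))) = norm (g (z - b))"
        using diff(1) by (metis add_diff_eq diff_add_eq)
      also have "\<dots> = norm (g z)" using diff(2) by (metis diff_add_cancel)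
      finally show "norm (g (z + (a - b))) = norm (g z)" .
    qed
  qed
  have g_hol: "g holomorphic_on UNIV"
    unfolding g_def by (intro holomorphic_intros F)
  have "bounded (g ` fund_domain)"
    by (intro compact_imp_bounded compact_continuous_image compact_fund_domain
          continuous_on_subset[OF holomorphic_on_imp_continuous_on[OF g_hol]]) auto
  then obtain B where B: "\<And>z. z \<in> fund_domain \<Longrightarrow> norm (g z) \<le> B"
    by (auto simp: bounded_iff)
  have "norm (g z) \<le> B" for z
    using B g_per by (metis lattice_translate_fund_domain)
  hence "bounded (range g)" by (auto simp: bounded_iff)
  then obtain K where K: "\<And>z. g z = K"
    using Liouville_theorem[OF g_hol] by (auto simp: constant_on_def)
  have FK: "F z = K * exp (- (\<i> * of_real y * z))" for z
    using K[of z] by (simp add: g_def exp_minus field_simps)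
  show ?thesis
  proof (cases "K = 0")
    case True
    with FK show ?thesis by (intro that[of 0 0]) auto
  next
    case False
    \<comment> \<open>The exact period 1 of \<open>F\<close> forces the remaining exponent to be an
      integral multiple of \<open>2 * pi\<close>.\<close>
    have "exp (- (\<i> * of_real y)) = 1"
      using F(3)[of 0] FK[of 0] FK[of 1] False by simp
    then obtain m :: int where m: "- y = of_int (2 * m) * pi"
      by (auto simp: exp_eq_1)
    have "exp (- (\<i> * of_real y * z)) = ee (of_int m * z)" for z
    proof -
      have "- (\<i> * of_real y * z) = \<i> * of_real (- y) * z" by simp
      thus ?thesis unfolding m by (simp add: ee_def algebra_simps)
    qed
    with FK show ?thesis by (intro that[of K m]) auto
  qed
qed

lemma theta_power_sect: "(\<lambda>z. theta z ^ m) \<in> sect (int m) ((-1) ^ m)"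
proof (induction m)
  case 0
  show ?case using sect_0_const[of 1] by simp
next
  case (Suc m)
  have "theta \<in> sect 1 (-1)" using theta_sect[of 0] by simp
  from sect_mult[OF this Suc] show ?case by (simp add: add.commute)
qed

text \<open>A power of \<open>theta\<close> raises the degree to 0, where a section is either zero
  or free of zeros; the product vanishes at 0.\<close>

lemma sect_neg:
  assumes "F \<in> sect n c" "n < 0"
  shows "F = (\<lambda>_. 0)"
proof -
  define m where "m = nat (- n)"
  have m: "m > 0" "n + int m = 0" using assms(2) by (auto simp: m_def)
  have "(\<lambda>z. F z * theta z ^ m) \<in> sect 0 (c * (-1) ^ m)"
    by (rule sect_mult'[OF assms(1) theta_power_sect]) (use m in auto)
  then obtain K k where K: "(\<lambda>z. F z * theta z ^ m) = (\<lambda>z. K * ee (of_int k * z))"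
    by (rule sect_0)
  have "K = 0" using fun_cong[OF K, of 0] m by (simp add: power_0_left)
  hence *: "theta z ^ m * F z = theta z ^ m * 0" for z using fun_cong[OF K, of z] by auto
  have nz: "(\<lambda>z. theta z ^ m) \<noteq> (\<lambda>_. 0)"
    using theta_nonzero[of 0] by (auto simp: fun_eq_iff)
  show ?thesis
    by (rule entire_mult_cancel[of "\<lambda>z. theta z ^ m"])
       (use sectD[OF assms(1)] nz * in \<open>auto intro!: holomorphic_intros\<close>)
qed

text \<open>Otherwise the reciprocal would be a nonzero section of negative degree.\<close>

lemma sect_has_zero:
  assumes "F \<in> sect n c" "n > 0"
  obtains a where "F a = 0"
proof -
  have "\<exists>a. F a = 0"
  proof (rule ccontr)
    assume nz: "\<nexists>a. F a = 0"
    have "(\<lambda>z. 1 / F z) \<in> sect (0 - n) (1 / c)"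
    proof (rule sect_quotient[OF sect_0_const[of 1] assms(1)])
      show "F \<noteq> (\<lambda>_. 0)" using nz by auto
      show "(\<lambda>z. 1 / F z) holomorphic_on UNIV"
        using nz by (intro holomorphic_intros sectD[OF assms(1)]) auto
    qed (use nz in auto)
    hence "(\<lambda>z. 1 / F z) = (\<lambda>_. 0)" by (rule sect_neg) (use assms in auto)
    with nz show False by (auto dest: fun_cong)
  qed
  with that show ?thesis by blast
qed

end

section \<open>Zeros of sections\<close>

context torus
begin

definition tprod :: "complex multiset \<Rightarrow> complex \<Rightarrow> complex" where
  "tprod A z = (\<Prod>a\<in>#A. theta (z - a))"

lemma tprod_empty [simp]: "tprod {#} z = 1"
  by (simp add: tprod_def)

lemma tprod_add_mset [simp]: "tprod (add_mset a A) z = theta (z - a) * tprod A z"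
  by (simp add: tprod_def)

lemma tprod_union: "tprod (A + B) z = tprod A z * tprod B z"
  by (simp add: tprod_def)

lemma tprod_sect: "tprod A \<in> sect (int (size A)) ((-1) ^ size A * ee (sum_mset A))"
proof (induction A)
  case empty
  show ?case using sect_0_const[of 1] by (simp add: tprod_def)
next
  case (add a A)
  have "(\<lambda>z. theta (z - a) * tprod A z) \<in> sect (int (size (add_mset a A)))
          ((-1) ^ size (add_mset a A) * ee (sum_mset (add_mset a A)))"
    by (rule sect_mult'[OF theta_sect add]) (auto simp: ee_add)
  also have "(\<lambda>z. theta (z - a) * tprod A z) = tprod (add_mset a A)" by auto
  finally show ?case .
qed

lemma exp_sect: "(\<lambda>z. K * ee (of_int k * z)) \<in> sect 0 (ee (of_int k * \<tau>))"
  by (auto simp: sect_def ee_add distrib_left intro!: holomorphic_intros)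

text \<open>\<open>A\<close> consists of representatives in the plane. Moving one of them by a
  period changes the product by an exponential, which the factor \<open>ee (of_int k * z)\<close>
  and the constant absorb.\<close>

definition theta_rep :: "(complex \<Rightarrow> complex) \<Rightarrow> complex multiset \<Rightarrow> bool" where
  "theta_rep F A \<longleftrightarrow> (\<exists>K k. K \<noteq> 0 \<and> F = (\<lambda>z. K * ee (of_int k * z) * tprod A z))"

lemma theta_repE:
  assumes "theta_rep F A"
  obtains K k where "K \<noteq> 0" "F = (\<lambda>z. K * ee (of_int k * z) * tprod A z)"
    "F \<in> sect (int (size A)) ((-1) ^ size A * ee (of_int k * \<tau> + sum_mset A))"
proof -
  obtain K k where K: "K \<noteq> 0" "F = (\<lambda>z. K * ee (of_int k * z) * tprod A z)"
    using assms by (auto simp: theta_rep_def)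
  have "(\<lambda>z. K * ee (of_int k * z) * tprod A z) \<in>
      sect (int (size A)) ((-1) ^ size A * ee (of_int k * \<tau> + sum_mset A))"
    by (rule sect_mult'[OF exp_sect tprod_sect]) (auto simp: ee_add)
  with K show ?thesis by (intro that) auto
qed

lemma theta_rep_theta_mult:
  assumes "theta_rep F A" shows "theta_rep (\<lambda>z. theta (z - a) * F z) (add_mset a A)"
  using assms unfolding theta_rep_def by (fastforce simp: mult_ac)

lemma theta_rep_mult:
  assumes "theta_rep F A" "theta_rep G B"
  shows "theta_rep (\<lambda>z. F z * G z) (A + B)"
proof -
  obtain K k L l where "K \<noteq> 0" "F = (\<lambda>z. K * ee (of_int k * z) * tprod A z)"
     "L \<noteq> 0" "G = (\<lambda>z. L * ee (of_int l * z) * tprod B z)"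
    using assms by (auto simp: theta_rep_def)
  thus ?thesis
    unfolding theta_rep_def
    by (intro exI[of _ "K * L"] exI[of _ "k + l"])
       (auto simp: tprod_union ee_add algebra_simps)
qed

lemma theta_rep_exists:
  assumes "F \<in> sect n c" "F \<noteq> (\<lambda>_. 0)"
  shows "\<exists>A. theta_rep F A \<and> int (size A) = n"
proof -
  have "n \<ge> 0" using sect_neg[OF assms(1)] assms(2) by fastforce
  then obtain m where "n = int m" by (metis nonneg_int_cases)
  with assms show ?thesis
  proof (induction m arbitrary: n c F)
    case 0
    then obtain K k where K: "F = (\<lambda>z. K * ee (of_int k * z))"
      using sect_0[of F c] by auto
    moreover from this 0 have "K \<noteq> 0" by auto
    ultimately have "theta_rep F {#}" by (auto simp: theta_rep_def)
    with 0 show ?case by auto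
  next
    case (Suc m)
    obtain a where a: "F a = 0" using sect_has_zero[OF Suc.prems(1)] Suc.prems(3) by auto
    obtain F1 where F1: "F1 \<in> sect (n - 1) (c / - ee a)" "F = (\<lambda>z. theta (z - a) * F1 z)"
      by (rule sect_divide_theta[OF Suc.prems(1) a])
    have "F1 \<noteq> (\<lambda>_. 0)" using Suc.prems(2) F1(2) by auto
    then obtain A where "theta_rep F1 A" "int (size A) = n - 1"
      using Suc.IH[OF F1(1)] Suc.prems(3) by auto
    thus ?case unfolding F1(2) using theta_rep_theta_mult by (intro exI[of _ "add_mset a A"]) auto
  qed
qed

lemma pt_eq: "pt \<tau> z = (\<lambda>w. w + z) ` \<Lambda>"
  by (auto simp: pt_def r_coset_def complex_group_def)

lemma pt_eq_iff: "pt \<tau> z = pt \<tau> z' \<longleftrightarrow> z - z' \<in> \<Lambda>"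
proof
  assume "pt \<tau> z = pt \<tau> z'"
  moreover have "z \<in> pt \<tau> z" by (auto simp: pt_eq intro!: image_eqI[of _ _ 0])
  ultimately show "z - z' \<in> \<Lambda>" by (auto simp: pt_eq)
next
  assume *: "z - z' \<in> \<Lambda>"
  have "w + z \<in> pt \<tau> z'" if "w \<in> \<Lambda>" for w
    unfolding pt_eq using lattice_add[OF that *] by (intro image_eqI[of _ _ "w + (z - z')"]) auto
  moreover have "w + z' \<in> pt \<tau> z" if "w \<in> \<Lambda>" for w
    unfolding pt_eq using lattice_diff[OF that *] by (intro image_eqI[of _ _ "w - (z - z')"]) auto
  ultimately show "pt \<tau> z = pt \<tau> z'" by (auto simp: pt_eq)
qed

lemma sect_analytic: "F \<in> sect n c \<Longrightarrow> F analytic_on S"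
  using sectD(2)[of F n c] analytic_on_subset[of F UNIV S] by (simp add: analytic_on_open)

lemma theta_rep_sect: "theta_rep F A \<Longrightarrow> \<exists>c. F \<in> sect (int (size A)) c"
  by (erule theta_repE) blast

lemma tprod_nonzero: "tprod A \<noteq> (\<lambda>_. 0)"
proof (induction A)
  case empty
  show ?case by (auto simp: fun_eq_iff)
next
  case (add a A)
  have "(\<lambda>z. theta (z - a) * tprod A z) \<noteq> (\<lambda>_. 0)"
    by (intro entire_mult_nonzero sectD(2)[OF theta_sect] sectD(2)[OF tprod_sect] theta_nonzero add)
  moreover have "(\<lambda>z. theta (z - a) * tprod A z) = tprod (add_mset a A)" by auto
  ultimately show ?case by simp
qed

lemma theta_rep_nonzero: "theta_rep F A \<Longrightarrow> F \<noteq> (\<lambda>_. 0)"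
  using tprod_nonzero[of A] by (auto simp: theta_rep_def fun_eq_iff)

lemma zorder_theta_rep:
  assumes "theta_rep F A"
  shows "zorder F z = int (count (image_mset (pt \<tau>) A) (pt \<tau> z))"
proof -
  obtain K k where K: "K \<noteq> 0" "F = (\<lambda>z. K * ee (of_int k * z) * tprod A z)"
    by (rule theta_repE[OF assms])
  have "zorder (\<lambda>z. K * ee (of_int k * z) * tprod A z) z = int (count (image_mset (pt \<tau>) A) (pt \<tau> z))"
  proof (induction A)
    case empty
    show ?case using K(1) sect_analytic[OF exp_sect] by (simp add: zorder_eq_0I)
  next
    case (add a A)
    define G where "G = (\<lambda>z. K * ee (of_int k * z) * tprod A z)"
    have rep: "theta_rep G A" using K(1) by (auto simp: theta_rep_def G_def)
    then obtain c where c: "G \<in> sect (int (size A)) c" using theta_rep_sect by blast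
    have "zorder (\<lambda>z. theta (z - a) * G z) z = zorder (\<lambda>z. theta (z - a)) z + zorder G z"
      by (intro zorder_times_analytic sect_analytic[OF theta_sect] sect_analytic[OF c]
            entire_eventually_nonzero entire_mult_nonzero theta_nonzero
            theta_rep_nonzero[OF rep] holomorphic_on_mult sectD(2)[OF theta_sect] sectD(2)[OF c])
    also have "(\<lambda>z. theta (z - a) * G z) = (\<lambda>z. K * ee (of_int k * z) * tprod (add_mset a A) z)"
      by (auto simp: G_def mult_ac)
    finally show ?case
      using add pt_eq_iff[of z a] by (auto simp: G_def zorder_theta)
  qed
  thus ?thesis unfolding K(2) .
qed

text \<open>The divisor of zeros on the curve, meaningful for nonzero sections;
  \<open>theta_rep_unique\<close> makes it independent of the factorisation.\<close>

definition dv :: "(complex \<Rightarrow> complex) \<Rightarrow> complex set multiset" where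
  "dv F = (SOME D. \<exists>A. theta_rep F A \<and> D = image_mset (pt \<tau>) A)"

text \<open>The multiplicity of a point is the order of vanishing there, which refers to
  \<open>F\<close> alone.\<close>

lemma theta_rep_unique:
  assumes "theta_rep F A" "theta_rep F B"
  shows "image_mset (pt \<tau>) A = image_mset (pt \<tau>) B"
proof (rule multiset_eqI)
  fix x
  show "count (image_mset (pt \<tau>) A) x = count (image_mset (pt \<tau>) B) x"
  proof (cases "x \<in> range (pt \<tau>)")
    case True
    then obtain z where "x = pt \<tau> z" by blast
    thus ?thesis using zorder_theta_rep[OF assms(1), of z] zorder_theta_rep[OF assms(2), of z] by simp
  next
    case False
    hence "x \<notin># image_mset (pt \<tau>) A" "x \<notin># image_mset (pt \<tau>) B" by auto
    thus ?thesis by (simp only: not_in_iff)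
  qed
qed

lemma dv_eq: "theta_rep F A \<Longrightarrow> dv F = image_mset (pt \<tau>) A"
  unfolding dv_def by (rule someI2[of _ "image_mset (pt \<tau>) A"]) (auto dest: theta_rep_unique)

lemma dv_theta: "dv (\<lambda>z. theta (z - a)) = {#pt \<tau> a#}"
proof -
  have "theta_rep (\<lambda>z. theta (z - a)) {#a#}"
    unfolding theta_rep_def by (rule exI[of _ 1], rule exI[of _ 0]) auto
  from dv_eq[OF this] show ?thesis by simp
qed

context
  fixes F n c
  assumes F: "F \<in> sect n c" "F \<noteq> (\<lambda>_. 0)"
begin

lemma size_dv: "int (size (dv F)) = n"
proof -
  obtain A where "theta_rep F A" "int (size A) = n" using theta_rep_exists[OF F] by blast
  thus ?thesis using dv_eq by force
qed

lemma zorder_eq_count_dv: "zorder F z = int (count (dv F) (pt \<tau> z))"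
proof -
  obtain A where "theta_rep F A" using theta_rep_exists[OF F] by blast
  thus ?thesis using dv_eq zorder_theta_rep by force
qed

lemma in_dv_iff: "pt \<tau> z \<in># dv F \<longleftrightarrow> F z = 0"
proof -
  have "zorder F z > 0 \<longleftrightarrow> F z = 0"
    by (rule zorder_pos_iff'[OF sect_analytic[OF F(1)]])
       (intro eventually_frequently entire_eventually_nonzero sectD(2)[OF F(1)] F(2), simp)
  thus ?thesis unfolding zorder_eq_count_dv by simp
qed

lemma in_dvE:
  assumes "x \<in># dv F"
  obtains a where "x = pt \<tau> a" "F a = 0"
proof -
  obtain A where "theta_rep F A" using theta_rep_exists[OF F] by blast
  hence "dv F = image_mset (pt \<tau>) A" by (rule dv_eq)
  then obtain a where a: "x = pt \<tau> a" using assms by auto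
  with assms in_dv_iff[of a] show ?thesis by (intro that) auto
qed

lemma dv_mult:
  assumes "G \<in> sect m d" "G \<noteq> (\<lambda>_. 0)"
  shows "dv (\<lambda>z. F z * G z) = dv F + dv G"
proof -
  obtain A where A: "theta_rep F A" using theta_rep_exists[OF F] by blast
  obtain B where B: "theta_rep G B" using theta_rep_exists[OF assms] by blast
  show ?thesis using dv_eq[OF A] dv_eq[OF B] dv_eq[OF theta_rep_mult[OF A B]] by simp
qed

lemma dv_cmult:
  assumes "k \<noteq> 0" shows "dv (\<lambda>z. k * F z) = dv F"
proof -
  obtain A where A: "theta_rep F A" using theta_rep_exists[OF F] by blast
  then obtain K j where "K \<noteq> 0" "F = (\<lambda>z. K * ee (of_int j * z) * tprod A z)"
    by (auto simp: theta_rep_def)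
  hence "theta_rep (\<lambda>z. k * F z) A"
    using assms unfolding theta_rep_def by (intro exI[of _ "k * K"] exI[of _ j]) (auto simp: mult_ac)
  from dv_eq[OF this] dv_eq[OF A] show ?thesis by simp
qed

lemma dv_uminus: "dv (\<lambda>z. - F z) = dv F"
  using dv_cmult[of "-1"] by simp

lemma sect_multiplier_unique:
  assumes "F \<in> sect n c'" shows "c = c'"
proof -
  obtain z where "F z \<noteq> 0" using F(2) by auto
  with sectD(4)[OF F(1), of z] sectD(4)[OF assms, of z] show ?thesis by simp
qed

lemma dv_theta_mult: "dv (\<lambda>z. theta (z - a) * F z) = add_mset (pt \<tau> a) (dv F)"
proof -
  obtain A where A: "theta_rep F A" using theta_rep_exists[OF F] by blast
  show ?thesis using dv_eq[OF A] dv_eq[OF theta_rep_theta_mult[OF A]] by simp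
qed

end

text \<open>The product form exhibits the multiplier as a sign times \<open>ee\<close> of the sum of
  zeros plus an integral multiple of \<open>\<tau>\<close>, and a nonzero section has only one
  multiplier.\<close>

lemma sum_zeros_congruent:
  assumes "F \<in> sect n c" "G \<in> sect n c" "theta_rep F A" "theta_rep G B"
  shows "sum_mset A - sum_mset B \<in> \<Lambda>"
proof -
  have "int (size A) = n" "int (size B) = n"
    using size_dv[OF assms(1) theta_rep_nonzero[OF assms(3)]] dv_eq[OF assms(3)]
      size_dv[OF assms(2) theta_rep_nonzero[OF assms(4)]] dv_eq[OF assms(4)] by auto
  hence sz: "int (size A) = n" "size B = size A" by auto
  obtain K k where k: "F \<in> sect (int (size A)) ((-1) ^ size A * ee (of_int k * \<tau> + sum_mset A))"
    by (rule theta_repE[OF assms(3)])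
  obtain L l where l: "G \<in> sect (int (size B)) ((-1) ^ size B * ee (of_int l * \<tau> + sum_mset B))"
    by (rule theta_repE[OF assms(4)])
  have "(-1) ^ size A * ee (of_int k * \<tau> + sum_mset A) = (-1) ^ size A * ee (of_int l * \<tau> + sum_mset B)"
    using sect_multiplier_unique[OF assms(1) theta_rep_nonzero[OF assms(3)], of "(-1) ^ size A * ee (of_int k * \<tau> + sum_mset A)"]
      sect_multiplier_unique[OF assms(2) theta_rep_nonzero[OF assms(4)], of "(-1) ^ size B * ee (of_int l * \<tau> + sum_mset B)"]
      k l sz by simp
  hence "ee (of_int k * \<tau> + sum_mset A - (of_int l * \<tau> + sum_mset B)) = 1"
    by (simp add: ee_diff)
  hence "sum_mset A - sum_mset B - of_int (l - k) * \<tau> \<in> \<int>"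
    by (simp add: ee_eq_1_iff algebra_simps)
  thus ?thesis unfolding lattice_iff by blast
qed

text \<open>Once all common zeros are divided out, two pure exponentials remain. Equal multipliers
  force equal exponents because \<open>\<tau>\<close> is not real.\<close>

lemma sect_proportional:
  assumes "F \<in> sect n c" "G \<in> sect n c" "F \<noteq> (\<lambda>_. 0)" "G \<noteq> (\<lambda>_. 0)" "dv F = dv G"
  obtains a where "a \<noteq> 0" "F = (\<lambda>z. a * G z)"
proof -
  have "n \<ge> 0" using sect_neg[OF assms(1)] assms(3) by fastforce
  then obtain m where "n = int m" by (metis nonneg_int_cases)
  with assms(1-5) have "\<exists>a. a \<noteq> 0 \<and> F = (\<lambda>z. a * G z)"
  proof (induction m arbitrary: n c F G)
    case 0
    obtain K k where K: "F = (\<lambda>z. K * ee (of_int k * z))" using sect_0[of F c] 0 by auto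
    obtain L l where L: "G = (\<lambda>z. L * ee (of_int l * z))" using sect_0[of G c] 0 by auto
    have "K \<noteq> 0" "L \<noteq> 0" using 0 K L by auto
    moreover have "k = l"
    proof -
      have "F \<in> sect 0 (ee (of_int k * \<tau>))" "G \<in> sect 0 (ee (of_int l * \<tau>))"
        unfolding K L by (rule exp_sect)+
      hence "ee (of_int k * \<tau>) = ee (of_int l * \<tau>)"
        using sect_multiplier_unique[of F 0 c] sect_multiplier_unique[of G 0 c] 0 by auto
      hence "ee (of_int (k - l) * \<tau>) = 1" by (simp add: ee_diff algebra_simps)
      hence "of_int (k - l) * \<tau> \<in> \<int>" by (simp only: ee_eq_1_iff)
      hence "Im (of_int (k - l) * \<tau>) = 0" by (simp only: complex_is_Int_iff)
      thus "k = l" using Im_tau_pos by simp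
    qed
    ultimately show ?case unfolding K L by (intro exI[of _ "K / L"]) auto
  next
    case (Suc m)
    obtain a where a: "F a = 0" using sect_has_zero[OF Suc.prems(1)] Suc.prems(6) by auto
    hence a': "G a = 0"
      using in_dv_iff[OF Suc.prems(1,3)] in_dv_iff[OF Suc.prems(2,4)] Suc.prems(5) by simp
    obtain F1 where F1: "F1 \<in> sect (n - 1) (c / - ee a)" "F = (\<lambda>z. theta (z - a) * F1 z)"
      by (rule sect_divide_theta[OF Suc.prems(1) a])
    obtain G1 where G1: "G1 \<in> sect (n - 1) (c / - ee a)" "G = (\<lambda>z. theta (z - a) * G1 z)"
      by (rule sect_divide_theta[OF Suc.prems(2) a'])
    have nz: "F1 \<noteq> (\<lambda>_. 0)" "G1 \<noteq> (\<lambda>_. 0)" using Suc.prems F1(2) G1(2) by auto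
    have "dv F1 = dv G1"
      using Suc.prems(5) F1(2) G1(2) dv_theta_mult[OF F1(1) nz(1)] dv_theta_mult[OF G1(1) nz(2)] by simp
    from Suc.IH[OF F1(1) G1(1) nz this] obtain b where "b \<noteq> 0" "F1 = (\<lambda>z. b * G1 z)"
      using Suc.prems(6) by auto
    thus ?case unfolding F1(2) G1(2) by (intro exI[of _ b]) (auto simp: mult_ac)
  qed
  with that show ?thesis by blast
qed

text \<open>With a single zero, the sum of the zeros is the zero itself, and the multiplier
  determines it modulo the lattice.\<close>

lemma dv_eq_degree_1:
  assumes "F \<in> sect 1 c" "G \<in> sect 1 c" "F \<noteq> (\<lambda>_. 0)" "G \<noteq> (\<lambda>_. 0)"
  shows "dv F = dv G"
proof -
  obtain A where A: "theta_rep F A" "size A = 1" using theta_rep_exists[OF assms(1,3)] by auto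
  obtain B where B: "theta_rep G B" "size B = 1" using theta_rep_exists[OF assms(2,4)] by auto
  obtain a b where ab: "A = {#a#}" "B = {#b#}" using A(2) B(2) size_1_singleton_mset by metis
  have "a - b \<in> \<Lambda>" using sum_zeros_congruent[OF assms(1,2) A(1) B(1)] ab by simp
  thus ?thesis using dv_eq[OF A(1)] dv_eq[OF B(1)] ab pt_eq_iff by simp
qed

lemma some_representative: "(SOME w. w \<in> pt \<tau> z) - z \<in> \<Lambda>"
proof -
  have "z \<in> pt \<tau> z" by (auto simp: pt_eq intro!: image_eqI[of _ _ 0])
  hence "(SOME w. w \<in> pt \<tau> z) \<in> pt \<tau> z" by (rule someI)
  thus ?thesis by (auto simp: pt_eq)
qed

end

section \<open>The Bloch form\<close>

context torus
begin

section \<open>The group law in terms of representatives in the plane\<close>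

lemma subgroup_lattice: "subgroup \<Lambda> complex_group" and comm_group_complex: "comm_group complex_group"
proof -
  show "comm_group complex_group"
    by (rule comm_groupI) (auto simp: complex_group_def intro: exI[of _ "- x" for x])
  then interpret comm_group complex_group .
  have inv: "inv\<^bsub>complex_group\<^esub> x = - x" for x
    by (rule inv_equality) (auto simp: complex_group_def)
  show "subgroup \<Lambda> complex_group"
    by (rule subgroupI)
       (use lattice_0 in \<open>auto simp: inv lattice_uminus, auto simp: complex_group_def lattice_add\<close>)
qed

lemma normal_lattice: "\<Lambda> \<lhd> complex_group"
  by (rule comm_group.subgroup_imp_normal[OF comm_group_complex subgroup_lattice])

lemma carrier_elliptic_curve: "carrier (elliptic_curve \<tau>) = range (pt \<tau>)"
  by (auto simp: elliptic_curve_def FactGroup_def RCOSETS_def pt_def complex_group_def)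

lemma pt_mult: "pt \<tau> x \<otimes>\<^bsub>elliptic_curve \<tau>\<^esub> pt \<tau> y = pt \<tau> (x + y)"
  using normal.rcos_sum[OF normal_lattice, of x y]
  by (simp add: elliptic_curve_def FactGroup_def pt_def) (simp add: complex_group_def)

lemma group_elliptic_curve: "group (elliptic_curve \<tau>)"
  unfolding elliptic_curve_def by (rule normal.factorgroup_is_group[OF normal_lattice])

lemma one_elliptic_curve: "\<one>\<^bsub>elliptic_curve \<tau>\<^esub> = pt \<tau> 0"
  by (auto simp: elliptic_curve_def FactGroup_def pt_eq)

lemma pt_inv: "inv\<^bsub>elliptic_curve \<tau>\<^esub> pt \<tau> x = pt \<tau> (- x)"
  by (rule group.inv_equality[OF group_elliptic_curve])
     (auto simp: pt_mult one_elliptic_curve carrier_elliptic_curve)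

lemma point_diff_pt: "point_diff \<tau> (pt \<tau> x) (pt \<tau> y) = pt \<tau> (x - y)"
  by (simp add: point_diff_def pt_inv pt_mult)

definition mfrag :: "complex set multiset \<Rightarrow> complex set \<Rightarrow>\<^sub>0 int" where
  "mfrag P = (\<Sum>x\<in>#P. frag_of x)"

lemma mfrag_simps [simp]:
  "mfrag {#} = 0" "mfrag (add_mset x P) = frag_of x + mfrag P" "mfrag (P + Q) = mfrag P + mfrag Q"
  by (simp_all add: mfrag_def)

text \<open>The representative of the coset \<open>bloch_beta\<close> in the free group, so that
  bilinear algebra can be done before passing to the quotient.\<close>

definition bloch_form where
  "bloch_form u v = frag_extend (\<lambda>x. frag_extend (\<lambda>y. frag_of (point_diff \<tau> x y)) v) u"

lemma bloch_form_left:
  "bloch_form (u + u') v = bloch_form u v + bloch_form u' v"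
  "bloch_form (u - u') v = bloch_form u v - bloch_form u' v"
  "bloch_form (- u) v = - bloch_form u v"
  "bloch_form 0 v = 0"
  by (simp_all add: bloch_form_def frag_extend_add frag_extend_diff frag_extend_minus)

lemma bloch_form_frag_of: "bloch_form (frag_of x) (frag_of y) = frag_of (point_diff \<tau> x y)"
  by (simp add: bloch_form_def)

lemma frag_cmul_diff_distrib2: "frag_cmul k (a - b) = frag_cmul k a - frag_cmul k b"
  by (rule poly_mapping_eqI) (simp add: lookup_minus algebra_simps)

lemma frag_extend_diff_fun: "frag_extend (\<lambda>x. f x - g x) u = frag_extend f u - frag_extend g u"
  by (simp add: frag_extend_def frag_cmul_diff_distrib2 sum_subtractf)

lemma bloch_form_right:
  "bloch_form u (v - v') = bloch_form u v - bloch_form u v'"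
  "bloch_form u 0 = 0"
  "bloch_form u (- v) = - bloch_form u v"
  "bloch_form u (v + v') = bloch_form u v + bloch_form u v'"
proof -
  show diff: "bloch_form u (v - v') = bloch_form u v - bloch_form u v'" for v v'
    by (simp add: bloch_form_def frag_extend_diff frag_extend_diff_fun)
  show 0: "bloch_form u 0 = 0" using diff[of 0 0] by simp
  show minus: "bloch_form u (- v) = - bloch_form u v" for v using diff[of 0 v] 0 by simp
  show "bloch_form u (v + v') = bloch_form u v + bloch_form u v'" using diff[of v "- v'"] minus by simp
qed

lemmas bloch_form_simps = bloch_form_left bloch_form_right

definition Tform where
  "Tform F G K = bloch_form (mfrag (dv F) - mfrag (dv K)) (mfrag (dv G) - mfrag (dv K))"

text \<open>Three terms with sum zero replace \<open>f\<close> and \<open>1 - f\<close>: poles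
  disappear and the statement becomes symmetric.\<close>

definition steinberg where
  "steinberg n c F G K \<longleftrightarrow> F \<in> sect n c \<and> G \<in> sect n c \<and> K \<in> sect n c \<and>
     F \<noteq> (\<lambda>_. 0) \<and> G \<noteq> (\<lambda>_. 0) \<and> K \<noteq> (\<lambda>_. 0) \<and> (\<forall>z. F z + G z + K z = 0)"

lemma steinbergD:
  assumes "steinberg n c F G K"
  shows "F \<in> sect n c" "G \<in> sect n c" "K \<in> sect n c"
    "F \<noteq> (\<lambda>_. 0)" "G \<noteq> (\<lambda>_. 0)" "K \<noteq> (\<lambda>_. 0)" "F z + G z + K z = 0"
  using assms by (auto simp: steinberg_def)

lemma Tform_cancel:
  assumes "steinberg n c F G K" "M \<in> sect m d" "M \<noteq> (\<lambda>_. 0)"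
  shows "Tform (\<lambda>z. M z * F z) (\<lambda>z. M z * G z) (\<lambda>z. M z * K z) = Tform F G K"
  using dv_mult[OF assms(2,3)] steinbergD[OF assms(1)] by (simp add: Tform_def)

lemma theta_rep_size2:
  assumes "F \<in> sect 2 c" "F \<noteq> (\<lambda>_. 0)"
  obtains a b where "theta_rep F {#a, b#}" "dv F = {#pt \<tau> a, pt \<tau> b#}"
proof -
  obtain A where A: "theta_rep F A" "int (size A) = 2" using theta_rep_exists[OF assms] by blast
  hence "size A = Suc (Suc 0)" by simp
  then obtain a B where B: "A = add_mset a B" using size_eq_Suc_imp_eq_union by blast
  hence "size B = 1" using A(2) by simp
  then obtain b where "A = {#a, b#}" using B size_1_singleton_mset by blast
  with A(1) dv_eq[OF A(1)] show ?thesis by (intro that) auto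
qed

end

text \<open>Of the line relations the reduction uses only that degree 3 is available for triples
  without common zeros. \<open>H\<close> will be the preimage in the free group of the subgroup they
  generate, so equality of cosets becomes membership.\<close>

locale bloch_subgroup = torus +
  fixes H :: "(complex set \<Rightarrow>\<^sub>0 int) set"
  assumes H_diff: "a \<in> H \<Longrightarrow> b \<in> H \<Longrightarrow> a - b \<in> H"
    and H_antisym: "frag_of (pt \<tau> z) + frag_of (pt \<tau> (- z)) \<in> H"
    and H_cubic: "steinberg 3 c F G K \<Longrightarrow> (\<And>z. F z = 0 \<Longrightarrow> G z \<noteq> 0) \<Longrightarrow> Tform F G K \<in> H"
begin

lemma H_0: "0 \<in> H"
  using H_diff[OF H_antisym[of 0] H_antisym[of 0]] by simp

lemma H_uminus: "a \<in> H \<Longrightarrow> - a \<in> H"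
  using H_diff[OF H_0] by simp

lemma H_add: "a \<in> H \<Longrightarrow> b \<in> H \<Longrightarrow> a + b \<in> H"
  using H_diff[of a "- b"] H_uminus[of b] by simp

lemma H_antisym': "a + b \<in> \<Lambda> \<Longrightarrow> frag_of (pt \<tau> a) + frag_of (pt \<tau> b) \<in> H"
  using H_antisym[of a] pt_eq_iff[of "- a" b] lattice_uminus_iff[of "a + b"] by simp

abbreviation "supported P \<equiv> set_mset P \<subseteq> range (pt \<tau>)"

lemma supported_dv: "F \<in> sect n c \<Longrightarrow> F \<noteq> (\<lambda>_. 0) \<Longrightarrow> supported (dv F)"
  by (auto elim!: in_dvE)

lemma bloch_form_antisym:
  assumes "supported P" "supported Q"
  shows "bloch_form (mfrag P) (mfrag Q) + bloch_form (mfrag Q) (mfrag P) \<in> H"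
  using assms(1)
proof (induction P)
  case empty
  show ?case by (simp add: bloch_form_simps H_0)
next
  case (add x P)
  have "bloch_form (frag_of x) (mfrag Q) + bloch_form (mfrag Q) (frag_of x) \<in> H"
    using assms(2)
  proof (induction Q)
    case empty
    show ?case by (simp add: bloch_form_simps H_0)
  next
    case (add y Q)
    obtain a b where "x = pt \<tau> a" "y = pt \<tau> b" using add.prems \<open>supported (add_mset x P)\<close> by auto
    have "bloch_form (frag_of x) (frag_of y) + bloch_form (frag_of y) (frag_of x) \<in> H"
      unfolding \<open>x = _\<close> \<open>y = _\<close> bloch_form_frag_of point_diff_pt by (rule H_antisym') simp
    moreover have "bloch_form (frag_of x) (mfrag Q) + bloch_form (mfrag Q) (frag_of x) \<in> H"
      using add by auto
    ultimately have "(bloch_form (frag_of x) (frag_of y) + bloch_form (frag_of y) (frag_of x)) +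
          (bloch_form (frag_of x) (mfrag Q) + bloch_form (mfrag Q) (frag_of x)) \<in> H"
      by (rule H_add)
    thus ?case by (simp add: bloch_form_simps algebra_simps)
  qed
  moreover have "bloch_form (mfrag P) (mfrag Q) + bloch_form (mfrag Q) (mfrag P) \<in> H"
    using add by auto
  ultimately have "(bloch_form (frag_of x) (mfrag Q) + bloch_form (mfrag Q) (frag_of x)) +
      (bloch_form (mfrag P) (mfrag Q) + bloch_form (mfrag Q) (mfrag P)) \<in> H" by (rule H_add)
  thus ?case by (simp add: bloch_form_simps algebra_simps)
qed

text \<open>Modulo \<^term>\<open>H\<close> the self-pairing of a divisor is its degree times the 2-torsion class of the origin.\<close>
lemma bloch_form_self_pair:
  assumes "supported P" "supported Q" "size P = size Q"
  shows "bloch_form (mfrag P) (mfrag P) + bloch_form (mfrag Q) (mfrag Q) \<in> H"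
  using assms
proof (induction P arbitrary: Q)
  case empty
  thus ?case by (simp add: bloch_form_simps H_0)
next
  case (add x P)
  obtain y Q' where Q: "Q = add_mset y Q'" using add.prems(3) by (cases Q) auto
  obtain a b where "x = pt \<tau> a" "y = pt \<tau> b" using add.prems Q by auto
  hence 1: "bloch_form (frag_of x) (frag_of x) + bloch_form (frag_of y) (frag_of y) \<in> H"
    by (simp only: bloch_form_frag_of point_diff_pt) (rule H_antisym', simp)
  have 2: "bloch_form (mfrag {#x#}) (mfrag P) + bloch_form (mfrag P) (mfrag {#x#}) \<in> H"
    "bloch_form (mfrag {#y#}) (mfrag Q') + bloch_form (mfrag Q') (mfrag {#y#}) \<in> H"
    by (rule bloch_form_antisym; use add.prems Q in auto)+
  have 3: "bloch_form (mfrag P) (mfrag P) + bloch_form (mfrag Q') (mfrag Q') \<in> H"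
    by (rule add.IH) (use add.prems Q in auto)
  have "(bloch_form (frag_of x) (frag_of x) + bloch_form (frag_of y) (frag_of y)) +
    ((bloch_form (mfrag {#x#}) (mfrag P) + bloch_form (mfrag P) (mfrag {#x#})) +
    ((bloch_form (mfrag {#y#}) (mfrag Q') + bloch_form (mfrag Q') (mfrag {#y#})) +
     (bloch_form (mfrag P) (mfrag P) + bloch_form (mfrag Q') (mfrag Q')))) \<in> H"
    by (rule H_add[OF 1 H_add[OF 2(1) H_add[OF 2(2) 3]]])
  thus ?case by (simp add: Q bloch_form_simps algebra_simps)
qed

definition div0 where
  "div0 = {mfrag P - mfrag Q | P Q. supported P \<and> supported Q \<and> size P = size Q}"

lemma div0I: "supported P \<Longrightarrow> supported Q \<Longrightarrow> size P = size Q \<Longrightarrow> mfrag P - mfrag Q \<in> div0"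
  unfolding div0_def by blast

lemma div0E:
  assumes "u \<in> div0"
  obtains P Q where "u = mfrag P - mfrag Q" "supported P" "supported Q" "size P = size Q"
  using assms unfolding div0_def by blast

lemma div0_antisym:
  assumes "u \<in> div0" "v \<in> div0" shows "bloch_form u v + bloch_form v u \<in> H"
proof -
  obtain P Q where u: "u = mfrag P - mfrag Q" "supported P" "supported Q"
    using assms(1) by (rule div0E)
  obtain P' Q' where v: "v = mfrag P' - mfrag Q'" "supported P'" "supported Q'"
    using assms(2) by (rule div0E)
  have "(bloch_form (mfrag P) (mfrag P') + bloch_form (mfrag P') (mfrag P))
     - (bloch_form (mfrag P) (mfrag Q') + bloch_form (mfrag Q') (mfrag P))
     - ((bloch_form (mfrag Q) (mfrag P') + bloch_form (mfrag P') (mfrag Q))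
     - (bloch_form (mfrag Q) (mfrag Q') + bloch_form (mfrag Q') (mfrag Q))) \<in> H"
    by (intro H_diff bloch_form_antisym u v)
  thus ?thesis by (simp add: u(1) v(1) bloch_form_simps algebra_simps)
qed

text \<open>Antisymmetry by itself only puts twice \<open>bloch_form u u\<close> into
  \<open>H\<close>. Here the self-pairings of \<open>P\<close> and \<open>Q\<close> together
  contribute an even number of copies of the class of the origin, because the sizes agree, and twice
  that class lies in \<open>H\<close>.\<close>

lemma div0_alternating:
  assumes "u \<in> div0" shows "bloch_form u u \<in> H"
proof -
  obtain P Q where *: "u = mfrag P - mfrag Q" "supported P" "supported Q" "size P = size Q"
    using assms by (rule div0E)
  have "(bloch_form (mfrag P) (mfrag P) + bloch_form (mfrag Q) (mfrag Q))
     - (bloch_form (mfrag P) (mfrag Q) + bloch_form (mfrag Q) (mfrag P)) \<in> H"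
    by (rule H_diff[OF bloch_form_self_pair[OF *(2-4)] bloch_form_antisym[OF *(2,3)]])
  thus ?thesis by (simp add: *(1) bloch_form_simps algebra_simps)
qed

lemma sect_div0:
  assumes "F \<in> sect n c" "F \<noteq> (\<lambda>_. 0)" "G \<in> sect n d" "G \<noteq> (\<lambda>_. 0)"
  shows "mfrag (dv F) - mfrag (dv G) \<in> div0"
  using supported_dv[OF assms(1,2)] supported_dv[OF assms(3,4)] size_dv[OF assms(1,2)] size_dv[OF assms(3,4)]
  by (intro div0I) auto

lemma Tform_swap:
  assumes "steinberg n c F G K" "Tform G F K \<in> H"
  shows "Tform F G K \<in> H"
proof -
  note S = steinbergD[OF assms(1)]
  have "Tform F G K + Tform G F K \<in> H"
    unfolding Tform_def
    by (rule div0_antisym[OF sect_div0[OF S(1,4) S(3,6)] sect_div0[OF S(2,5) S(3,6)]])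
  from H_diff[OF this assms(2)] show ?thesis by simp
qed

text \<open>With \<open>u\<close> and \<open>v\<close> the divisors of the two quotients, the
  rotated triple has the pair \<open>v - u\<close>, \<open>- u\<close>. The difference from the
  original is covered by antisymmetry and the diagonal term. Together with the transposition this
  yields every permutation.\<close>

lemma Tform_cyc:
  assumes "steinberg n c F G K" "Tform G K F \<in> H"
  shows "Tform F G K \<in> H"
proof -
  note S = steinbergD[OF assms(1)]
  define u v where "u = mfrag (dv F) - mfrag (dv K)" and "v = mfrag (dv G) - mfrag (dv K)"
  have uv: "u \<in> div0" "v \<in> div0" unfolding u_def v_def
    by (rule sect_div0[OF S(1,4) S(3,6)], rule sect_div0[OF S(2,5) S(3,6)])
  have "Tform G K F = bloch_form (v - u) (- u)"
    by (simp add: Tform_def u_def v_def)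
  hence 1: "bloch_form (v - u) (- u) \<in> H" using assms(2) by simp
  have "(bloch_form u v + bloch_form v u) + bloch_form (v - u) (- u) - bloch_form u u \<in> H"
    by (rule H_diff[OF H_add[OF div0_antisym[OF uv] 1] div0_alternating[OF uv(1)]])
  also have "(bloch_form u v + bloch_form v u) + bloch_form (v - u) (- u) - bloch_form u u = bloch_form u v"
    by (simp add: bloch_form_simps)
  finally have "bloch_form u v \<in> H" .
  thus ?thesis by (simp add: Tform_def u_def v_def)
qed

lemma Tform_swap23:
  assumes "steinberg n c F G K" "Tform F K G \<in> H"
  shows "Tform F G K \<in> H"
proof -
  have "steinberg n c G F K" "steinberg n c F K G"
    using assms(1) by (auto simp: steinberg_def algebra_simps)
  thus ?thesis using Tform_swap[OF assms(1)] Tform_cyc[of n c G F K] assms(2) by blast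
qed

text \<open>Equal sums of zeros make the four differences opposite in pairs: \<open>a - b\<close>
  and \<open>a' - b'\<close>, \<open>a - b'\<close> and \<open>a' - b\<close>.\<close>

lemma pair_in_H:
  assumes "F \<in> sect 2 c" "G \<in> sect 2 c" "F \<noteq> (\<lambda>_. 0)" "G \<noteq> (\<lambda>_. 0)"
  shows "bloch_form (mfrag (dv F)) (mfrag (dv G)) \<in> H"
proof -
  obtain a a' where a: "theta_rep F {#a, a'#}" "dv F = {#pt \<tau> a, pt \<tau> a'#}"
    by (rule theta_rep_size2[OF assms(1,3)])
  obtain b b' where b: "theta_rep G {#b, b'#}" "dv G = {#pt \<tau> b, pt \<tau> b'#}"
    by (rule theta_rep_size2[OF assms(2,4)])
  have "sum_mset {#a, a'#} - sum_mset {#b, b'#} \<in> \<Lambda>"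
    by (rule sum_zeros_congruent[OF assms(1,2) a(1) b(1)])
  hence L: "a + a' - (b + b') \<in> \<Lambda>" by simp
  have "(frag_of (pt \<tau> (a - b)) + frag_of (pt \<tau> (a' - b'))) +
        (frag_of (pt \<tau> (a - b')) + frag_of (pt \<tau> (a' - b))) \<in> H"
    by (rule H_add[OF H_antisym' H_antisym']) (use L in \<open>simp_all add: algebra_simps\<close>)
  thus ?thesis
    by (simp add: a b bloch_form_simps bloch_form_frag_of point_diff_pt algebra_simps)
qed

lemma Tform_degree_le_2:
  assumes st: "steinberg n c F G K" and "n \<le> 2"
  shows "Tform F G K \<in> H"
proof -
  note S = steinbergD[OF st]
  have "n \<ge> 0" using size_dv[OF S(1,4)] by simp
  then consider "n = 0" | "n = 1" | "n = 2" using assms(2) by linarith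
  thus ?thesis
  proof cases
    case 1
    have "dv F = {#}" "dv K = {#}" using size_dv[OF S(1,4)] size_dv[OF S(3,6)] 1 by auto
    thus ?thesis by (simp add: Tform_def bloch_form_simps H_0)
  next
    case 2
    have "dv F = dv K" by (rule dv_eq_degree_1[OF _ _ S(4,6)]) (use S 2 in auto)
    thus ?thesis by (simp add: Tform_def bloch_form_simps H_0)
  next
    case 3
    have S': "F \<in> sect 2 c" "G \<in> sect 2 c" "K \<in> sect 2 c" using S 3 by auto
    let ?B = "\<lambda>F G. bloch_form (mfrag (dv F)) (mfrag (dv G))"
    have "?B F G - ?B F K - (?B K G - ?B K K) \<in> H"
      by (rule H_diff[OF H_diff[OF pair_in_H[OF S'(1,2) S(4,5)] pair_in_H[OF S'(1,3) S(4,6)]]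
            H_diff[OF pair_in_H[OF S'(3,2) S(6,5)] pair_in_H[OF S'(3,3) S(6,6)]]])
    thus ?thesis by (simp add: Tform_def bloch_form_simps algebra_simps)
  qed
qed

text \<open>Put \<open>f = - FA / FC\<close> and \<open>g = - GA / GC\<close>. The hypotheses in
  \<open>T\<close> are the relations of \<open>g\<close>, \<open>f / g\<close>,
  \<open>f (1 - g) / (f - g)\<close> and \<open>(1 - g) / (f - g)\<close>, and \<open>u\<close>,
  \<open>v\<close>, \<open>u'\<close>, \<open>v'\<close>, \<open>d'\<close> are the divisors of
  \<open>f\<close>, \<open>1 - f\<close>, \<open>g\<close>, \<open>1 - g\<close>,
  \<open>f - g\<close>. What remains is a formal identity for alternating bilinear forms.\<close>

lemma fiveterm:
  assumes F: "steinberg n c FA FB FC" and G: "steinberg m d GA GB GC"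
    and N: "\<And>z. N z = FA z * GC z - FC z * GA z" "N \<noteq> (\<lambda>_. 0)"
    and T: "Tform GA GB GC \<in> H"
      "Tform (\<lambda>z. FA z * GC z) (\<lambda>z. - N z) (\<lambda>z. - (FC z * GA z)) \<in> H"
      "Tform (\<lambda>z. FA z * GB z) (\<lambda>z. - (FB z * GA z)) N \<in> H"
      "Tform (\<lambda>z. FC z * GB z) (\<lambda>z. - (FB z * GC z)) (\<lambda>z. - N z) \<in> H"
  shows "Tform FA FB FC \<in> H"
proof -
  note F' = steinbergD[OF F] and G' = steinbergD[OF G]
  have Ns: "N \<in> sect (n + m) (c * d)"
    using sect_diff[OF sect_mult[OF F'(1) G'(3)] sect_mult[OF F'(3) G'(1)]]
    by (simp add: N(1)[symmetric])
  let ?f = "\<lambda>F. mfrag (dv F)"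
  define u v u' v' d' where "u = ?f FA - ?f FC" and "v = ?f FB - ?f FC"
    and "u' = ?f GA - ?f GC" and "v' = ?f GB - ?f GC" and "d' = ?f N - ?f FC - ?f GC"
  have FC_GC: "(\<lambda>z. FC z * GC z) \<noteq> (\<lambda>_. 0)"
    by (intro entire_mult_nonzero sectD(2)[OF F'(3)] sectD(2)[OF G'(3)] F' G')
  have "?f N - ?f (\<lambda>z. FC z * GC z) \<in> div0"
    by (intro sect_div0[OF Ns N(2) sect_mult[OF F'(3) G'(3)] FC_GC])
  also have "?f N - ?f (\<lambda>z. FC z * GC z) = d'"
    by (simp add: d'_def dv_mult[OF F'(3,6) G'(3,6)] algebra_simps)
  finally have d': "d' \<in> div0" .
  have uv': "u' \<in> div0" "v' \<in> div0" unfolding u'_def v'_def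
    by (rule sect_div0[OF G'(1,4) G'(3,6)], rule sect_div0[OF G'(2,5) G'(3,6)])
  have prod: "dv (\<lambda>z. - (X z * Y z)) = dv X + dv Y" "dv (\<lambda>z. X z * Y z) = dv X + dv Y"
    if "X \<in> sect n c" "X \<noteq> (\<lambda>_. 0)" "Y \<in> sect m d" "Y \<noteq> (\<lambda>_. 0)" for X Y
    using dv_mult[OF that] dv_uminus[OF sect_mult[OF that(1,3)] entire_mult_nonzero[OF sectD(2)[OF that(1)] sectD(2)[OF that(3)] that(2,4)]] by auto
  note dvs = prod[OF F'(1,4) G'(3,6)] prod[OF F'(3,6) G'(1,4)] prod[OF F'(1,4) G'(2,5)]
    prod[OF F'(2,5) G'(1,4)] prod[OF F'(3,6) G'(2,5)] prod[OF F'(2,5) G'(3,6)] dv_uminus[OF Ns N(2)]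
  have 1: "bloch_form u' v' \<in> H" using T(1) by (simp add: Tform_def u'_def v'_def)
  have 2: "bloch_form (u - u') (d' - u') \<in> H"
    using T(2) by (simp add: Tform_def dvs u_def u'_def d'_def algebra_simps)
  have 3: "bloch_form (u + v' - d') (v + u' - d') \<in> H"
    using T(3) by (simp add: Tform_def dvs u_def v_def v'_def u'_def d'_def algebra_simps)
  have 4: "bloch_form (v' - d') (v - d') \<in> H"
    using T(4) by (simp add: Tform_def dvs v_def v'_def d'_def algebra_simps)
  have "bloch_form u' v' + bloch_form (u - u') (d' - u')
     + bloch_form (u + v' - d') (v + u' - d') - bloch_form (v' - d') (v - d')
     - (bloch_form u' v' + bloch_form v' u') + (bloch_form u' d' + bloch_form d' u')
     - bloch_form u' u' \<in> H"
    by (rule H_diff[OF H_add[OF H_diff[OF H_diff[OF H_add[OF H_add[OF 1 2] 3] 4]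
          div0_antisym[OF uv']] div0_antisym[OF uv'(1) d']] div0_alternating[OF uv'(1)]])
  also have "bloch_form u' v' + bloch_form (u - u') (d' - u')
     + bloch_form (u + v' - d') (v + u' - d') - bloch_form (v' - d') (v - d')
     - (bloch_form u' v' + bloch_form v' u') + (bloch_form u' d' + bloch_form d' u')
     - bloch_form u' u' = bloch_form u v"
    by (simp add: bloch_form_simps)
  finally show ?thesis by (simp add: Tform_def u_def v_def)
qed

end

section \<open>Steinberg relations of arbitrary degree\<close>

text \<open>\<open>b1\<close> and \<open>b2\<close> would both have to occupy the single place of
  \<open>a3\<close>. This shows that two sections with three zeros each are not
  proportional.\<close>

lemma mset_triple_disjoint:
  assumes "M = N" "M = {#a1, a2, a3#}" "N = {#b1, b2, b3#}"
    "b1 \<noteq> a1" "b1 \<noteq> a2" "b2 \<noteq> a1" "b2 \<noteq> a2"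
  shows False
proof -
  have eq: "{#a1, a2, a3#} = {#b1, b2, b3#}" using assms(1-3) by simp
  hence "b1 \<in># {#a1, a2, a3#}" by simp
  hence "b1 = a3" using assms(4,5) by simp
  with eq have "{#a1, a2#} = {#b2, b3#}" by (simp add: add_mset_commute)
  hence "b2 \<in># {#a1, a2#}" by simp
  thus False using assms(6,7) by simp
qed

text \<open>A vanishing Wronskian makes \<open>F / G\<close> constant near \<open>a\<close>, where
  its value is 0, so that \<open>F\<close> would vanish on a disc and hence everywhere.\<close>

lemma wronskian_nonzero:
  fixes F G :: "complex \<Rightarrow> complex"
  assumes "F holomorphic_on UNIV" "G holomorphic_on UNIV" "F \<noteq> (\<lambda>_. 0)" "F a = 0" "G a \<noteq> 0"
  shows "(\<lambda>z. deriv F z * G z - F z * deriv G z) \<noteq> (\<lambda>_. 0)"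
proof
  assume W: "(\<lambda>z. deriv F z * G z - F z * deriv G z) = (\<lambda>_. 0)"
  have cont: "continuous (at a) G"
    using assms(2) by (simp add: holomorphic_on_imp_differentiable_at field_differentiable_imp_continuous_at)
  obtain e where e: "e > 0" "\<And>z. z \<in> ball a e \<Longrightarrow> G z \<noteq> 0"
    using continuous_at_avoid[OF cont assms(5)] unfolding mem_ball by blast
  have der: "((\<lambda>z. F z / G z) has_field_derivative 0) (at z within ball a e)" if "z \<in> ball a e" for z
  proof -
    have "(F has_field_derivative deriv F z) (at z)" "(G has_field_derivative deriv G z) (at z)"
      using assms(1,2) by (auto intro: holomorphic_derivI)
    hence "((\<lambda>z. F z / G z) has_field_derivative
             (deriv F z * G z - F z * deriv G z) / (G z * G z)) (at z)"
      using e(2)[OF that] by (rule DERIV_divide)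
    hence "((\<lambda>z. F z / G z) has_field_derivative 0) (at z)" using fun_cong[OF W, of z] by simp
    thus ?thesis by (rule has_field_derivative_at_within)
  qed
  have "\<exists>k. \<forall>z\<in>ball a e. F z / G z = k"
    by (rule has_field_derivative_zero_constant[OF convex_ball der])
  then obtain k where k: "\<And>z. z \<in> ball a e \<Longrightarrow> F z / G z = k" by blast
  have "k = 0" using k[of a] assms(4) e(1) by simp
  hence F0: "F z = 0" if "z \<in> ball a e" for z
    using k[OF that] e(2)[OF that] by simp
  have "F z = 0" for z
    by (rule analytic_continuation_open[of "ball a e" UNIV F "\<lambda>_. 0"])
       (use e(1) in \<open>simp_all add: F0 assms(1) not_le connected_UNIV\<close>)
  thus False using assms(3) by auto
qed

section \<open>Sections with prescribed zeros\<close>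

context torus
begin

text \<open>Distinctness modulo the lattice ensures that the zero at \<open>b\<close> survives the
  division by \<open>theta (z - a)\<close>.\<close>

lemma sect_split_two_zeros:
  assumes "F \<in> sect n c" "F a = 0" "F b = 0" "a - b \<notin> \<Lambda>"
  obtains F' where "F' holomorphic_on UNIV" "F = (\<lambda>z. (theta (z - a) * theta (z - b)) * F' z)"
proof -
  obtain F1 where F1: "F1 \<in> sect (n - 1) (c / - ee a)" "F = (\<lambda>z. theta (z - a) * F1 z)"
    by (rule sect_divide_theta[OF assms(1,2)])
  have "theta (b - a) \<noteq> 0" using assms(4) lattice_minus_commute by (simp add: theta_eq_0_iff)
  hence "F1 b = 0" using assms(3) F1(2) by auto
  then obtain F2 where F2: "F2 \<in> sect (n - 1 - 1) (c / - ee a / - ee b)" "F1 = (\<lambda>z. theta (z - b) * F2 z)"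
    using sect_divide_theta[OF F1(1)] by blast
  show ?thesis by (rule that[OF sectD(2)[OF F2(1)]]) (auto simp: F1(2) F2(2))
qed

text \<open>Zeros are counted with multiplicity here: \<open>a\<close> and \<open>b\<close> may be
  equivalent.\<close>

lemma sect_two_zeros:
  assumes "F \<in> sect n c" "n \<ge> 2"
  obtains a b F' where "F' holomorphic_on UNIV" "F = (\<lambda>z. (theta (z - a) * theta (z - b)) * F' z)"
proof -
  obtain a where a: "F a = 0" using sect_has_zero[OF assms(1)] assms(2) by auto
  obtain F1 where F1: "F1 \<in> sect (n - 1) (c / - ee a)" "F = (\<lambda>z. theta (z - a) * F1 z)"
    by (rule sect_divide_theta[OF assms(1) a])
  obtain b where b: "F1 b = 0" using sect_has_zero[OF F1(1)] assms(2) by auto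
  obtain F2 where F2: "F2 \<in> sect (n - 1 - 1) (c / - ee a / - ee b)" "F1 = (\<lambda>z. theta (z - b) * F2 z)"
    by (rule sect_divide_theta[OF F1(1) b])
  show ?thesis by (rule that[OF sectD(2)[OF F2(1)]]) (auto simp: F1(2) F2(2))
qed

lemma theta_pair_sect: "(\<lambda>z. theta (z - a) * theta (z - b)) \<in> sect 2 (ee (a + b))"
  by (rule sect_mult'[OF theta_sect theta_sect]) (auto simp: ee_add)

lemma theta_pair_nonzero: "(\<lambda>z. theta (z - a) * theta (z - b)) \<noteq> (\<lambda>_. 0)"
  by (intro entire_mult_nonzero theta_nonzero sectD(2)[OF theta_sect])

lemma theta_triple_sect:
  "(\<lambda>z. theta (z - a) * theta (z - b) * theta (z - c)) \<in> sect 3 (- ee (a + b + c))"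
  by (rule sect_mult'[OF theta_pair_sect theta_sect]) (auto simp: ee_add)

text \<open>If the difference vanished, the two products would have equal divisors. As
  \<open>FA\<close> and \<open>FC\<close> have no common zero, all \<open>n\<close> zeros of
  \<open>FA\<close> would lie among the \<open>m\<close> zeros of \<open>GA\<close>.\<close>

lemma cross_nonzero:
  assumes "steinberg n c FA FB FC" "steinberg m d GA GB GC" "m < n"
    and disj: "\<And>z. FA z = 0 \<Longrightarrow> FB z \<noteq> 0"
  shows "(\<lambda>z. FA z * GC z - FC z * GA z) \<noteq> (\<lambda>_. 0)"
proof
  note F = steinbergD[OF assms(1)] and G = steinbergD[OF assms(2)]
  assume "(\<lambda>z. FA z * GC z - FC z * GA z) = (\<lambda>_. 0)"
  hence "(\<lambda>z. FA z * GC z) = (\<lambda>z. FC z * GA z)" by (auto simp: fun_eq_iff)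
  hence eq: "dv FA + dv GC = dv FC + dv GA"
    using dv_mult[OF F(1,4) G(3,6)] dv_mult[OF F(3,6) G(1,4)] by simp
  have "dv FA \<subseteq># dv GA"
  proof (rule mset_subset_eqI)
    fix x show "count (dv FA) x \<le> count (dv GA) x"
    proof (cases "x \<in># dv FA")
      case True
      then obtain a where a: "x = pt \<tau> a" "FA a = 0" by (rule in_dvE[OF F(1,4)])
      have "FC a \<noteq> 0" using disj[OF a(2)] F(7)[of a] a(2) by auto
      hence "x \<notin># dv FC" using a(1) in_dv_iff[OF F(3,6)] by simp
      hence "count (dv FC) x = 0" by (simp add: not_in_iff)
      thus ?thesis using arg_cong[OF eq, of "\<lambda>M. count M x"] by simp
    next
      case False
      hence "count (dv FA) x = 0" by (simp add: not_in_iff)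
      thus ?thesis by simp
    qed
  qed
  hence "size (dv FA) \<le> size (dv GA)" by (rule size_mset_mono)
  with size_dv[OF F(1,4)] size_dv[OF G(1,4)] assms(3) show False by linarith
qed

end

context bloch_subgroup
begin

definition solved_below where
  "solved_below n \<longleftrightarrow> (\<forall>k<n. \<forall>c F G K. steinberg k c F G K \<longrightarrow> Tform F G K \<in> H)"

lemma solved_belowD: "solved_below n \<Longrightarrow> k < n \<Longrightarrow> steinberg k c F G K \<Longrightarrow> Tform F G K \<in> H"
  by (auto simp: solved_below_def)

text \<open>Each of the two products takes one factor divisible by \<open>M1\<close> and one
  divisible by \<open>M2\<close>, so \<open>M1 * M2\<close> cancels from the whole relation. The
  degree left is \<open>n + m - p - q\<close>, which is less than \<open>n\<close>.\<close>

lemma Tform_cross: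
  assumes IH: "solved_below n"
    and F: "F1 \<in> sect n c" "F2 \<in> sect n c" and G: "G1 \<in> sect m d" "G2 \<in> sect m d"
    and nz: "F1 \<noteq> (\<lambda>_. 0)" "F2 \<noteq> (\<lambda>_. 0)" "G1 \<noteq> (\<lambda>_. 0)" "G2 \<noteq> (\<lambda>_. 0)"
    and M: "M1 \<in> sect p e1" "M2 \<in> sect q e2" "M1 \<noteq> (\<lambda>_. 0)" "M2 \<noteq> (\<lambda>_. 0)"
    and F': "F1 = (\<lambda>z. M1 z * F1' z)" "F2 = (\<lambda>z. M2 z * F2' z)"
    and G': "G1 = (\<lambda>z. M1 z * G1' z)" "G2 = (\<lambda>z. M2 z * G2' z)"
    and hol: "F1' holomorphic_on UNIV" "F2' holomorphic_on UNIV"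
             "G1' holomorphic_on UNIV" "G2' holomorphic_on UNIV"
    and N: "(\<lambda>z. F1 z * G2 z - F2 z * G1 z) \<noteq> (\<lambda>_. 0)" and less: "m < p + q"
  shows "Tform (\<lambda>z. F1 z * G2 z) (\<lambda>z. - (F2 z * G1 z)) (\<lambda>z. - (F1 z * G2 z - F2 z * G1 z)) \<in> H"
proof -
  have s: "F1' \<in> sect (n - p) (c / e1)" "F2' \<in> sect (n - q) (c / e2)"
    "G1' \<in> sect (m - p) (d / e1)" "G2' \<in> sect (m - q) (d / e2)"
    by (rule sect_quotient[OF F(1) M(1,3) hol(1)], simp add: F',
        rule sect_quotient[OF F(2) M(2,4) hol(2)], simp add: F',
        rule sect_quotient[OF G(1) M(1,3) hol(3)], simp add: G',
        rule sect_quotient[OF G(2) M(2,4) hol(4)], simp add: G')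
  define X where "X = (\<lambda>z. F1' z * G2' z)"
  define Y where "Y = (\<lambda>z. F2' z * G1' z)"
  have X: "X \<in> sect (n + m - p - q) (c * d / (e1 * e2))"
    unfolding X_def by (rule sect_mult'[OF s(1,4)]) auto
  have Y: "Y \<in> sect (n + m - p - q) (c * d / (e1 * e2))"
    unfolding Y_def by (rule sect_mult'[OF s(2,3)]) auto
  have nz': "F1' \<noteq> (\<lambda>_. 0)" "F2' \<noteq> (\<lambda>_. 0)" "G1' \<noteq> (\<lambda>_. 0)" "G2' \<noteq> (\<lambda>_. 0)"
    using nz F' G' by auto
  have "steinberg (n + m - p - q) (c * d / (e1 * e2)) X (\<lambda>z. - Y z) (\<lambda>z. - (X z - Y z))"
    unfolding steinberg_def
  proof (intro conjI allI)
    show "X \<noteq> (\<lambda>_. 0)" unfolding X_def by (intro entire_mult_nonzero hol nz')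
    have "Y \<noteq> (\<lambda>_. 0)" unfolding Y_def by (intro entire_mult_nonzero hol nz')
    thus "(\<lambda>z. - Y z) \<noteq> (\<lambda>_. 0)" by (auto simp: fun_eq_iff)
    show "(\<lambda>z. - (X z - Y z)) \<noteq> (\<lambda>_. 0)"
    proof
      assume "(\<lambda>z. - (X z - Y z)) = (\<lambda>_. 0)"
      hence "X z = Y z" for z using fun_cong[of _ _ z] by fastforce
      hence "F1 z * G2 z - F2 z * G1 z = 0" for z
        using \<open>\<And>z. X z = Y z\<close>[of z] unfolding X_def Y_def F' G' by (simp add: mult_ac)
      with N show False by simp
    qed
  qed (auto intro!: sect_uminus sect_diff X Y)
  note st = this
  have "Tform X (\<lambda>z. - Y z) (\<lambda>z. - (X z - Y z)) \<in> H"
    by (rule solved_belowD[OF IH _ st]) (use less in simp)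
  also have "Tform X (\<lambda>z. - Y z) (\<lambda>z. - (X z - Y z)) =
      Tform (\<lambda>z. (M1 z * M2 z) * X z) (\<lambda>z. (M1 z * M2 z) * - Y z) (\<lambda>z. (M1 z * M2 z) * - (X z - Y z))"
    by (rule sym, rule Tform_cancel[OF st sect_mult[OF M(1,2)]])
       (intro entire_mult_nonzero sectD(2)[OF M(1)] sectD(2)[OF M(2)] M)
  also have "(\<lambda>z. (M1 z * M2 z) * X z) = (\<lambda>z. F1 z * G2 z)"
    by (auto simp: X_def F' G' mult_ac)
  also have "(\<lambda>z. (M1 z * M2 z) * - Y z) = (\<lambda>z. - (F2 z * G1 z))"
    by (auto simp: Y_def F' G' mult_ac)
  also have "(\<lambda>z. (M1 z * M2 z) * - (X z - Y z)) = (\<lambda>z. - (F1 z * G2 z - F2 z * G1 z))"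
    by (auto simp: X_def Y_def F' G' algebra_simps)
  finally show ?thesis .
qed

text \<open>
  The five-term relation expresses the relation of the degree-\<open>n\<close> pencil by that of the
  degree-\<open>m\<close> pencil and three cross terms of degree \<open>n + m\<close>.  If corresponding members share
  \<open>p\<close>, \<open>q\<close>, \<open>r\<close> zeros, cancelling them brings the degree of the cross terms below \<open>n\<close>.
\<close>
lemma Tform_reduce:
  assumes IH: "solved_below n"
    and F: "steinberg n c FA FB FC" and G: "steinberg m d GA GB GC" and "m < n"
    and disj: "\<And>z. FA z = 0 \<Longrightarrow> FB z \<noteq> 0"
    and M: "MA \<in> sect p eA" "MB \<in> sect q eB" "MC \<in> sect r eC"
      "MA \<noteq> (\<lambda>_. 0)" "MB \<noteq> (\<lambda>_. 0)" "MC \<noteq> (\<lambda>_. 0)"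
    and F': "FA = (\<lambda>z. MA z * FA' z)" "FB = (\<lambda>z. MB z * FB' z)" "FC = (\<lambda>z. MC z * FC' z)"
    and G': "GA = (\<lambda>z. MA z * GA' z)" "GB = (\<lambda>z. MB z * GB' z)" "GC = (\<lambda>z. MC z * GC' z)"
    and hol: "FA' holomorphic_on UNIV" "FB' holomorphic_on UNIV" "FC' holomorphic_on UNIV"
      "GA' holomorphic_on UNIV" "GB' holomorphic_on UNIV" "GC' holomorphic_on UNIV"
    and less: "m < p + q" "m < q + r" "m < p + r"
  shows "Tform FA FB FC \<in> H"
proof -
  note S = steinbergD[OF F] and R = steinbergD[OF G]
  define N where "N = (\<lambda>z. FA z * GC z - FC z * GA z)"
  have N0: "N \<noteq> (\<lambda>_. 0)"
    unfolding N_def by (rule cross_nonzero[OF F G \<open>m < n\<close> disj])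
  have FCe: "FC z = - FA z - FB z" "GC z = - GA z - GB z" for z
    using S(7)[of z] R(7)[of z] by (simp_all add: eq_neg_iff_add_eq_0 algebra_simps)
  \<comment> \<open>Both triples sum to zero, so the three cross differences agree up to sign and
    one section \<open>N\<close> serves all of them.\<close>
  have N_AB: "(\<lambda>z. FA z * GB z - FB z * GA z) = (\<lambda>z. - N z)"
    unfolding N_def by (simp add: FCe algebra_simps)
  have N_CB: "(\<lambda>z. FC z * GB z - FB z * GC z) = N"
    unfolding N_def by (simp add: FCe algebra_simps)
  have N0': "(\<lambda>z. - N z) \<noteq> (\<lambda>_. 0)" using N0 by (auto simp: fun_eq_iff)
  have Ns: "N \<in> sect (n + m) (c * d)"
    unfolding N_def by (intro sect_diff sect_mult S R)
  have AC: "Tform (\<lambda>z. FA z * GC z) (\<lambda>z. - (FC z * GA z)) (\<lambda>z. - N z) \<in> H"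
    using Tform_cross[OF IH S(1,3) R(1,3) S(4,6) R(4,6) M(1,3,4,6) F'(1,3) G'(1,3) hol(1,3,4,6)]
      N0 less(3) unfolding N_def by simp
  have AB: "Tform (\<lambda>z. FA z * GB z) (\<lambda>z. - (FB z * GA z)) N \<in> H"
    using Tform_cross[OF IH S(1,2) R(1,2) S(4,5) R(4,5) M(1,2,4,5) F'(1,2) G'(1,2) hol(1,2,4,5)]
      N0' less(1) unfolding N_AB fun_cong[OF N_AB] by simp
  have CB: "Tform (\<lambda>z. FC z * GB z) (\<lambda>z. - (FB z * GC z)) (\<lambda>z. - N z) \<in> H"
    using Tform_cross[OF IH S(3,2) R(3,2) S(6,5) R(6,5) M(3,2,6,5) F'(3,2) G'(3,2) hol(3,2,6,5)]
      N0 less(2) unfolding N_CB fun_cong[OF N_CB] by (simp add: add.commute)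
  have st: "steinberg (n + m) (c * d) (\<lambda>z. FA z * GC z) (\<lambda>z. - N z) (\<lambda>z. - (FC z * GA z))"
    unfolding steinberg_def
  proof (intro conjI allI)
    show "(\<lambda>z. FA z * GC z) \<noteq> (\<lambda>_. 0)"
      by (intro entire_mult_nonzero sectD(2)[OF S(1)] sectD(2)[OF R(3)] S R)
    have "(\<lambda>z. FC z * GA z) \<noteq> (\<lambda>_. 0)"
      by (intro entire_mult_nonzero sectD(2)[OF S(3)] sectD(2)[OF R(1)] S R)
    thus "(\<lambda>z. - (FC z * GA z)) \<noteq> (\<lambda>_. 0)" by (auto simp: fun_eq_iff)
    show "FA z * GC z + - N z + - (FC z * GA z) = 0" for z by (simp add: N_def)
  qed (use N0' in \<open>auto intro!: sect_uminus sect_mult Ns S R\<close>)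
  show ?thesis
  proof (rule fiveterm[OF F G _ N0 _ _ AB CB])
    show "Tform GA GB GC \<in> H" by (rule solved_belowD[OF IH \<open>m < n\<close> G])
    show "Tform (\<lambda>z. FA z * GC z) (\<lambda>z. - N z) (\<lambda>z. - (FC z * GA z)) \<in> H"
      by (rule Tform_swap23[OF st AC])
  qed (simp add: N_def)
qed

text \<open>If \<open>a1 + a2\<close> and \<open>b1 + b2'\<close> agree on the curve, the two theta
  pairs lie in a common space of degree 2, and the member of their pencil through \<open>c1\<close>
  gives 2, 2 and 1 shared zeros. Otherwise each pair receives a third zero bringing its sum to
  \<open>- w\<close>, and \<open>w\<close> is chosen so that one member passes through both
  \<open>c1\<close> and \<open>c2\<close>.\<close>

lemma Tform_step:
  assumes IH: "solved_below n"
    and F: "steinberg n c FA FB FC" and "n \<ge> 4"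
    and disj: "\<And>z. FA z = 0 \<Longrightarrow> FB z \<noteq> 0"
    and c12: "FC c1 = 0" "FC c2 = 0" "c1 - c2 \<notin> \<Lambda>"
  shows "Tform FA FB FC \<in> H"
proof -
  note S = steinbergD[OF F]
  have n2: "n \<ge> 2" using \<open>n \<ge> 4\<close> by simp
  obtain a1 a2 FA' where FA': "FA' holomorphic_on UNIV" "FA = (\<lambda>z. (theta (z - a1) * theta (z - a2)) * FA' z)"
    by (rule sect_two_zeros[OF S(1) n2])
  obtain b1 b2' FB' where FB': "FB' holomorphic_on UNIV" "FB = (\<lambda>z. (theta (z - b1) * theta (z - b2')) * FB' z)"
    by (rule sect_two_zeros[OF S(2) n2])
  have Fa: "FA a1 = 0" "FA a2 = 0" and Fb: "FB b1 = 0" "FB b2' = 0"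
    by (simp_all add: FA' FB')
  have nz_ab: "FB a1 \<noteq> 0" "FB a2 \<noteq> 0" "FA b1 \<noteq> 0" "FA b2' \<noteq> 0"
    using Fa Fb disj by auto
  have nz_c: "FA x \<noteq> 0" "FB x \<noteq> 0" if "FC x = 0" for x
    using that disj[of x] S(7)[of x] by auto
  have sep: "x - y \<notin> \<Lambda>" if "FX \<in> sect n c" "FX x \<noteq> 0" "FX y = 0" for FX x y
    using sect_zero_lattice[OF that(1)] that by blast
  show ?thesis
  proof (cases "(a1 + a2) - (b1 + b2') \<in> \<Lambda>")
    case True
    \<comment> \<open>A common multiplier needs sums that agree in the plane and not only modulo the
      lattice, so \<open>b2'\<close> is replaced by an equivalent representative.\<close>
    define b2 where "b2 = a1 + a2 - b1"
    have L: "b2 - b2' \<in> \<Lambda>" using True by (simp add: b2_def algebra_simps)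
    hence Fb2: "FB b2 = 0" using sect_zero_lattice[OF S(2)] Fb by blast
    obtain FB'' where FB'': "FB'' holomorphic_on UNIV" "FB = (\<lambda>z. (theta (z - b1) * theta (z - b2)) * FB'' z)"
    proof -
      have "b2' - b2 \<in> \<Lambda>" using L lattice_minus_commute by blast
      from sect_lattice[OF theta_sect[of 0] this]
      obtain k C where kC: "C \<noteq> 0" "\<And>z. theta (z + (b2' - b2)) = C * ee (of_int k * z) * theta z"
        by (simp only: diff_zero) blast
      have "theta (z - b2') = inverse C * ee (- (of_int k * (z - b2'))) * theta (z - b2)" for z
      proof -
        define E where "E = ee (of_int k * (z - b2'))"
        have "E \<noteq> 0" by (simp add: E_def)
        moreover have "theta (z - b2) = C * E * theta (z - b2')"
          using kC(2)[of "z - b2'"] by (simp add: E_def)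
        ultimately show ?thesis using kC(1) unfolding ee_minus E_def[symmetric] by (simp add: field_simps)
      qed
      hence "FB = (\<lambda>z. (theta (z - b1) * theta (z - b2)) *
                (inverse C * ee (- (of_int k * (z - b2'))) * FB' z))"
        unfolding FB'(2) by (simp add: mult_ac)
      moreover have "(\<lambda>z. inverse C * ee (- (of_int k * (z - b2'))) * FB' z) holomorphic_on UNIV"
        by (intro holomorphic_intros FB')
      ultimately show ?thesis by (rule that[rotated])
    qed
    obtain FC' where FC': "FC' \<in> sect (n - 1) (c / - ee c1)" "FC = (\<lambda>z. theta (z - c1) * FC' z)"
      by (rule sect_divide_theta[OF S(3) c12(1)])
    \<comment> \<open>Coefficients that make the combination vanish at \<open>c1\<close>; they are
      nonzero because \<open>FA\<close> and \<open>FB\<close> do not vanish there.\<close>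
    define \<alpha> \<beta> where "\<alpha> = theta (c1 - b1) * theta (c1 - b2)" and "\<beta> = - (theta (c1 - a1) * theta (c1 - a2))"
    have \<alpha>: "\<alpha> \<noteq> 0" and \<beta>: "\<beta> \<noteq> 0"
      unfolding \<alpha>_def \<beta>_def using sep[OF S(2), of c1] sep[OF S(1), of c1] nz_c[OF c12(1)] Fa Fb Fb2
      by (auto simp: theta_eq_0_iff)
    define GA where "GA = (\<lambda>z. theta (z - a1) * theta (z - a2) * \<alpha>)"
    define GB where "GB = (\<lambda>z. theta (z - b1) * theta (z - b2) * \<beta>)"
    define GC where "GC = (\<lambda>z. - (GA z + GB z))"
    have GA: "GA \<in> sect 2 (ee (a1 + a2))"
      using sect_cmult[OF theta_pair_sect, of \<alpha> a1 a2] by (simp add: GA_def mult_ac)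
    have GB: "GB \<in> sect 2 (ee (a1 + a2))"
      using sect_cmult[OF theta_pair_sect, of \<beta> b1 b2] by (simp add: GB_def b2_def mult_ac)
    have GC: "GC \<in> sect 2 (ee (a1 + a2))"
      unfolding GC_def by (intro sect_uminus sect_add GA GB)
    have "GA a1 + GB a1 \<noteq> 0"
      unfolding GA_def GB_def using \<beta> sep[OF S(2) nz_ab(1)] Fb Fb2 by (auto simp: theta_eq_0_iff)
    hence "- GC a1 \<noteq> 0" by (simp only: GC_def minus_minus not_False_eq_True)
    hence GC0: "GC \<noteq> (\<lambda>_. 0)" by auto
    have st: "steinberg 2 (ee (a1 + a2)) GA GB GC"
      unfolding steinberg_def using GA GB GC GC0 theta_pair_nonzero \<alpha> \<beta>
      by (auto simp: GA_def GB_def GC_def fun_eq_iff)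
    have "GC c1 = 0" by (simp add: GC_def GA_def GB_def \<alpha>_def \<beta>_def)
    then obtain GC' where GC': "GC' \<in> sect (2 - 1) (ee (a1 + a2) / - ee c1)" "GC = (\<lambda>z. theta (z - c1) * GC' z)"
      by (rule sect_divide_theta[OF GC])
    show ?thesis
      by (rule Tform_reduce[OF IH F st _ disj theta_pair_sect theta_pair_sect theta_sect
            theta_pair_nonzero theta_pair_nonzero theta_nonzero FA'(2) FB''(2) FC'(2) GA_def GB_def GC'(2)
            FA'(1) FB''(1) sectD(2)[OF FC'(1)] _ _ sectD(2)[OF GC'(1)]])
         (use \<open>n \<ge> 4\<close> in auto)
  next
    case False
    define b2 where "b2 = b2'"
    define sa sb where "sa = a1 + a2" and "sb = b1 + b2"
    have sab: "sa - sb \<notin> \<Lambda>" "sb - sa \<notin> \<Lambda>" using False lattice_minus_commute by (auto simp: sa_def sb_def b2_def)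
    have c12': "c2 - c1 \<notin> \<Lambda>" using c12(3) lattice_minus_commute by blast
    \<comment> \<open>\<open>k1\<close> and \<open>k2\<close> are the parts of
      \<open>s c1 * u c2\<close> and \<open>s c2 * u c1\<close> that do not involve the free
      parameter \<open>w\<close>.\<close>
    define k1 where "k1 = theta (c1 - a1) * theta (c1 - a2) * theta (c2 - b1) * theta (c2 - b2)"
    define k2 where "k2 = theta (c2 - a1) * theta (c2 - a2) * theta (c1 - b1) * theta (c1 - b2)"
    have ne: "theta (x - a1) \<noteq> 0" "theta (x - a2) \<noteq> 0" "theta (x - b1) \<noteq> 0" "theta (x - b2) \<noteq> 0"
      if "FC x = 0" for x
      using sep[OF S(2), of x] sep[OF S(1), of x] nz_c[OF that] Fa Fb by (auto simp: theta_eq_0_iff b2_def)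
    have k: "k1 \<noteq> 0" "k2 \<noteq> 0" unfolding k1_def k2_def using ne[OF c12(1)] ne[OF c12(2)] by auto
    \<comment> \<open>A zero \<open>w\<close> of \<open>\<Psi>\<close> satisfies \<open>s c1 * u c2 = s c2 * u c1\<close> for the sections \<open>s\<close>, \<open>u\<close> below, so that the
      member of their pencil vanishing at \<open>c1\<close> vanishes at \<open>c2\<close> as well.\<close>
    define \<Psi> where "\<Psi> = (\<lambda>w. k1 * (theta (w - - (c1 + sa)) * theta (w - - (c2 + sb))) +
                              - k2 * (theta (w - - (c2 + sa)) * theta (w - - (c1 + sb))))"
    have "\<Psi> \<in> sect 2 (ee (- (c1 + c2 + sa + sb)))"
      unfolding \<Psi>_def
    proof (rule sect_lincomb)
      show "(\<lambda>w. theta (w - - (c1 + sa)) * theta (w - - (c2 + sb))) \<in> sect 2 (ee (- (c1 + c2 + sa + sb)))"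
        using theta_pair_sect[of "- (c1 + sa)" "- (c2 + sb)"] by (simp add: algebra_simps)
      show "(\<lambda>w. theta (w - - (c2 + sa)) * theta (w - - (c1 + sb))) \<in> sect 2 (ee (- (c1 + c2 + sa + sb)))"
        using theta_pair_sect[of "- (c2 + sa)" "- (c1 + sb)"] by (simp add: algebra_simps)
    qed
    then obtain w where w0: "\<Psi> w = 0" by (rule sect_has_zero) simp
    hence w: "k1 * (theta (w + c1 + sa) * theta (w + c2 + sb)) = k2 * (theta (w + c2 + sa) * theta (w + c1 + sb))"
      by (simp add: \<Psi>_def algebra_simps)
    have not_both: "\<not> (theta x = 0 \<and> theta y = 0)" if "x - y \<notin> \<Lambda>" for x y
      using lattice_diff[of x y] that by (auto simp: theta_eq_0_iff)
    have nb: "\<not> (theta (w + c1 + sa) = 0 \<and> theta (w + c2 + sa) = 0)"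
      "\<not> (theta (w + c1 + sa) = 0 \<and> theta (w + c1 + sb) = 0)"
      "\<not> (theta (w + c1 + sb) = 0 \<and> theta (w + c2 + sb) = 0)"
      by (rule not_both; use sab c12 c12' in \<open>simp add: algebra_simps\<close>)+
    \<comment> \<open>If either factor vanished, the equation for \<open>w\<close> would force a
      second theta factor to vanish at a point differing from the first by \<open>sa - sb\<close> or
      \<open>c1 - c2\<close> up to sign. Neither is a period, by the case assumption and by the
      distinctness of \<open>c1\<close> and \<open>c2\<close>.\<close>
    have ta: "theta (w + c1 + sa) \<noteq> 0" and tb: "theta (w + c1 + sb) \<noteq> 0"
      using nb w k by auto
    define s where "s = (\<lambda>z. theta (z - a1) * theta (z - a2) * theta (z - - (w + sa)))"
    define u where "u = (\<lambda>z. theta (z - b1) * theta (z - b2) * theta (z - - (w + sb)))"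
    have s: "s \<in> sect 3 (- ee (- w))" and u: "u \<in> sect 3 (- ee (- w))"
      unfolding s_def u_def
      using theta_triple_sect[of a1 a2 "- (w + sa)"] theta_triple_sect[of b1 b2 "- (w + sb)"]
      by (simp_all add: sa_def sb_def)
    have s0: "s \<noteq> (\<lambda>_. 0)" and u0: "u \<noteq> (\<lambda>_. 0)"
      unfolding s_def u_def
      by (intro entire_mult_nonzero[OF sectD(2)[OF theta_pair_sect] sectD(2)[OF theta_sect]]
            theta_pair_nonzero theta_nonzero)+
    define \<alpha> \<beta> where "\<alpha> = u c1" and "\<beta> = - s c1"
    have \<alpha>: "\<alpha> \<noteq> 0" and \<beta>: "\<beta> \<noteq> 0"
      unfolding \<alpha>_def \<beta>_def s_def u_def using ta tb ne[OF c12(1)] by (simp_all add: algebra_simps)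
    define GA where "GA = (\<lambda>z. (theta (z - a1) * theta (z - a2)) * (\<alpha> * theta (z - - (w + sa))))"
    define GB where "GB = (\<lambda>z. (theta (z - b1) * theta (z - b2)) * (\<beta> * theta (z - - (w + sb))))"
    have GAs: "GA = (\<lambda>z. \<alpha> * s z)" and GBu: "GB = (\<lambda>z. \<beta> * u z)"
      by (auto simp: GA_def GB_def s_def u_def)
    define GC where "GC = (\<lambda>z. - (GA z + GB z))"
    have GA: "GA \<in> sect 3 (- ee (- w))" and GB: "GB \<in> sect 3 (- ee (- w))"
      unfolding GAs GBu by (intro sect_cmult s u)+
    have GC: "GC \<in> sect 3 (- ee (- w))"
      unfolding GC_def by (intro sect_uminus sect_add GA GB)
    have GC0: "GC \<noteq> (\<lambda>_. 0)"
    proof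
      assume "GC = (\<lambda>_. 0)"
      hence "- GC z = 0" for z by simp
      hence "GA z + GB z = 0" for z by (simp only: GC_def minus_minus)
      hence "\<alpha> * s z = - (\<beta> * u z)" for z by (simp add: GAs GBu eq_neg_iff_add_eq_0)
      hence "s = (\<lambda>z. (- \<beta> / \<alpha>) * u z)" using \<alpha> by (auto simp: field_simps fun_eq_iff)
      hence "dv s = dv u" using dv_cmult[OF u u0, of "- \<beta> / \<alpha>"] \<alpha> \<beta> by simp
      moreover have "dv s = {#pt \<tau> a1, pt \<tau> a2, pt \<tau> (- (w + sa))#}"
        unfolding s_def
        by (subst dv_mult[OF theta_pair_sect theta_pair_nonzero theta_sect theta_nonzero],
            subst dv_mult[OF theta_sect theta_nonzero theta_sect theta_nonzero]) (simp add: dv_theta)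
      moreover have "dv u = {#pt \<tau> b1, pt \<tau> b2, pt \<tau> (- (w + sb))#}"
        unfolding u_def
        by (subst dv_mult[OF theta_pair_sect theta_pair_nonzero theta_sect theta_nonzero],
            subst dv_mult[OF theta_sect theta_nonzero theta_sect theta_nonzero]) (simp add: dv_theta)
      moreover have "pt \<tau> b1 \<noteq> pt \<tau> a1" "pt \<tau> b1 \<noteq> pt \<tau> a2" "pt \<tau> b2 \<noteq> pt \<tau> a1" "pt \<tau> b2 \<noteq> pt \<tau> a2"
        using sep[OF S(1) nz_ab(3)] sep[OF S(1) nz_ab(4)] Fa by (auto simp: pt_eq_iff b2_def)
      ultimately show False by (rule mset_triple_disjoint)
    qed
    have st: "steinberg 3 (- ee (- w)) GA GB GC"
      unfolding steinberg_def using GA GB GC GC0 s0 u0 \<alpha> \<beta>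
      by (auto simp: GAs GBu GC_def fun_eq_iff)
    have GC1: "GC c1 = 0" by (simp add: GC_def GAs GBu \<alpha>_def \<beta>_def)
    have "u c1 * s c2 = k2 * (theta (w + c2 + sa) * theta (w + c1 + sb))"
      by (simp add: s_def u_def k2_def algebra_simps)
    also have "\<dots> = k1 * (theta (w + c1 + sa) * theta (w + c2 + sb))" by (rule w[symmetric])
    also have "\<dots> = s c1 * u c2"
      by (simp add: s_def u_def k1_def algebra_simps)
    finally have GC2: "GC c2 = 0" by (simp add: GC_def GAs GBu \<alpha>_def \<beta>_def)
    obtain GC' where GC': "GC' holomorphic_on UNIV" "GC = (\<lambda>z. (theta (z - c1) * theta (z - c2)) * GC' z)"
      by (rule sect_split_two_zeros[OF GC GC1 GC2 c12(3)])
    obtain FC' where FC': "FC' holomorphic_on UNIV" "FC = (\<lambda>z. (theta (z - c1) * theta (z - c2)) * FC' z)"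
      by (rule sect_split_two_zeros[OF S(3) c12])
    show ?thesis
      by (rule Tform_reduce[OF IH F st _ disj theta_pair_sect theta_pair_sect theta_pair_sect
            theta_pair_nonzero theta_pair_nonzero theta_pair_nonzero FA'(2) FB'(2)[folded b2_def] FC'(2)
            GA_def GB_def GC'(2) FA'(1) FB'(1) FC'(1) _ _ GC'(1)])
         (use \<open>n \<ge> 4\<close> in \<open>auto intro!: holomorphic_intros\<close>)
  qed
qed

text \<open>
  A pencil member through a point where the Wronskian does not vanish has a simple zero there, hence
  two distinct zeros.  Comparing with this fourth member covers members with a single multiple zero.
\<close>
lemma Tform_step':
  assumes IH: "solved_below n" and F: "steinberg n c FA FB FC" and "n \<ge> 4"
    and disj: "\<And>z. FA z = 0 \<Longrightarrow> FB z \<noteq> 0"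
  shows "Tform FA FB FC \<in> H"
proof -
  note S = steinbergD[OF F]
  note hol = sectD(2)[OF S(1)] sectD(2)[OF S(2)] sectD(2)[OF S(3)]
  define W where "W = (\<lambda>z. deriv FA z * FC z - FA z * deriv FC z)"
  obtain a where a: "FA a = 0" using sect_has_zero[OF S(1)] \<open>n \<ge> 4\<close> by auto
  have FCa: "FC a \<noteq> 0" using S(7)[of a] a disj[OF a] by auto
  have W0: "W \<noteq> (\<lambda>_. 0)"
    unfolding W_def by (rule wronskian_nonzero[of FA FC a]) (use hol S(4) a FCa in auto)
  have Wh: "W holomorphic_on UNIV"
    unfolding W_def by (intro holomorphic_intros hol open_UNIV)
  \<comment> \<open>Away from the zeros of \<open>W\<close> the member through \<open>z0\<close> has
    a simple zero there; away from those of \<open>FA\<close>, \<open>FB\<close>, \<open>FC\<close>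
    it differs from all three given members.\<close>
  have "(\<lambda>z. (W z * FA z) * (FB z * FC z)) \<noteq> (\<lambda>_. 0)"
    by (intro entire_mult_nonzero holomorphic_on_mult hol Wh W0 S)
  then obtain z0 where z0: "W z0 \<noteq> 0" "FA z0 \<noteq> 0" "FB z0 \<noteq> 0" "FC z0 \<noteq> 0"
    by (auto simp: fun_eq_iff)
  define l where "l = FA z0 / FC z0"
  have l: "l \<noteq> 0" using z0 by (simp add: l_def)
  have l1: "1 + l \<noteq> 0"
  proof
    assume "1 + l = 0"
    hence "FC z0 + FA z0 = 0" using z0 by (simp add: l_def field_simps)
    moreover have "FB z0 = (FA z0 + FB z0 + FC z0) - (FC z0 + FA z0)" by simp
    ultimately show False using S(7)[of z0] z0(3) by simp
  qed
  define D where "D = (\<lambda>z. FA z - l * FC z)"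
  have D: "D \<in> sect n c" unfolding D_def by (intro sect_diff sect_cmult S)
  have D_z0: "D z0 = 0" using z0 by (simp add: D_def l_def)
  have "D a \<noteq> 0" using a FCa l by (simp add: D_def)
  hence D0: "D \<noteq> (\<lambda>_. 0)" by auto
  have "(D has_field_derivative (deriv FA z0 - l * deriv FC z0)) (at z0)"
    unfolding D_def using hol by (auto intro!: derivative_eq_intros holomorphic_derivI)
  hence "deriv D z0 = deriv FA z0 - l * deriv FC z0" by (rule DERIV_imp_deriv)
  also have "\<dots> = W z0 / FC z0" using z0 by (simp add: W_def l_def field_simps)
  finally have "deriv D z0 \<noteq> 0" using z0 by simp
  hence "zorder D z0 = 1"
    by (intro zorder_zero_eqI' sect_analytic[OF D]) (auto simp: D_z0)
  hence count: "count (dv D) (pt \<tau> z0) = 1" using zorder_eq_count_dv[OF D D0, of z0] by simp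
  obtain z1 where z1: "D z1 = 0" "z1 - z0 \<notin> \<Lambda>"
  proof -
    have "\<exists>x. x \<in># dv D - {#pt \<tau> z0#}"
    proof (rule ccontr)
      assume "\<not> ?thesis"
      hence "dv D - {#pt \<tau> z0#} = {#}" by auto
      hence "size (dv D - {#pt \<tau> z0#}) = 0" by simp
      moreover have "pt \<tau> z0 \<in># dv D" using in_dv_iff[OF D D0] D_z0 by blast
      ultimately have "size (dv D) = 1"
        by (metis One_nat_def size_Suc_Diff1 size_eq_0_iff_empty)
      thus False using size_dv[OF D D0] \<open>n \<ge> 4\<close> by simp
    qed
    then obtain x where x: "x \<in># dv D - {#pt \<tau> z0#}" by blast
    hence "x \<in># dv D" by (rule in_diffD)
    then obtain z1 where z1: "x = pt \<tau> z1" "D z1 = 0" by (rule in_dvE[OF D D0])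
    have "x \<noteq> pt \<tau> z0"
    proof
      assume "x = pt \<tau> z0"
      hence "count (dv D - {#pt \<tau> z0#}) x = 0" using count by simp
      thus False using x unfolding count_eq_zero_iff by blast
    qed
    with z1 that show ?thesis by (simp add: pt_eq_iff)
  qed
  have disj': "FA z = 0 \<Longrightarrow> FC z \<noteq> 0" "FB z = 0 \<Longrightarrow> FC z \<noteq> 0" for z
    using S(7)[of z] disj[of z] by auto
  \<comment> \<open>Rescaling makes the three terms sum to zero and leaves their divisors unchanged.
    \<open>D\<close> is the third term, with the distinct zeros \<open>z0\<close> and
    \<open>z1\<close>.\<close>
  have step: "Tform X Y D \<in> H"
    if XY: "X \<in> sect n c" "Y \<in> sect n c" "X \<noteq> (\<lambda>_. 0)" "Y \<noteq> (\<lambda>_. 0)" "\<And>z. X z = 0 \<Longrightarrow> Y z \<noteq> 0"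
      and nz: "x \<noteq> 0" "y \<noteq> 0" "k \<noteq> 0" and sum: "\<And>z. x * X z + y * Y z + k * D z = 0"
    for X Y x y k
  proof -
    have "steinberg n c (\<lambda>z. x * X z) (\<lambda>z. y * Y z) (\<lambda>z. k * D z)"
      unfolding steinberg_def using XY nz D D0 sum
      by (auto intro!: sect_cmult simp: fun_eq_iff)
    hence "Tform (\<lambda>z. x * X z) (\<lambda>z. y * Y z) (\<lambda>z. k * D z) \<in> H"
      by (rule Tform_step[OF IH _ \<open>n \<ge> 4\<close> _ _ _ z1(2)]) (use XY(5) nz z1 D_z0 in auto)
    thus ?thesis
      by (simp add: Tform_def dv_cmult[OF XY(1,3)] dv_cmult[OF XY(2,4)] dv_cmult[OF D D0] nz)
  qed
  have FBeq: "FB z = - FA z - FC z" for z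
    using S(7)[of z] by (simp add: eq_neg_iff_add_eq_0 algebra_simps)
  have AB: "Tform FA FB D \<in> H"
    by (rule step[OF S(1,2,4,5) disj, of "l + 1" l "-1"])
       (use l l1 in \<open>auto simp: FBeq D_def algebra_simps\<close>)
  have AC: "Tform FA FC D \<in> H"
    by (rule step[OF S(1,3,4,6) disj'(1), of "1" "-l" "-1"])
       (use l in \<open>auto simp: D_def algebra_simps\<close>)
  have BC: "Tform FB FC D \<in> H"
    by (rule step[OF S(2,3,5,6) disj'(2), of "1" "1 + l" "1"])
       (use l1 in \<open>auto simp: FBeq D_def algebra_simps\<close>)
  \<comment> \<open>With divisors taken relative to \<open>D\<close>, the relation sought is
    \<open>bloch_form (x - w) (y - w)\<close>, which expands into the three relations involving
    \<open>D\<close> and terms that vanish for an alternating form.\<close>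
  define x y w where "x = mfrag (dv FA) - mfrag (dv D)" and "y = mfrag (dv FB) - mfrag (dv D)"
    and "w = mfrag (dv FC) - mfrag (dv D)"
  have d0: "y \<in> div0" "w \<in> div0"
    unfolding y_def w_def by (rule sect_div0[OF S(2,5) D D0], rule sect_div0[OF S(3,6) D D0])
  have 1: "bloch_form x y \<in> H" "bloch_form x w \<in> H" "bloch_form y w \<in> H"
    using AB AC BC by (simp_all add: Tform_def x_def y_def w_def)
  have "bloch_form x y - bloch_form x w + bloch_form y w - (bloch_form w y + bloch_form y w)
          + bloch_form w w \<in> H"
    by (rule H_add[OF H_diff[OF H_add[OF H_diff[OF 1(1,2)] 1(3)] div0_antisym[OF d0(2,1)]]
          div0_alternating[OF d0(2)]])
  also have "bloch_form x y - bloch_form x w + bloch_form y w - (bloch_form w y + bloch_form y w)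
          + bloch_form w w = bloch_form (x - w) (y - w)"
    by (simp add: bloch_form_simps)
  finally show ?thesis by (simp add: Tform_def x_def y_def w_def)
qed

text \<open>A zero common to two terms is one of the third as well, and dividing by it lowers the
  degree. This is why disjointness of the zeros may be assumed in degree 3 and in the reduction
  steps.\<close>

theorem Tform_in_H: "steinberg n c F G K \<Longrightarrow> Tform F G K \<in> H"
proof -
  have "steinberg (int m) c F G K \<Longrightarrow> Tform F G K \<in> H" for m c F G K
  proof (induction m arbitrary: c F G K rule: less_induct)
    case (less m)
    note S = steinbergD[OF less.prems]
    have IH: "solved_below (int m)"
      unfolding solved_below_def
    proof (intro allI impI)
      fix k c F G K assume k: "k < int m" "steinberg k c F G K"
      have "k \<ge> 0" using size_dv[OF steinbergD(1,4)[OF k(2)]] by simp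
      then obtain j where "k = int j" by (metis nonneg_int_cases)
      with k less.IH show "Tform F G K \<in> H" by auto
    qed
    show ?case
    proof (cases "\<exists>a. F a = 0 \<and> G a = 0")
      case True
      then obtain a where a: "F a = 0" "G a = 0" by blast
      hence Ka: "K a = 0" using S(7)[of a] by simp
      obtain F' where F': "F' \<in> sect (int m - 1) (c / - ee a)" "F = (\<lambda>z. theta (z - a) * F' z)"
        by (rule sect_divide_theta[OF S(1) a(1)])
      obtain G' where G': "G' \<in> sect (int m - 1) (c / - ee a)" "G = (\<lambda>z. theta (z - a) * G' z)"
        by (rule sect_divide_theta[OF S(2) a(2)])
      obtain K' where K': "K' \<in> sect (int m - 1) (c / - ee a)" "K = (\<lambda>z. theta (z - a) * K' z)"
        by (rule sect_divide_theta[OF S(3) Ka])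
      have "(\<lambda>z. F' z + G' z + K' z) = (\<lambda>_. 0)"
      proof (rule entire_mult_cancel[of "\<lambda>z. theta (z - a)"])
        show "theta (z - a) * (F' z + G' z + K' z) = theta (z - a) * 0" for z
          using S(7)[of z] by (simp add: F'(2) G'(2) K'(2) algebra_simps)
      qed (use theta_nonzero sectD(2)[OF F'(1)] sectD(2)[OF G'(1)] sectD(2)[OF K'(1)]
            in \<open>auto intro!: holomorphic_intros\<close>)
      hence st: "steinberg (int m - 1) (c / - ee a) F' G' K'"
        unfolding steinberg_def using F' G' K' S(4-6) by (auto dest: fun_cong)
      have "Tform F' G' K' \<in> H" by (rule solved_belowD[OF IH _ st]) simp
      thus ?thesis
        using Tform_cancel[OF st theta_sect theta_nonzero, of a] by (simp add: F'(2) G'(2) K'(2))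
    next
      case False
      consider "m \<le> 2" | "m = 3" | "m \<ge> 4" by linarith
      thus ?thesis
      proof cases
        case 1 thus ?thesis using Tform_degree_le_2[OF less.prems] by simp
      next
        case 2 thus ?thesis using H_cubic[of c F G K] less.prems False by auto
      next
        case 3 thus ?thesis using Tform_step'[OF IH less.prems] False by auto
      qed
    qed
  qed
  moreover assume st: "steinberg n c F G K"
  moreover have "n \<ge> 0" using size_dv[OF steinbergD(1,4)[OF st]] by simp
  ultimately show ?thesis by (metis nonneg_int_cases)
qed

end

section \<open>Elliptic functions as quotients of sections\<close>

text \<open>Local analytic expressions, each valid only off its centre, are glued by removing
  singularities. The second conjunct lets the value at a repaired point be read off from any such
  expression.\<close>

lemma glue_entire:
  fixes \<phi> :: "complex \<Rightarrow> complex"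
  assumes loc: "\<And>z. \<exists>k. k analytic_on {z} \<and> eventually (\<lambda>w. \<phi> w = k w) (at z)"
  shows "\<exists>G. G holomorphic_on UNIV \<and> (\<forall>z k. k analytic_on {z} \<longrightarrow>
           eventually (\<lambda>w. \<phi> w = k w) (at z) \<longrightarrow> G z = k z)"
proof (intro exI[of _ "remove_sings \<phi>"] conjI allI impI)
  have G: "remove_sings \<phi> z = k z" if "k analytic_on {z}" "eventually (\<lambda>w. \<phi> w = k w) (at z)" for z k
    using remove_sings_cong[OF that(2) refl] remove_sings_at_analytic[OF that(1)] by simp
  have "remove_sings \<phi> analytic_on {z}" for z
  proof -
    obtain k where k: "k analytic_on {z}" "eventually (\<lambda>w. \<phi> w = k w) (at z)" using loc by blast
    obtain T where "open T" "z \<in> T" "k holomorphic_on T" using k(1) unfolding analytic_at by blast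
    hence "eventually (\<lambda>w. k analytic_on {w}) (nhds z)"
      unfolding eventually_nhds by (intro exI[of _ T]) (auto simp: analytic_at)
    moreover have "eventually (\<lambda>w. w \<noteq> z \<longrightarrow> eventually (\<lambda>v. \<phi> v = k v) (at w)) (nhds z)"
    proof -
      obtain S where S: "open S" "z \<in> S" "\<And>w. w \<in> S \<Longrightarrow> w \<noteq> z \<Longrightarrow> \<phi> w = k w"
        using k(2) unfolding eventually_at_topological by blast
      have "eventually (\<lambda>v. \<phi> v = k v) (at w)" if "w \<in> S" "w \<noteq> z" for w
        unfolding eventually_at_topological
        by (rule exI[of _ "S - {z}"]) (use S that in auto)
      thus ?thesis using S(1,2) unfolding eventually_nhds by blast
    qed
    ultimately have "eventually (\<lambda>w. remove_sings \<phi> w = k w) (nhds z)"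
      by eventually_elim (use G k in metis)
    thus ?thesis using k(1) by (simp add: analytic_at_cong)
  qed
  hence "remove_sings \<phi> analytic_on UNIV" using analytic_on_analytic_at by blast
  thus "remove_sings \<phi> holomorphic_on UNIV" by (rule analytic_imp_holomorphic)
  fix z k assume "k analytic_on {z}" "eventually (\<lambda>w. \<phi> w = k w) (at z)"
  thus "remove_sings \<phi> z = k z" by (rule G)
qed

lemma entire_eqI_off_discrete:
  fixes F G :: "complex \<Rightarrow> complex"
  assumes "F holomorphic_on UNIV" "G holomorphic_on UNIV" "\<And>z. \<not> z islimpt Z"
    "\<And>z. z \<notin> Z \<Longrightarrow> F z = G z"
  shows "F = G"
proof
  fix z
  have "eventually (\<lambda>w. w \<notin> Z) (at z)" using assms(3)[of z] by (simp add: islimpt_iff_eventually)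
  hence ev: "eventually (\<lambda>w. F w = G w) (at z)" by eventually_elim (use assms(4) in auto)
  have lim: "(F \<longlongrightarrow> F z) (at z)" "(G \<longlongrightarrow> G z) (at z)"
    using assms(1,2)
    by (auto simp: isCont_def[symmetric] intro!: analytic_at_imp_isCont simp: analytic_on_open
        intro: analytic_on_subset[of _ UNIV])
  have "(G \<longlongrightarrow> F z) (at z)" by (rule Lim_transform_eventually[OF lim(1) ev])
  thus "F z = G z" using lim(2) by (rule tendsto_unique[rotated]) simp
qed

context torus
begin

text \<open>Finiteness comes from compactness of \<open>fund_domain\<close>. The choice
  \<open>r\<close>, constant on lattice classes, restores the uniqueness that fails on its
  boundary.\<close>

lemma finite_representatives:
  assumes "\<And>z. \<not> z islimpt Z" "\<And>z w. w \<in> \<Lambda> \<Longrightarrow> z \<in> Z \<Longrightarrow> z + w \<in> Z"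
  obtains P where "finite P" "P \<subseteq> Z" "\<And>z. z \<in> Z \<Longrightarrow> \<exists>!p. p \<in> P \<and> z - p \<in> \<Lambda>"
proof
  define r where "r = (\<lambda>z. SOME z'. z - z' \<in> \<Lambda>)"
  have r: "z - r z \<in> \<Lambda>" for z unfolding r_def by (rule someI[of _ z]) simp
  have r_eq: "r z = r z'" if "z - z' \<in> \<Lambda>" for z z'
  proof -
    have "z - x \<in> \<Lambda> \<longleftrightarrow> z' - x \<in> \<Lambda>" for x
      using lattice_add[OF that, of "z' - x"] lattice_diff[of "z - x" "z - z'"] that by auto
    thus ?thesis by (simp add: r_def)
  qed
  show "finite (r ` (Z \<inter> fund_domain))"
  proof (rule finite_imageI, rule ccontr)
    assume "infinite (Z \<inter> fund_domain)"
    then obtain x where "x islimpt (Z \<inter> fund_domain)"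
      using compact_fund_domain unfolding compact_eq_Bolzano_Weierstrass by blast
    hence "x islimpt Z" by (rule islimpt_subset) auto
    with assms(1) show False by blast
  qed
  show "r ` (Z \<inter> fund_domain) \<subseteq> Z"
  proof safe
    fix z assume "z \<in> Z"
    have "z + (r z - z) \<in> Z" by (rule assms(2)[OF _ \<open>z \<in> Z\<close>]) (use r lattice_minus_commute in blast)
    thus "r z \<in> Z" by simp
  qed
  show "\<exists>!p. p \<in> r ` (Z \<inter> fund_domain) \<and> z - p \<in> \<Lambda>" if "z \<in> Z" for z
  proof (rule ex_ex1I)
    obtain w where w: "w \<in> \<Lambda>" "z + w \<in> fund_domain" by (rule lattice_translate_fund_domain)
    have "r (z + w) = r z" by (rule r_eq) (use w in simp)
    thus "\<exists>p. p \<in> r ` (Z \<inter> fund_domain) \<and> z - p \<in> \<Lambda>"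
      using assms(2)[OF w(1) that] w(2) r[of z] by (intro exI[of _ "r z"]) (auto intro!: image_eqI[of _ _ "z + w"])
  next
    fix p q assume "p \<in> r ` (Z \<inter> fund_domain) \<and> z - p \<in> \<Lambda>" "q \<in> r ` (Z \<inter> fund_domain) \<and> z - q \<in> \<Lambda>"
    then obtain x y where xy: "p = r x" "q = r y" "z - r x \<in> \<Lambda>" "z - r y \<in> \<Lambda>" by auto
    have "r x - r y \<in> \<Lambda>" using lattice_diff[OF xy(4,3)] by simp
    hence "(x - r x) - (y - r y) + (r x - r y) \<in> \<Lambda>"
      using lattice_add[OF lattice_diff[OF r[of x] r[of y]]] by blast
    also have "(x - r x) - (y - r y) + (r x - r y) = x - y" by simp
    finally have "r x = r y" by (rule r_eq)
    thus "p = q" using xy by simp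
  qed
qed

text \<open>Stated for families because it is applied both to one elliptic function and to all
  coordinate ratios of the embedding. One exponent per point serves the whole family and is exact,
  so some member of the cleared family is nonzero there.\<close>

lemma clear_poles:
  fixes g :: "'i \<Rightarrow> complex \<Rightarrow> complex"
  assumes per: "\<And>i z w. w \<in> \<Lambda> \<Longrightarrow> g i (z + w) = g i z"
    and disc: "\<And>z. \<not> z islimpt Z" and Zper: "\<And>z w. w \<in> \<Lambda> \<Longrightarrow> z \<in> Z \<Longrightarrow> z + w \<in> Z"
    and an: "\<And>i z. z \<notin> Z \<Longrightarrow> g i analytic_on {z}"
    and loc: "\<And>p. p \<in> Z \<Longrightarrow> \<exists>m h. (\<forall>i. h i analytic_on {p} \<and>
                 eventually (\<lambda>z. (z - p) ^ m * g i z = h i z) (at p)) \<and> (\<exists>i. h i p \<noteq> 0)"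
  shows "\<exists>\<Theta> n c G. \<Theta> \<in> sect n c \<and> \<Theta> \<noteq> (\<lambda>_. 0) \<and> (\<forall>z. z \<notin> Z \<longrightarrow> \<Theta> z \<noteq> 0) \<and>
           (\<forall>i. G i \<in> sect n c) \<and> (\<forall>i z. z \<notin> Z \<longrightarrow> G i z = \<Theta> z * g i z) \<and>
           (\<forall>p. p \<in> Z \<longrightarrow> (\<exists>i. G i p \<noteq> 0))"
proof -
  obtain P where P: "finite P" "P \<subseteq> Z" "\<And>z. z \<in> Z \<Longrightarrow> \<exists>!p. p \<in> P \<and> z - p \<in> \<Lambda>"
    using finite_representatives[OF disc Zper] by blast
  obtain m h where mh: "\<And>p i. p \<in> Z \<Longrightarrow> h p i analytic_on {p}"
      "\<And>p i. p \<in> Z \<Longrightarrow> eventually (\<lambda>z. (z - p) ^ m p * g i z = h p i z) (at p)"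
      "\<And>p. p \<in> Z \<Longrightarrow> \<exists>i. h p i p \<noteq> 0"
  proof -
    define Q where "Q p m h \<longleftrightarrow> (\<forall>i. h i analytic_on {p} \<and>
       eventually (\<lambda>z. (z - p) ^ m * g i z = h i z) (at p)) \<and> (\<exists>i. h i p \<noteq> 0)" for p m h
    have "\<forall>p\<in>Z. \<exists>m h. Q p m h" using loc unfolding Q_def by (intro ballI)
    from bchoice[OF this] obtain m where "\<forall>p\<in>Z. \<exists>h. Q p (m p) h" by (elim exE)
    from bchoice[OF this] obtain h where Q: "\<forall>p\<in>Z. Q p (m p) (h p)" by (elim exE)
    show ?thesis by (rule that[of h m]) (use Q in \<open>auto simp: Q_def\<close>)
  qed
  define A where "A = (\<Sum>p\<in>P. replicate_mset (m p) p)"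
  define \<Theta> where "\<Theta> = tprod A"
  have rep: "theta_rep \<Theta> A"
    unfolding theta_rep_def \<Theta>_def by (rule exI[of _ 1], rule exI[of _ 0]) auto
  obtain n c where \<Theta>: "\<Theta> \<in> sect n c" using tprod_sect[of A] unfolding \<Theta>_def by blast
  have \<Theta>0: "\<Theta> \<noteq> (\<lambda>_. 0)" by (rule theta_rep_nonzero[OF rep])
  have count_A: "count A p = (if p \<in> P then m p else 0)" for p
    unfolding A_def using P(1) by (simp add: count_sum sum.delta')
  have set_A: "set_mset A \<subseteq> P" by (auto simp: count_A simp flip: count_greater_zero_iff split: if_splits)
  have \<Theta>_nz: "\<Theta> z \<noteq> 0" if "z \<notin> Z" for z
  proof
    assume "\<Theta> z = 0"
    hence "pt \<tau> z \<in># dv \<Theta>" using in_dv_iff[OF \<Theta> \<Theta>0] by simp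
    then obtain p where p: "p \<in># A" "pt \<tau> z = pt \<tau> p" using dv_eq[OF rep] by auto
    hence "p \<in> Z" "z - p \<in> \<Lambda>" using set_A P(2) by (auto simp: pt_eq_iff)
    hence "p + (z - p) \<in> Z" by (intro Zper)
    with that show False by simp
  qed
  \<comment> \<open>No other element of \<open>P\<close> is equivalent to \<open>z\<close>, so
    \<open>p\<close> alone contributes to the order.\<close>
  have ord: "zorder \<Theta> z = int (m p)" if z: "z \<in> Z" "p \<in> P" "z - p \<in> \<Lambda>" for z p
  proof -
    define S where "S = pt \<tau> -` {pt \<tau> z} \<inter> set_mset A"
    have "S \<subseteq> {p}"
    proof
      fix q assume "q \<in> S"
      hence "q \<in> P" "pt \<tau> z = pt \<tau> q" using set_A by (auto simp: S_def)
      thus "q \<in> {p}" using P(3)[OF z(1)] z(2,3) pt_eq_iff by blast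
    qed
    moreover have "count A q = 0" if "q \<in> {p} - S" for q
      using that z(3) pt_eq_iff[of p z] lattice_minus_commute[of z p] by (auto simp: S_def not_in_iff)
    ultimately have "sum (count A) S = sum (count A) {p}"
      by (intro sum.mono_neutral_left) auto
    hence "count (image_mset (pt \<tau>) A) (pt \<tau> z) = m p"
      using z(2) by (simp add: count_image_mset S_def count_A)
    thus ?thesis using zorder_theta_rep[OF rep] by simp
  qed
  have local: "\<exists>k. k analytic_on {z} \<and> eventually (\<lambda>w. \<Theta> w * g i w = k w) (at z) \<and>
                 (k z \<noteq> 0 \<longleftrightarrow> h p i p \<noteq> 0)"
    if z: "z \<in> Z" "p \<in> P" "z - p \<in> \<Lambda>" for z p i
  proof -
    have p: "p \<in> Z" using z P by blast
    obtain r where r: "r > 0" "zor_poly \<Theta> z holomorphic_on cball z r"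
       "\<And>w. w \<in> cball z r \<Longrightarrow> \<Theta> w = zor_poly \<Theta> z w * (w - z) ^ m p \<and> zor_poly \<Theta> z w \<noteq> 0"
    proof -
      have "\<exists>w\<in>UNIV. \<Theta> w \<noteq> 0" using \<Theta>0 by auto
      from zorder_exist_zero[OF sectD(2)[OF \<Theta>] open_UNIV connected_UNIV UNIV_I this, of z]
      show ?thesis using ord[OF z] that by auto
    qed
    define u where "u = zor_poly \<Theta> z"
    have u: "u analytic_on {z}" "u z \<noteq> 0"
      using r by (auto simp: u_def analytic_at intro!: exI[of _ "ball z r"] holomorphic_on_subset[OF r(2)])
    \<comment> \<open>The local data are fixed at the representative \<open>p\<close> and carried to
      \<open>z\<close> by this period.\<close>
    define v where "v = z - p"
    have sh: "filtermap (\<lambda>w. w - v) (at z) = at p"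
      using filtermap_at_shift[of v z] by (simp add: v_def)
    have "eventually (\<lambda>w. (w - p) ^ m p * g i w = h p i w) (filtermap (\<lambda>w. w - v) (at z))"
      unfolding sh by (rule mh(2)[OF p])
    hence "eventually (\<lambda>w. (w - v - p) ^ m p * g i (w - v) = h p i (w - v)) (at z)"
      by (simp add: eventually_filtermap)
    moreover have "g i (w - v) = g i w" for w
    proof -
      have "- v \<in> \<Lambda>" unfolding v_def by (rule lattice_uminus[OF z(3)])
      from per[OF this, of i w] show ?thesis by (simp only: add_uminus_conv_diff)
    qed
    ultimately have ev: "eventually (\<lambda>w. (w - z) ^ m p * g i w = h p i (w - v)) (at z)"
      by (simp add: v_def)
    moreover have "eventually (\<lambda>w. w \<in> ball z r) (at z)"
      using r(1) by (intro eventually_at_in_open') auto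
    ultimately have "eventually (\<lambda>w. \<Theta> w * g i w = u w * h p i (w - v)) (at z)"
    proof eventually_elim
      case (elim w)
      have "\<Theta> w = u w * (w - z) ^ m p" using r(3)[of w] elim(2) by (simp add: u_def)
      thus ?case using elim(1) by (simp add: mult_ac)
    qed
    moreover have "(\<lambda>w. h p i (w - v)) analytic_on {z}"
    proof -
      have "(\<lambda>w. w - v) analytic_on {z}" by (intro analytic_intros)
      from analytic_on_compose_gen[OF this, of "h p i" "{p}"] mh(1)[OF p, of i] show ?thesis
        by (auto simp: o_def v_def)
    qed
    hence "(\<lambda>w. u w * h p i (w - v)) analytic_on {z}" by (intro analytic_intros u)
    moreover have "u z * h p i (z - v) \<noteq> 0 \<longleftrightarrow> h p i p \<noteq> 0" using u by (simp add: v_def)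
    ultimately show ?thesis by (intro exI[of _ "\<lambda>w. u w * h p i (w - v)"] conjI)
  qed
  have off: "(\<lambda>w. \<Theta> w * g i w) analytic_on {z}" if "z \<notin> Z" for i z
    by (intro analytic_intros sect_analytic[OF \<Theta>] an that)
  have "\<exists>G. G holomorphic_on UNIV \<and> (\<forall>z k. k analytic_on {z} \<longrightarrow>
          eventually (\<lambda>w. \<Theta> w * g i w = k w) (at z) \<longrightarrow> G z = k z)" for i
  proof -
    have ex: "\<exists>k. k analytic_on {z} \<and> eventually (\<lambda>w. \<Theta> w * g i w = k w) (at z)" for z
    proof (cases "z \<in> Z")
      case True
      then obtain p where "p \<in> P" "z - p \<in> \<Lambda>" using P(3) by blast
      with local[OF True, of p i] show ?thesis by blast
    next
      case False
      with off show ?thesis by (intro exI[of _ "\<lambda>w. \<Theta> w * g i w"]) auto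
    qed
    show ?thesis by (rule glue_entire[OF ex])
  qed
  hence "\<forall>i. \<exists>G. G holomorphic_on UNIV \<and> (\<forall>z k. k analytic_on {z} \<longrightarrow>
          eventually (\<lambda>w. \<Theta> w * g i w = k w) (at z) \<longrightarrow> G z = k z)" ..
  from choice[OF this] obtain G where G': "\<forall>i. G i holomorphic_on UNIV \<and> (\<forall>z k. k analytic_on {z} \<longrightarrow>
          eventually (\<lambda>w. \<Theta> w * g i w = k w) (at z) \<longrightarrow> G i z = k z)" by (elim exE)
  note G = G'[rule_format, THEN conjunct1] G'[rule_format, THEN conjunct2, rule_format]
  have G_off: "G i z = \<Theta> z * g i z" if "z \<notin> Z" for i z
    by (rule G(2)[OF off[OF that]]) simp
  have Z_minus: "z + w \<notin> Z" if "w \<in> \<Lambda>" "z \<notin> Z" for z w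
    using Zper[of "- w" "z + w"] lattice_uminus that by auto
  have shift: "(\<lambda>z. G i (z + w)) holomorphic_on UNIV" for i w
  proof -
    have "(\<lambda>z. z + w) holomorphic_on UNIV" by (intro holomorphic_intros)
    from holomorphic_on_compose_gen[OF this G(1)] show ?thesis by (simp add: o_def)
  qed
  have "G i \<in> sect n c" for i
  proof -
    have "(\<lambda>z. G i (z + 1)) = G i"
      by (rule entire_eqI_off_discrete[OF shift G(1) disc])
         (simp add: G_off Z_minus per sectD[OF \<Theta>])
    moreover have "(\<lambda>z. G i (z + \<tau>)) = (\<lambda>z. c * ee (- (of_int n * z)) * G i z)"
      by (rule entire_eqI_off_discrete[OF shift _ disc])
         (auto simp: G_off Z_minus per sectD[OF \<Theta>] intro!: holomorphic_intros G(1))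
    ultimately show ?thesis
      unfolding sect_def using sectD(1)[OF \<Theta>] G(1) by (auto dest: fun_cong)
  qed
  moreover have "\<exists>i. G i z \<noteq> 0" if zZ: "z \<in> Z" for z
  proof -
    obtain p where p: "p \<in> P" "z - p \<in> \<Lambda>" using P(3)[OF zZ] by blast
    obtain i where i: "h p i p \<noteq> 0" using mh(3)[of p] p(1) P(2) by blast
    obtain k where "k analytic_on {z}" "eventually (\<lambda>w. \<Theta> w * g i w = k w) (at z)" "k z \<noteq> 0"
      using local[OF zZ p, of i] i by blast
    thus ?thesis using G(2) by (intro exI[of _ i]) simp
  qed
  ultimately show ?thesis
    using \<Theta> \<Theta>_nz G_off \<Theta>0
    by (intro exI[of _ \<Theta>] exI[of _ n] exI[of _ c] exI[of _ G] conjI allI impI)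
qed

text \<open>A family with one member, indexed by \<open>unit\<close>. The denominator is a theta
  product whose zeros lie only at poles of \<open>f\<close>, so it is nonzero wherever
  \<open>f\<close> has no pole.\<close>

lemma function_field_quotient:
  assumes f: "f \<in> function_field \<tau>"
  obtains n c F C where "F \<in> sect n c" "C \<in> sect n c" "C \<noteq> (\<lambda>_. 0)"
    "\<And>z. \<not> is_pole f z \<Longrightarrow> C z \<noteq> 0 \<and> f z = F z / C z"
proof -
  have nice: "f nicely_meromorphic_on UNIV" and per: "\<And>z w. w \<in> \<Lambda> \<Longrightarrow> f (z + w) = f z"
    using f by (auto simp: function_field_def)
  have mero: "f meromorphic_on {z}" for z
  proof -
    have "f meromorphic_on UNIV" using nice by (simp add: nicely_meromorphic_on_def)
    thus ?thesis by (rule meromorphic_on_subset) simp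
  qed
  define Z where "Z = {z. is_pole f z}"
  have disc: "\<not> z islimpt Z" for z
    unfolding Z_def by (rule not_islimpt_poles[OF meromorphic_on_isolated_singularity[OF mero]])
  have Zper: "z + w \<in> Z" if "w \<in> \<Lambda>" "z \<in> Z" for z w
  proof -
    have *: "at (z + w) = filtermap (\<lambda>x. x + w) (at z)"
      using filtermap_at_shift[of "- w" z] by simp
    have "filterlim (\<lambda>x. f (x + w)) at_infinity (at z)"
      using that per by (simp add: Z_def is_pole_def)
    thus ?thesis unfolding Z_def is_pole_def mem_Collect_eq * filterlim_filtermap .
  qed
  have an: "f analytic_on {z}" if "z \<notin> Z" for z
    using nicely_meromorphic_on_imp_analytic_at[OF nice] that by (simp add: Z_def)
  have loc: "\<exists>m h. (\<forall>i::unit. h i analytic_on {p} \<and>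
               eventually (\<lambda>z. (z - p) ^ m * f z = h i z) (at p)) \<and> (\<exists>i. h i p \<noteq> 0)"
    if "p \<in> Z" for p
  proof -
    have iso: "isolated_singularity_at f p"
      by (rule meromorphic_on_isolated_singularity[OF mero])
    obtain S where S: "open S" "p \<in> S" "f holomorphic_on (S - {p})"
    proof -
      obtain r where "r > 0" "f analytic_on ball p r - {p}"
        using iso by (auto simp: isolated_singularity_at_def)
      thus ?thesis using analytic_imp_holomorphic by (intro that[of "ball p r"]) auto
    qed
    obtain r where r: "r > 0" "zor_poly f p holomorphic_on cball p r"
      "\<forall>w\<in>cball p r - {p}. f w = zor_poly f p w / (w - p) ^ nat (- zorder f p) \<and> zor_poly f p w \<noteq> 0"
      "zor_poly f p p \<noteq> 0"
      using zorder_exist_pole[OF S(3,1,2)] \<open>p \<in> Z\<close> unfolding Z_def by blast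
    have "zor_poly f p analytic_on {p}"
      using r(1) by (auto simp: analytic_at intro!: exI[of _ "ball p r"] holomorphic_on_subset[OF r(2)])
    moreover have "eventually (\<lambda>w. w \<in> ball p r - {p}) (at p)"
      using r(1) by (intro eventually_at_in_open) auto
    hence "eventually (\<lambda>z. (z - p) ^ nat (- zorder f p) * f z = zor_poly f p z) (at p)"
      by eventually_elim (use r(3) in auto)
    ultimately show ?thesis using r(4) by (intro exI[of _ "nat (- zorder f p)"] exI[of _ "\<lambda>_. zor_poly f p"]) auto
  qed
  obtain \<Theta> n c and G :: "unit \<Rightarrow> complex \<Rightarrow> complex"
    where G: "\<Theta> \<in> sect n c" "\<Theta> \<noteq> (\<lambda>_. 0)" "\<forall>z. z \<notin> Z \<longrightarrow> \<Theta> z \<noteq> 0"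
      "\<forall>i. G i \<in> sect n c" "\<forall>i z. z \<notin> Z \<longrightarrow> G i z = \<Theta> z * f z"
  proof -
    have "\<exists>\<Theta> n c G. \<Theta> \<in> sect n c \<and> \<Theta> \<noteq> (\<lambda>_. 0) \<and> (\<forall>z. z \<notin> Z \<longrightarrow> \<Theta> z \<noteq> 0) \<and>
           (\<forall>i::unit. G i \<in> sect n c) \<and> (\<forall>i z. z \<notin> Z \<longrightarrow> G i z = \<Theta> z * f z) \<and>
           (\<forall>p. p \<in> Z \<longrightarrow> (\<exists>i. G i p \<noteq> 0))"
      by (rule clear_poles[of "\<lambda>_. f" Z]) (fact per disc Zper an loc)+
    thus ?thesis using that by blast
  qed
  show ?thesis
  proof (rule that[OF G(4)[rule_format, of "()"] G(1,2)])
    fix z assume "\<not> is_pole f z"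
    hence "z \<notin> Z" by (simp add: Z_def)
    thus "\<Theta> z \<noteq> 0 \<and> f z = G () z / \<Theta> z" using G(3,5) by simp
  qed
qed

lemma lookup_mfrag: "Poly_Mapping.lookup (mfrag M) x = int (count M x)"
  by (induction M) (auto simp: lookup_add lookup_frag_of)

text \<open>Orders depend on punctured neighbourhoods only, so agreement there is enough. This
  covers \<open>1 - f\<close> and \<open>form_ratio\<close>, whose values at poles are
  conventional.\<close>

lemma divisor_quotient:
  assumes F: "F \<in> sect n c" "F \<noteq> (\<lambda>_. 0)" and C: "C \<in> sect m d" "C \<noteq> (\<lambda>_. 0)"
    and \<phi>: "\<And>z. eventually (\<lambda>w. \<phi> w = F w / C w) (at z)"
  shows "divisor \<tau> \<phi> = mfrag (dv F) - mfrag (dv C)"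
proof -
  have ord: "ord_at \<phi> x = int (count (dv F) x) - int (count (dv C) x)"
    if x_in: "x \<in> carrier (elliptic_curve \<tau>)" for x
  proof -
    obtain z0 where z0: "x = pt \<tau> z0" using x_in unfolding carrier_elliptic_curve by blast
    define z where "z = (SOME z. z \<in> x)"
    have "z - z0 \<in> \<Lambda>" unfolding z_def z0 by (rule some_representative)
    hence x: "x = pt \<tau> z" by (simp add: z0 pt_eq_iff lattice_minus_commute)
    have "zorder \<phi> z = zorder (\<lambda>w. F w / C w) z" by (rule zorder_cong[OF \<phi> refl])
    also have "\<dots> = zorder F z - zorder C z"
      by (intro zorder_divide analytic_on_imp_meromorphic_on sect_analytic[OF F(1)] sect_analytic[OF C(1)]
            eventually_frequently entire_eventually_nonzero sectD(2)[OF F(1)] sectD(2)[OF C(1)] F C) auto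
    also have "\<dots> = int (count (dv F) x) - int (count (dv C) x)"
      by (simp add: x zorder_eq_count_dv[OF F] zorder_eq_count_dv[OF C])
    finally show ?thesis by (simp add: ord_at_def z_def)
  qed
  define A where "A = {x \<in> carrier (elliptic_curve \<tau>). ord_at \<phi> x \<noteq> 0}"
  have "A \<subseteq> set_mset (dv F) \<union> set_mset (dv C)"
  proof
    fix x assume "x \<in> A"
    show "x \<in> set_mset (dv F) \<union> set_mset (dv C)"
    proof (rule ccontr)
      assume "\<not> ?thesis"
      hence "x \<notin># dv F" "x \<notin># dv C" by auto
      hence 0: "count (dv F) x = 0" "count (dv C) x = 0" by (simp_all only: not_in_iff)
      have "x \<in> carrier (elliptic_curve \<tau>)" "ord_at \<phi> x \<noteq> 0" using \<open>x \<in> A\<close> by (auto simp: A_def)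
      with ord[of x] show False unfolding 0 by simp
    qed
  qed
  hence fin: "finite A" by (rule finite_subset) auto
  show ?thesis
  proof (rule poly_mapping_eqI)
    fix x
    have "Poly_Mapping.lookup (divisor \<tau> \<phi>) x = (\<Sum>y\<in>A. ord_at \<phi> y * (if x = y then 1 else 0))"
      unfolding divisor_def A_def[symmetric] lookup_sum by (simp add: lookup_frag_of)
    also have "\<dots> = (if x \<in> A then ord_at \<phi> x else 0)"
      using fin by (simp add: if_distrib[of "(*) _"] sum.delta' sum.delta cong: if_cong)
    also have "\<dots> = int (count (dv F) x) - int (count (dv C) x)"
    proof (cases "x \<in> carrier (elliptic_curve \<tau>)")
      case True thus ?thesis by (auto simp: A_def ord)
    next
      case False
      hence "x \<notin># dv F" "x \<notin># dv C"
        by (auto elim!: in_dvE[OF F] in_dvE[OF C] simp: carrier_elliptic_curve)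
      thus ?thesis using False by (simp add: A_def not_in_iff)
    qed
    finally show "Poly_Mapping.lookup (divisor \<tau> \<phi>) x = Poly_Mapping.lookup (mfrag (dv F) - mfrag (dv C)) x"
      by (simp add: lookup_minus lookup_mfrag)
  qed
qed

lemma bloch_beta_eq_Tform:
  assumes st: "steinberg n c F G K"
    and \<phi>: "\<And>z. eventually (\<lambda>w. K w \<noteq> 0 \<longrightarrow> \<phi> w = - F w / K w) (at z)"
  shows "bloch_beta \<tau> \<phi> (\<lambda>z. 1 - \<phi> z) = antisymmetry_relations \<tau> #>\<^bsub>ZE \<tau>\<^esub> Tform F G K"
proof -
  note S = steinbergD[OF st]
  have ev: "eventually (\<lambda>w. K w \<noteq> 0) (at z)" for z
    by (rule entire_eventually_nonzero[OF sectD(2)[OF S(3)] S(6)])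
  have 1: "eventually (\<lambda>w. \<phi> w = (- F w) / K w) (at z)" for z
    using ev[of z] \<phi>[of z] by eventually_elim simp
  have 2: "eventually (\<lambda>w. 1 - \<phi> w = (- G w) / K w) (at z)" for z
    using ev[of z] 1[of z]
  proof eventually_elim
    case (elim w)
    have "K w + F w = - G w" using S(7)[of w] by (simp add: eq_neg_iff_add_eq_0 algebra_simps)
    moreover have "1 - \<phi> w = (K w + F w) / K w" using elim by (simp add: add_divide_distrib)
    ultimately show ?case by simp
  qed
  have nz: "(\<lambda>z. - F z) \<noteq> (\<lambda>_. 0)" "(\<lambda>z. - G z) \<noteq> (\<lambda>_. 0)" using S(4,5) by (auto simp: fun_eq_iff)
  have "divisor \<tau> \<phi> = mfrag (dv F) - mfrag (dv K)"
    using divisor_quotient[OF sect_uminus[OF S(1)] nz(1) S(3,6) 1] by (simp add: dv_uminus[OF S(1,4)])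
  moreover have "divisor \<tau> (\<lambda>z. 1 - \<phi> z) = mfrag (dv G) - mfrag (dv K)"
    using divisor_quotient[OF sect_uminus[OF S(2)] nz(2) S(3,6) 2] by (simp add: dv_uminus[OF S(2,5)])
  ultimately show ?thesis by (simp add: bloch_beta_def Tform_def bloch_form_def)
qed

end

section \<open>Lifting the embedding\<close>

text \<open>Forms are coded by coefficient vectors under a bilinear, not Hermitian, pairing; its
  symmetry makes points and forms interchangeable.\<close>

definition lf :: "complex ^ 3 \<Rightarrow> complex ^ 3 \<Rightarrow> complex" where
  "lf a x = a $ 1 * x $ 1 + a $ 2 * x $ 2 + a $ 3 * x $ 3"

lemma lf_simps [simp]:
  "lf a (k *s x) = k * lf a x" "lf a (x + y) = lf a x + lf a y" "lf a (x - y) = lf a x - lf a y"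
  "lf (k *s a) x = k * lf a x" "lf (a + b) x = lf a x + lf b x" "lf (a - b) x = lf a x - lf b x"
  "lf 0 x = 0" "lf a 0 = 0"
  by (simp_all add: lf_def algebra_simps)

lemma lf_commute: "lf a x = lf x a"
  by (simp add: lf_def mult_ac)

lemma linear_lf: "Vector_Spaces.linear (*s) (*) (lf a)"
  by unfold_locales (simp_all add: algebra_simps)

lemma lf_axis [simp]: "lf a (axis i 1) = a $ i"
  using exhaust_3[of i] by (auto simp: lf_def axis_def)

lemma span_singleton_iff: "x \<in> vec.span {v} \<longleftrightarrow> (\<exists>k. x = k *s v)"
  by (auto simp: vec.span_singleton)

lemma vec3_eq_0_iff: "(v :: complex ^ 3) = 0 \<longleftrightarrow> v $ 1 = 0 \<and> v $ 2 = 0 \<and> v $ 3 = 0"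
  by (auto simp: vec_eq_iff forall_3)

text \<open>The rows \<open>(a1, a2, a3)\<close> and \<open>(v2, - v1, 0)\<close> are independent
  since \<open>a3 \<noteq> 0\<close>, so their common kernel is the line through
  \<open>v\<close>.\<close>

lemma proportional_triple:
  fixes a1 a2 a3 :: complex
  assumes "a3 \<noteq> 0" "a1 * v1 + a2 * v2 + a3 * v3 = 0" "a1 * x1 + a2 * x2 + a3 * x3 = 0"
    and "v2 * x1 = v1 * x2" "v1 \<noteq> 0 \<or> v2 \<noteq> 0"
  shows "\<exists>k. x1 = k * v1 \<and> x2 = k * v2 \<and> x3 = k * v3"
proof -
  obtain k where k: "x1 = k * v1" "x2 = k * v2"
  proof (cases "v1 = 0")
    case True
    with assms show ?thesis by (intro that[of "x2 / v2"]) auto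
  next
    case False
    with assms(4) show ?thesis by (intro that[of "x1 / v1"]) (auto simp: field_simps)
  qed
  have "a3 * x3 = - (a1 * x1 + a2 * x2)" using assms(3) by (simp add: eq_neg_iff_add_eq_0 algebra_simps)
  also have "\<dots> = - k * (a1 * v1 + a2 * v2)" by (simp add: k algebra_simps)
  also have "a1 * v1 + a2 * v2 = - (a3 * v3)" using assms(2) by (simp add: eq_neg_iff_add_eq_0)
  finally have "a3 * x3 = a3 * (k * v3)" by simp
  hence "x3 = k * v3" using assms(1) by simp
  with k show ?thesis by blast
qed

text \<open>\<open>b\<close> is, up to sign, the cross product of \<open>v\<close> with the axis of
  an index \<open>k\<close> such that \<open>a $ k \<noteq> 0\<close>. It vanishes on that axis
  while \<open>a\<close> does not, which gives independence.\<close>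

lemma independent_form:
  assumes "a \<noteq> 0" "v \<noteq> 0" "lf a v = 0"
  obtains b where "b \<noteq> 0" "lf b v = 0" "\<And>k. a \<noteq> k *s b"
    "\<And>x. lf a x = 0 \<Longrightarrow> lf b x = 0 \<Longrightarrow> \<exists>k. x = k *s v"
proof -
  note witness = that
  have *: thesis if ak: "a $ k \<noteq> 0" and ijk: "(i, j, k) \<in> {(1, 2, 3), (1, 3, 2), (2, 3, 1)}" for i j k :: 3
  proof -
    define b where "b = v $ j *s axis i 1 - v $ i *s axis j (1 :: complex)"
    have bx: "lf b x = v $ j * x $ i - v $ i * x $ j" for x
      by (simp add: b_def lf_commute[of _ x])
    have ax: "lf a x = a $ i * x $ i + a $ j * x $ j + a $ k * x $ k" for x
      using ijk by (auto simp: lf_def)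
    have all: "(\<forall>l. Q l) \<longleftrightarrow> Q i \<and> Q j \<and> Q k" for Q :: "3 \<Rightarrow> bool"
      using ijk by (auto simp: forall_3)
    have b: "b $ i = v $ j" "b $ j = - v $ i" "b $ k = 0"
      using ijk by (auto simp: b_def axis_def)
    have av: "a $ i * v $ i + a $ j * v $ j + a $ k * v $ k = 0" using assms(3) ax by simp
    have vij: "v $ i \<noteq> 0 \<or> v $ j \<noteq> 0"
    proof (rule ccontr)
      assume "\<not> ?thesis"
      hence "v $ l = 0" for l using av ak all[of "\<lambda>l. v $ l = 0"] by auto
      thus False using assms(2) by (simp add: vec_eq_iff)
    qed
    show thesis
    proof (rule witness[of b])
      show "b \<noteq> 0" using vij b by auto
      show "lf b v = 0" by (simp add: bx)
      show "a \<noteq> m *s b" for m using ak b by auto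
      fix x assume "lf a x = 0" "lf b x = 0"
      hence "a $ i * x $ i + a $ j * x $ j + a $ k * x $ k = 0" "v $ j * x $ i = v $ i * x $ j"
        by (simp_all add: ax bx)
      from proportional_triple[OF ak av this vij] show "\<exists>m. x = m *s v"
        unfolding vec_eq_iff all by simp
    qed
  qed
  have "a $ 1 \<noteq> 0 \<or> a $ 2 \<noteq> 0 \<or> a $ 3 \<noteq> 0" using assms(1) vec3_eq_0_iff by blast
  thus thesis using *[of 3 1 2] *[of 2 1 3] *[of 1 2 3] by blast
qed

lemma form_vanishing_at:
  obtains a where "a \<noteq> 0" "lf a v = 0"
proof -
  consider "v = 0" | "v $ 1 \<noteq> 0 \<or> v $ 2 \<noteq> 0" | "v $ 3 \<noteq> 0" using vec3_eq_0_iff by blast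
  thus ?thesis
  proof cases
    case 1
    show ?thesis by (rule that[of "axis 1 1"]) (simp_all add: 1 axis_eq_0_iff)
  next
    case 2
    show ?thesis
    proof (rule that)
      show "(vector [v $ 2, - v $ 1, 0] :: complex ^ 3) \<noteq> 0"
        using 2 by (auto simp: vec3_eq_0_iff)
    qed (simp add: lf_def)
  next
    case 3
    show ?thesis
    proof (rule that)
      show "(vector [v $ 3, 0, - v $ 1] :: complex ^ 3) \<noteq> 0"
        using 3 by (auto simp: vec3_eq_0_iff)
    qed (simp add: lf_def)
  qed
qed

text \<open>By duality, two independent forms vanishing at the vector \<open>a\<close> are two
  independent zeros of the form \<open>a\<close>; a combination of them is annihilated by
  \<open>b\<close>.\<close>

lemma common_zero_of_forms:
  assumes "a \<noteq> 0"
  obtains v where "v \<noteq> 0" "lf a v = 0" "lf b v = 0"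
proof -
  obtain x where x: "x \<noteq> 0" "lf x a = 0" by (rule form_vanishing_at)
  obtain y where y: "y \<noteq> 0" "lf y a = 0" "\<And>k. x \<noteq> k *s y"
    by (rule independent_form[OF x(1) assms x(2)]) blast
  show ?thesis
  proof (cases "lf y b = 0")
    case True
    with y show ?thesis using that[of y] lf_commute by metis
  next
    case False
    define v where "v = x - (lf x b / lf y b) *s y"
    have "v \<noteq> 0" using y(3) by (auto simp: v_def)
    moreover have "lf v a = 0" "lf v b = 0" using x y False by (simp_all add: v_def)
    ultimately show ?thesis using that[of v] lf_commute by metis
  qed
qed

lemma proportional_vectors:
  fixes x y :: "complex ^ 3"
  assumes "x \<noteq> 0" "y \<noteq> 0" "\<And>i j. x $ i * y $ j = x $ j * y $ i"
  obtains k where "k \<noteq> 0" "x = k *s y"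
proof -
  obtain j where j: "y $ j \<noteq> 0" using assms(2) by (auto simp: vec_eq_iff)
  have "x = (x $ j / y $ j) *s y" using j assms(3) by (auto simp: vec_eq_iff field_simps)
  moreover from this have "x $ j / y $ j \<noteq> 0" using assms(1) by auto
  ultimately show ?thesis using that by blast
qed

lemma span_scale:
  fixes v :: "complex ^ 3"
  assumes "k \<noteq> 0" shows "vec.span {k *s v} = vec.span {v}"
proof -
  have "m *s v = (m / k) *s (k *s v)" for m using assms by simp
  hence "\<exists>l. m *s v = l *s (k *s v)" for m by blast
  thus ?thesis by (auto simp: span_singleton_iff)
qed

lemma span_eqD:
  fixes v w :: "complex ^ 3"
  assumes "vec.span {v} = vec.span {w}" "v \<noteq> 0"
  obtains k where "k \<noteq> 0" "v = k *s w"
proof -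
  have "v \<in> vec.span {v}" by (simp add: vec.span_base)
  then obtain k where "v = k *s w" using assms(1) by (auto simp: span_singleton_iff)
  moreover from this have "k \<noteq> 0" using assms(2) by auto
  ultimately show ?thesis using that by blast
qed

lemma hom_coords_span:
  assumes "v \<noteq> 0"
  obtains k where "k \<noteq> 0" "hom_coords (vec.span {v}) = k *s v"
proof -
  have "hom_coords (vec.span {v}) \<in> vec.span {v} \<and> hom_coords (vec.span {v}) \<noteq> 0"
    unfolding hom_coords_def by (rule someI[of _ v]) (use assms in \<open>simp add: vec.span_base\<close>)
  then obtain k where "hom_coords (vec.span {v}) = k *s v" "k *s v \<noteq> 0"
    by (auto simp: span_singleton_iff)
  thus ?thesis by (intro that[of k]) auto
qed

section \<open>Homogeneous coordinates given by sections with one multiplier\<close>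

context torus
begin

text \<open>Local lifts differ by scalar functions, so ratios of coordinates are defined on the
  whole curve. A coordinate nonzero at 0 serves as denominator, and one theta product clears all
  poles.\<close>

lemma global_lift:
  assumes emb: "holomorphic_embedding \<tau> \<Phi>"
  obtains X :: "complex \<Rightarrow> complex ^ 3" and d c
  where "\<And>i. (\<lambda>z. X z $ i) \<in> sect d c" "\<And>z. X z \<noteq> 0" "\<And>z. \<Phi> (pt \<tau> z) = vec.span {X z}"
    "\<And>z. (\<chi> i. deriv (\<lambda>w. X w $ i) z) \<notin> vec.span {X z}"
proof -
  have ex: "\<exists>U F. z \<in> U \<and> local_lift \<tau> \<Phi> U F \<and> (\<chi> i. deriv (\<lambda>w. F w $ i) z) \<notin> vec.span {F z}" for z
    using emb unfolding holomorphic_embedding_def by blast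
  have lift: "open U" "\<And>i. (\<lambda>z. F z $ i) holomorphic_on U" "\<And>z. z \<in> U \<Longrightarrow> F z \<noteq> 0"
     "\<And>z. z \<in> U \<Longrightarrow> \<Phi> (pt \<tau> z) = vec.span {F z}" if "local_lift \<tau> \<Phi> U F" for U and F :: "complex \<Rightarrow> complex ^ 3"
    using that by (auto simp: local_lift_def)
  define hc where "hc z = hom_coords (\<Phi> (pt \<tau> z))" for z
  have hc: "\<exists>k. k \<noteq> 0 \<and> hc z = k *s F z" if L: "local_lift \<tau> \<Phi> U F" "z \<in> U" for z U and F :: "complex \<Rightarrow> complex ^ 3"
  proof -
    obtain k where "k \<noteq> 0" "hom_coords (vec.span {F z}) = k *s F z"
      by (rule hom_coords_span[OF lift(3)[OF L]])
    thus ?thesis unfolding hc_def lift(4)[OF L] by blast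
  qed
  have hc_per: "hc (z + w) = hc z" if "w \<in> \<Lambda>" for z w
    using that pt_eq_iff[of "z + w" z] by (simp add: hc_def)
  obtain U0 F0 where L0: "0 \<in> U0" "local_lift \<tau> \<Phi> U0 F0" using ex by blast
  obtain j where j: "F0 0 $ j \<noteq> 0" using lift(3)[OF L0(2,1)] by (auto simp: vec_eq_iff)
  define Z where "Z = {z. hc z $ j = 0}"
  define r where "r i z = hc z $ i / hc z $ j" for i z
  have Z_iff: "z \<in> Z \<longleftrightarrow> F z $ j = 0" if "local_lift \<tau> \<Phi> U F" "z \<in> U" for z U and F :: "complex \<Rightarrow> complex ^ 3"
    using hc[OF that] by (auto simp: Z_def)
  have r_eq: "r i z = F z $ i / F z $ j" if "local_lift \<tau> \<Phi> U F" "z \<in> U" for i z U and F :: "complex \<Rightarrow> complex ^ 3"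
    using hc[OF that] by (auto simp: r_def)
  have dichotomy: "eventually (\<lambda>w. w \<in> Z) (nhds z) \<or> eventually (\<lambda>w. w \<notin> Z) (at z)" for z
  proof -
    obtain U F where L: "z \<in> U" "local_lift \<tau> \<Phi> U F" using ex by blast
    obtain e where e: "e > 0" "ball z e \<subseteq> U" using lift(1)[OF L(2)] L(1) openE by blast
    have evU: "eventually (\<lambda>w. w \<in> ball z e) (nhds z)" using e(1) by (intro eventually_nhds_in_open) auto
    have hol: "(\<lambda>z. F z $ j) holomorphic_on ball z e"
      using lift(2)[OF L(2)] e(2) by (rule holomorphic_on_subset)
    show ?thesis
    proof (cases "\<exists>b\<in>ball z e. F b $ j \<noteq> 0")
      case True
      then obtain b where "b \<in> ball z e" "F b $ j \<noteq> 0" by blast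
      hence "eventually (\<lambda>w. F w $ j \<noteq> 0 \<and> w \<in> ball z e) (at z)"
        using non_zero_neighbour_alt[OF hol open_ball connected_ball, of z b] e(1) by auto
      hence "eventually (\<lambda>w. w \<notin> Z) (at z)"
        by eventually_elim (use Z_iff[OF L(2)] e(2) in auto)
      thus ?thesis ..
    next
      case False
      have "eventually (\<lambda>w. w \<in> Z) (nhds z)"
        using evU by eventually_elim (use False Z_iff[OF L(2)] e(2) in auto)
      thus ?thesis ..
    qed
  qed
  \<comment> \<open>By the dichotomy, the points near which the chosen coordinate vanishes
    identically form a set that is open and closed. It misses 0 by the choice of \<open>j\<close>,
    so connectedness makes it empty.\<close>
  have Z_discrete: "eventually (\<lambda>w. w \<notin> Z) (at z)" for z
  proof -
    define B where "B = {z. eventually (\<lambda>w. w \<in> Z) (nhds z)}"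
    have B_Z: "w \<in> Z" if "w \<in> B" for w
      using that unfolding B_def mem_Collect_eq by (rule eventually_nhds_x_imp_x)
    have "open B"
    proof (subst open_subopen, intro ballI)
      fix z assume "z \<in> B"
      hence "eventually (\<lambda>w. eventually (\<lambda>w. w \<in> Z) (nhds w)) (nhds z)"
        by (simp add: B_def eventually_eventually)
      from iffD1[OF eventually_nhds this]
      obtain T where T: "open T" "z \<in> T" "\<forall>w\<in>T. eventually (\<lambda>w. w \<in> Z) (nhds w)"
        by (elim exE conjE)
      show "\<exists>T. open T \<and> z \<in> T \<and> T \<subseteq> B"
        by (rule exI[of _ T]) (use T in \<open>auto simp: B_def\<close>)
    qed
    moreover have "open (- B)"
    proof (subst open_subopen, intro ballI)
      fix z assume z: "z \<in> - B"
      hence "eventually (\<lambda>w. w \<notin> Z) (at z)" using dichotomy[of z] by (simp add: B_def)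
      then obtain T where T: "open T" "z \<in> T" "\<And>w. w \<in> T \<Longrightarrow> w \<noteq> z \<Longrightarrow> w \<notin> Z"
        unfolding eventually_at_topological by blast
      have "T \<subseteq> - B"
      proof
        fix w assume w: "w \<in> T"
        show "w \<in> - B"
        proof (cases "w = z")
          case False
          hence "w \<notin> Z" using T(3) w by blast
          thus ?thesis using B_Z by blast
        qed (use z in simp)
      qed
      thus "\<exists>T. open T \<and> z \<in> T \<and> T \<subseteq> - B" using T(1,2) by blast
    qed
    ultimately have "B \<inter> UNIV = {} \<or> - B \<inter> UNIV = {}"
      by (intro connectedD[OF connected_UNIV]) auto
    moreover have "0 \<notin> Z" using Z_iff[OF L0(2,1)] j by simp
    hence "0 \<notin> B" using B_Z by blast
    ultimately have "z \<notin> B" by blast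
    thus ?thesis using dichotomy[of z] by (simp add: B_def)
  qed
  hence disc: "\<not> z islimpt Z" for z by (simp add: islimpt_iff_eventually)
  have rper: "r i (z + w) = r i z" if "w \<in> \<Lambda>" for i z w using hc_per[OF that] by (simp add: r_def)
  have Zper: "z + w \<in> Z" if "w \<in> \<Lambda>" "z \<in> Z" for z w using hc_per[OF that(1)] that(2) by (simp add: Z_def)
  have coord: "(\<lambda>z. F z $ i) analytic_on {z}" if "local_lift \<tau> \<Phi> U F" "z \<in> U" for i z U and F :: "complex \<Rightarrow> complex ^ 3"
    using lift(1,2)[OF that(1)] that(2) by (auto simp: analytic_at)
  have near: "eventually (\<lambda>w. w \<in> U) (nhds z)" "eventually (\<lambda>w. w \<in> U) (at z)"
    if "local_lift \<tau> \<Phi> U F" "z \<in> U" for z U and F :: "complex \<Rightarrow> complex ^ 3"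
    using lift(1)[OF that(1)] that(2) by (auto intro: eventually_nhds_in_open eventually_at_in_open')
  have ran: "r i analytic_on {z}" if zZ: "z \<notin> Z" for i z
  proof -
    obtain U F where L: "z \<in> U" "local_lift \<tau> \<Phi> U F" using ex by blast
    have "(\<lambda>z. F z $ i / F z $ j) analytic_on {z}"
      using Z_iff[OF L(2,1)] zZ by (intro analytic_intros coord[OF L(2,1)]) auto
    moreover have "eventually (\<lambda>w. r i w = F w $ i / F w $ j) (nhds z)"
      using near(1)[OF L(2,1)] by eventually_elim (rule r_eq[OF L(2)])
    ultimately show ?thesis by (simp add: analytic_at_cong)
  qed
  \<comment> \<open>The exponent is the order of the denominator of a local lift. What remains is
    the local lift divided by a unit, and a local lift never vanishes.\<close>
  have loc: "\<exists>m h. (\<forall>i. h i analytic_on {p} \<and> eventually (\<lambda>z. (z - p) ^ m * r i z = h i z) (at p)) \<and> (\<exists>i. h i p \<noteq> 0)"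
    if pZ: "p \<in> Z" for p
  proof -
    obtain U F where L: "p \<in> U" "local_lift \<tau> \<Phi> U F" using ex by blast
    obtain e where e: "e > 0" "ball p e \<subseteq> U" using lift(1)[OF L(2)] L(1) openE by blast
    define f where "f = (\<lambda>z. F z $ j)"
    have hol: "f holomorphic_on ball p e"
      unfolding f_def using lift(2)[OF L(2)] e(2) by (rule holomorphic_on_subset)
    have f_nz: "\<exists>w\<in>ball p e. f w \<noteq> 0"
    proof -
      have "eventually (\<lambda>w. w \<in> ball p e \<and> w \<notin> Z) (at p)"
        using Z_discrete[of p] e(1) by (intro eventually_conj eventually_at_in_open') auto
      then obtain w where "w \<in> ball p e" "w \<notin> Z"
        using eventually_happens[of _ "at p"] by auto
      moreover from this have "w \<in> U" using e(2) by blast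
      ultimately have "f w \<noteq> 0" using Z_iff[OF L(2), of w] by (simp add: f_def)
      thus ?thesis using \<open>w \<in> ball p e\<close> by blast
    qed
    have "p \<in> ball p e" using e(1) by simp
    from zorder_exist_zero[OF hol open_ball connected_ball this f_nz]
    obtain s where s: "s > 0" "cball p s \<subseteq> ball p e" "zor_poly f p holomorphic_on cball p s"
      "\<And>w. w \<in> cball p s \<Longrightarrow> f w = zor_poly f p w * (w - p) ^ nat (zorder f p) \<and> zor_poly f p w \<noteq> 0"
      by blast
    define q m where "q = zor_poly f p" and "m = nat (zorder f p)"
    have q: "q analytic_on {p}"
      using s(1) unfolding q_def by (auto simp: analytic_at intro!: exI[of _ "ball p s"] holomorphic_on_subset[OF s(3)])
    have q0: "q p \<noteq> 0" using s(4)[of p] s(1) by (simp add: q_def)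
    define h where "h i z = F z $ i / q z" for i z
    have "h i analytic_on {p}" for i
      unfolding h_def by (intro analytic_intros coord[OF L(2,1)] q) (use q0 in auto)
    moreover have "eventually (\<lambda>z. (z - p) ^ m * r i z = h i z) (at p)" for i
    proof -
      have "eventually (\<lambda>z. z \<in> ball p s - {p}) (at p)" using s(1) by (intro eventually_at_in_open) auto
      thus ?thesis
      proof eventually_elim
        case (elim z)
        have zU: "z \<in> U" using elim s(2) e(2) ball_subset_cball by blast
        have "f z = q z * (z - p) ^ m" "q z \<noteq> 0" using s(4)[of z] elim by (auto simp: q_def m_def)
        thus ?case using r_eq[OF L(2) zU, of i] elim by (simp add: f_def h_def)
      qed
    qed
    moreover obtain i where "F p $ i \<noteq> 0" using lift(3)[OF L(2,1)] by (auto simp: vec_eq_iff)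
    hence "\<exists>i. h i p \<noteq> 0" using q0 by (auto simp: h_def)
    ultimately show ?thesis by blast
  qed
  obtain \<Theta> d c G where G': "\<Theta> \<in> sect d c" "\<forall>z. z \<notin> Z \<longrightarrow> \<Theta> z \<noteq> 0"
    "\<forall>i. G i \<in> sect d c" "\<forall>i z. z \<notin> Z \<longrightarrow> G i z = \<Theta> z * r i z" "\<forall>p. p \<in> Z \<longrightarrow> (\<exists>i. G i p \<noteq> 0)"
  proof -
    have "\<exists>\<Theta> n c G. \<Theta> \<in> sect n c \<and> \<Theta> \<noteq> (\<lambda>_. 0) \<and> (\<forall>z. z \<notin> Z \<longrightarrow> \<Theta> z \<noteq> 0) \<and>
           (\<forall>i. G i \<in> sect n c) \<and> (\<forall>i z. z \<notin> Z \<longrightarrow> G i z = \<Theta> z * r i z) \<and>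
           (\<forall>p. p \<in> Z \<longrightarrow> (\<exists>i. G i p \<noteq> 0))"
      by (rule clear_poles[of r Z]) (fact rper disc Zper ran loc)+
    thus ?thesis using that by blast
  qed
  note G = G'(1) G'(3)[rule_format] G'(2)[rule_format] G'(4)[rule_format] G'(5)[rule_format]
  define X where "X z = (\<chi> i. G i z)" for z
  have Xi: "X z $ i = G i z" for z i by (simp add: X_def)
  have X0: "X z \<noteq> 0" for z
  proof (cases "z \<in> Z")
    case True thus ?thesis using G(5) by (auto simp: vec_eq_iff Xi)
  next
    case False
    hence "G j z = \<Theta> z" using G(4)[OF False, of j] by (simp add: r_def Z_def)
    hence "X z $ j \<noteq> 0" using G(3)[OF False] by (simp add: Xi)
    thus ?thesis by auto
  qed
  \<comment> \<open>Proportionality is immediate off \<open>Z\<close>; the vanishing of the minors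
    of size 2 extends to \<open>Z\<close> by continuity.\<close>
  have multiple: "\<exists>k. k \<noteq> 0 \<and> X z = k *s F z" if L: "local_lift \<tau> \<Phi> U F" "z \<in> U" for z U and F :: "complex \<Rightarrow> complex ^ 3"
  proof -
    have minors: "X z $ a * F z $ b = X z $ b * F z $ a" for a b
    proof -
      have an: "G a analytic_on {z}" for a by (rule sect_analytic[OF G(2)])
      have lim: "(\<lambda>w. G a w * F w $ b - G b w * F w $ a) \<midarrow>z\<rightarrow> G a z * F z $ b - G b z * F z $ a"
        by (intro isContD analytic_at_imp_isCont analytic_intros an coord[OF L])
      have "eventually (\<lambda>w. w \<in> U \<and> w \<notin> Z) (at z)"
        using near(2)[OF L] Z_discrete[of z] by (rule eventually_conj)
      hence "eventually (\<lambda>w. G a w * F w $ b - G b w * F w $ a = 0) (at z)"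
      proof eventually_elim
        case (elim w)
        thus ?case using G(4)[of w] r_eq[OF L(1), of w] by simp
      qed
      hence "(\<lambda>w. G a w * F w $ b - G b w * F w $ a) \<midarrow>z\<rightarrow> 0" by (rule tendsto_eventually)
      from LIM_unique[OF lim this] show ?thesis by (simp add: Xi)
    qed
    obtain k where "k \<noteq> 0" "X z = k *s F z"
      by (rule proportional_vectors[OF X0 lift(3)[OF L] minors])
    thus ?thesis by blast
  qed
  have span: "\<Phi> (pt \<tau> z) = vec.span {X z}" for z
  proof -
    obtain U F where L: "z \<in> U" "local_lift \<tau> \<Phi> U F" using ex by blast
    obtain k where "k \<noteq> 0" "X z = k *s F z" using multiple[OF L(2,1)] by blast
    thus ?thesis using lift(4)[OF L(2,1)] span_scale by simp
  qed
  \<comment> \<open>With \<open>X = u * F\<close> the derivative is \<open>u' * F + u * F'\<close>,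
    where \<open>u z \<noteq> 0\<close>. If it were a multiple of \<open>F\<close>, so would be
    \<open>F'\<close>.\<close>
  have imm: "(\<chi> i. deriv (\<lambda>w. X w $ i) z) \<notin> vec.span {X z}" for z
  proof
    assume in_span: "(\<chi> i. deriv (\<lambda>w. X w $ i) z) \<in> vec.span {X z}"
    obtain U F where L: "z \<in> U" "local_lift \<tau> \<Phi> U F"
      and F': "(\<chi> i. deriv (\<lambda>w. F w $ i) z) \<notin> vec.span {F z}" using ex by blast
    obtain k where k: "k \<noteq> 0" "X z = k *s F z" using multiple[OF L(2,1)] by blast
    obtain l where l: "(\<chi> i. deriv (\<lambda>w. X w $ i) z) = l *s X z"
      using in_span by (auto simp: span_singleton_iff)
    obtain a where a: "F z $ a \<noteq> 0" using lift(3)[OF L(2,1)] by (auto simp: vec_eq_iff)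
    define u where "u w = X w $ a / F w $ a" for w
    have u: "u analytic_on {z}"
      unfolding u_def Xi by (intro analytic_intros sect_analytic[OF G(2)] coord[OF L(2,1)]) (use a in auto)
    have uz: "u z = k" using k a by (simp add: u_def)
    have diffs: "((\<lambda>w. F w $ i) has_field_derivative deriv (\<lambda>w. F w $ i) z) (at z)"
      "(u has_field_derivative deriv u z) (at z)" for i
      using coord[OF L(2,1), of i] u by (auto simp: analytic_at intro!: holomorphic_derivI)
    have "eventually (\<lambda>w. F w $ a \<noteq> 0) (nhds z)"
    proof -
      obtain e where "e > 0" "\<forall>y. dist z y < e \<longrightarrow> F y $ a \<noteq> 0"
        using continuous_at_avoid[OF analytic_at_imp_isCont[OF coord[OF L(2,1), of a]] a] by blast
      thus ?thesis unfolding eventually_nhds_metric by (intro exI[of _ e]) (auto simp: dist_commute)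
    qed
    hence evX: "eventually (\<lambda>w. X w $ i = u w * F w $ i) (nhds z)" for i
      using near(1)[OF L(2,1)]
    proof eventually_elim
      case (elim w)
      obtain k where "X w = k *s F w" using multiple[OF L(2) elim(2)] by blast
      thus ?case using elim(1) by (simp add: u_def)
    qed
    have "deriv (\<lambda>w. X w $ i) z = deriv u z * F z $ i + u z * deriv (\<lambda>w. F w $ i) z" for i
    proof -
      have "((\<lambda>w. u w * F w $ i) has_field_derivative (deriv u z * F z $ i + deriv (\<lambda>w. F w $ i) z * u z)) (at z)"
        by (rule DERIV_mult[OF diffs(2,1)])
      hence "deriv (\<lambda>w. u w * F w $ i) z = deriv u z * F z $ i + deriv (\<lambda>w. F w $ i) z * u z"
        by (rule DERIV_imp_deriv)
      moreover have "deriv (\<lambda>w. X w $ i) z = deriv (\<lambda>w. u w * F w $ i) z"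
        by (rule deriv_cong_ev[OF evX refl])
      ultimately show ?thesis by (simp add: mult_ac)
    qed
    hence "deriv u z * F z $ i + k * deriv (\<lambda>w. F w $ i) z = l * (k * F z $ i)" for i
      using arg_cong[OF l, of "\<lambda>x. x $ i"] k(2) uz by simp
    hence "deriv (\<lambda>w. F w $ i) z = ((l * k - deriv u z) / k) * F z $ i" for i
      using k(1) by (simp add: field_simps)
    hence "(\<chi> i. deriv (\<lambda>w. F w $ i) z) = ((l * k - deriv u z) / k) *s F z"
      by (simp add: vec_eq_iff)
    with F' show False unfolding span_singleton_iff by blast
  qed
  show ?thesis
    by (rule that[of X d c]) (use G(2) X0 span imm in \<open>auto simp: Xi\<close>)
qed

end

section \<open>The embedding is by sections of degree three\<close>

lemma cubic_form_scale: "cubic_form c (k *s x) = k ^ 3 * cubic_form c x"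
proof -
  have *: "c i j * (k * x $ 1) ^ i * (k * x $ 2) ^ j * (k * x $ 3) ^ (3 - i - j) =
        k ^ 3 * (c i j * x $ 1 ^ i * x $ 2 ^ j * x $ 3 ^ (3 - i - j))"
    if "i \<in> {..3}" "j \<in> {..3 - i}" for i j
  proof -
    have "3 = i + j + (3 - i - j)" using that by auto
    hence "k ^ 3 = k ^ i * k ^ j * k ^ (3 - i - j)" by (metis power_add)
    thus ?thesis by (simp add: power_mult_distrib mult_ac)
  qed
  show ?thesis
    unfolding cubic_form_def sum_distrib_left vector_smult_component by (intro sum.cong refl *)
qed

lemma cubic_form_on_line:
  fixes c :: "nat \<Rightarrow> nat \<Rightarrow> complex" and q v :: "complex ^ 3"
  obtains p where "degree p \<le> 3" "\<And>s. poly p s = cubic_form c (q + s *s v)"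
proof
  define l where "l i = [:q $ i, v $ i:]" for i
  have deg: "degree (l i ^ n) \<le> n" for i n
  proof -
    have "degree (l i) * n \<le> 1 * n" by (intro mult_right_mono) (simp_all add: l_def)
    with degree_power_le[of "l i" n] show ?thesis by linarith
  qed
  define p where "p = (\<Sum>i\<le>3. \<Sum>j\<le>3 - i. smult (c i j) (l 1 ^ i * l 2 ^ j * l 3 ^ (3 - i - j)))"
  have "degree (smult (c i j) (l 1 ^ i * l 2 ^ j * l 3 ^ (3 - i - j))) \<le> 3"
    if "i \<in> {..3}" "j \<in> {..3 - i}" for i j
  proof -
    have "degree (smult (c i j) (l 1 ^ i * l 2 ^ j * l 3 ^ (3 - i - j))) \<le>
            degree (l 1 ^ i * l 2 ^ j * l 3 ^ (3 - i - j))" by (rule degree_smult_le)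
    also have "\<dots> \<le> degree (l 1 ^ i) + degree (l 2 ^ j) + degree (l 3 ^ (3 - i - j))"
      by (meson add_mono degree_mult_le le_refl order_trans)
    also have "\<dots> \<le> i + j + (3 - i - j)" by (intro add_mono deg)
    also have "\<dots> = 3" using that by auto
    finally show ?thesis .
  qed
  thus "degree p \<le> 3" unfolding p_def by (intro degree_sum_le finite_atMost)
  show "poly p s = cubic_form c (q + s *s v)" for s
    by (simp add: p_def cubic_form_def l_def poly_sum mult_ac)
qed

text \<open>The polynomial along the line is nonzero because its value at infinity is the cubic form
  at \<open>v\<close>: the reversed polynomial \<open>r\<close> satisfies
  \<open>r(s) = s ^ 3 * p(1 / s)\<close> and does not vanish at 0.\<close>

lemma cubic_form_line_roots:
  assumes "cubic_form c v \<noteq> 0"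
  shows "finite {s. cubic_form c (q + s *s v) = 0}" "card {s. cubic_form c (q + s *s v) = 0} \<le> 3"
proof -
  obtain p where p: "degree p \<le> 3" "\<And>s. poly p s = cubic_form c (q + s *s v)"
    by (rule cubic_form_on_line) blast
  obtain r where r: "degree r \<le> 3" "\<And>s. poly r s = cubic_form c (v + s *s q)"
    by (rule cubic_form_on_line) blast
  have "p \<noteq> 0"
  proof
    assume "p = 0"
    hence zero: "cubic_form c (q + s *s v) = 0" for s using p(2)[of s] by simp
    have "poly r s = 0" if "s \<noteq> 0" for s
    proof -
      have eq: "v + s *s q = s *s (q + (1 / s) *s v)" using that by (simp add: vec_eq_iff field_simps)
      show ?thesis unfolding r(2) eq cubic_form_scale zero by simp
    qed
    hence "UNIV - {0} \<subseteq> {s. poly r s = 0}" by auto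
    moreover have "infinite (UNIV - {0 :: complex})" by (simp add: infinite_UNIV_char_0)
    ultimately have "infinite {s. poly r s = 0}" using finite_subset by blast
    hence "r = 0" using poly_roots_finite by blast
    hence "cubic_form c v = 0" using r(2)[of 0] by simp
    with assms show False by simp
  qed
  thus "finite {s. cubic_form c (q + s *s v) = 0}" "card {s. cubic_form c (q + s *s v) = 0} \<le> 3"
    using poly_roots_finite[of p] card_poly_roots_bound[of p] p by auto
qed

locale lifted_cubic = torus +
  fixes \<Phi> :: "complex set \<Rightarrow> (complex ^ 3) set"
    and d :: int and c0 :: complex and X :: "complex \<Rightarrow> complex ^ 3"
  assumes coords: "(\<lambda>z. X z $ i) \<in> sect d c0"
    and X_nonzero: "X z \<noteq> 0"
    and \<Phi>_X: "\<Phi> (pt \<tau> z) = vec.span {X z}"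
    and immersive: "(\<chi> i. deriv (\<lambda>w. X w $ i) z) \<notin> vec.span {X z}"
    and injective: "inj_on \<Phi> (carrier (elliptic_curve \<tau>))"
    and cubic: "plane_cubic (\<Phi> ` carrier (elliptic_curve \<tau>))"
begin

lemma X_inj: "X z = k *s X z' \<Longrightarrow> z - z' \<in> \<Lambda>"
proof -
  assume eq: "X z = k *s X z'"
  hence "k \<noteq> 0" using X_nonzero[of z] by auto
  hence "\<Phi> (pt \<tau> z) = \<Phi> (pt \<tau> z')" unfolding \<Phi>_X eq by (rule span_scale)
  hence "pt \<tau> z = pt \<tau> z'" using injective by (auto simp: inj_on_def carrier_elliptic_curve)
  thus ?thesis by (simp add: pt_eq_iff)
qed

lemma lf_sect: "(\<lambda>z. lf a (X z)) \<in> sect d c0"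
  using sect_add[OF sect_add[OF sect_cmult[OF coords[of 1], of "a $ 1"] sect_cmult[OF coords[of 2], of "a $ 2"]]
      sect_cmult[OF coords[of 3], of "a $ 3"]] by (simp add: lf_def)

lemma deriv_lf: "deriv (\<lambda>z. lf a (X z)) z = lf a (\<chi> i. deriv (\<lambda>w. X w $ i) z)"
proof -
  have "((\<lambda>w. X w $ i) has_field_derivative deriv (\<lambda>w. X w $ i) z) (at z)" for i
    using sectD(2)[OF coords] by (auto intro: holomorphic_derivI)
  hence "((\<lambda>z. lf a (X z)) has_field_derivative lf a (\<chi> i. deriv (\<lambda>w. X w $ i) z)) (at z)"
    unfolding lf_def by (auto intro!: derivative_eq_intros)
  thus ?thesis by (rule DERIV_imp_deriv)
qed

lemma simple_zero:
  assumes "F \<in> sect n c" "F \<noteq> (\<lambda>_. 0)" "F z = 0" "deriv F z \<noteq> 0"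
  shows "count (dv F) (pt \<tau> z) = 1"
proof -
  have "zorder F z = 1"
    by (rule zorder_zero_eqI'[OF sect_analytic[OF assms(1)]]) (use assms in auto)
  thus ?thesis using zorder_eq_count_dv[OF assms(1,2), of z] by simp
qed

text \<open>
  If the curve lay on a line, the line through one further point would cut out a single simple point;
  but a section of degree one determines its zero, which could not vary.
\<close>
lemma nondegenerate:
  assumes "a \<noteq> 0" shows "(\<lambda>z. lf a (X z)) \<noteq> (\<lambda>_. 0)"
proof
  assume "(\<lambda>z. lf a (X z)) = (\<lambda>_. 0)"
  hence a: "lf a (X z) = 0" for z by (rule fun_cong)
  have point: "\<exists>F. F \<in> sect d c0 \<and> F \<noteq> (\<lambda>_. 0) \<and> dv F = {#pt \<tau> p#}" for p
  proof -
    \<comment> \<open>On the line \<open>a = 0\<close> a second form through \<open>X p\<close>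
      vanishes at no other point. Injectivity then leaves one zero on the curve, and immersivity
      makes it simple.\<close>
    obtain b where b: "lf b (X p) = 0" "\<And>x. lf a x = 0 \<Longrightarrow> lf b x = 0 \<Longrightarrow> \<exists>k. x = k *s X p"
      by (rule independent_form[OF assms X_nonzero a, of p]) blast
    define F where "F = (\<lambda>z. lf b (X z))"
    have F: "F \<in> sect d c0" unfolding F_def by (rule lf_sect)
    have zero: "z - p \<in> \<Lambda>" if "F z = 0" for z
      using b(2)[OF a, of z] that X_inj by (auto simp: F_def)
    have F0: "F \<noteq> (\<lambda>_. 0)"
      using zero[of "p + 1 / 2"] half_not_in_lattice by auto
    have "deriv F p \<noteq> 0"
    proof
      assume "deriv F p = 0"
      hence "lf b (\<chi> i. deriv (\<lambda>w. X w $ i) p) = 0" by (simp add: F_def deriv_lf)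
      moreover have "lf a (\<chi> i. deriv (\<lambda>w. X w $ i) p) = 0" using deriv_lf[of a p] by (simp add: a)
      ultimately show False using b(2) immersive[of p] by (auto simp: span_singleton_iff)
    qed
    hence "count (dv F) (pt \<tau> p) = 1"
      by (intro simple_zero[OF F F0]) (simp_all add: F_def b)
    moreover have "count (dv F) x = 0" if "x \<noteq> pt \<tau> p" for x
    proof (rule ccontr)
      assume "count (dv F) x \<noteq> 0"
      hence "x \<in># dv F" by (simp add: count_eq_zero_iff)
      then obtain z where "x = pt \<tau> z" "F z = 0" by (rule in_dvE[OF F F0])
      with zero[of z] that pt_eq_iff show False by blast
    qed
    ultimately have "dv F = {#pt \<tau> p#}" by (intro multiset_eqI) auto
    with F F0 show ?thesis by blast
  qed
  obtain F where F: "F \<in> sect d c0" "F \<noteq> (\<lambda>_. 0)" "dv F = {#pt \<tau> 0#}" using point by blast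
  obtain G where G: "G \<in> sect d c0" "G \<noteq> (\<lambda>_. 0)" "dv G = {#pt \<tau> (1 / 2)#}" using point by blast
  have "int (size (dv F)) = d" by (rule size_dv[OF F(1,2)])
  hence "d = 1" by (simp add: F(3))
  hence "dv F = dv G" using F G by (intro dv_eq_degree_1[of F c0 G]) auto
  hence "1 / 2 \<in> \<Lambda>" using pt_eq_iff[of "1 / 2" 0] by (simp add: F(3) G(3))
  thus False using half_not_in_lattice by simp
qed

lemma lf_eqI: "(\<And>z. lf a (X z) = lf b (X z)) \<Longrightarrow> a = b"
  using nondegenerate[of "a - b"] by (auto simp: fun_eq_iff)

text \<open>The points [0 : 1 : n] form an infinite subset of one line, while the section cutting
  out this line has finitely many zeros on the curve.\<close>

lemma point_off_curve:
  obtains v where "v \<noteq> 0" "\<And>z k. X z \<noteq> k *s v"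
proof -
  have "\<exists>v. v \<noteq> 0 \<and> (\<forall>z k. X z \<noteq> k *s v)"
  proof (rule ccontr)
    assume "\<not> ?thesis"
    hence all: "\<exists>z k. X z = k *s v" if "v \<noteq> 0" for v using that by blast
    define v :: "nat \<Rightarrow> complex ^ 3" where "v n = vector [0, 1, of_nat n]" for n
    have vc: "v n $ 1 = 0" "v n $ 2 = 1" "v n $ 3 = of_nat n" for n by (simp_all add: v_def)
    have v0: "v n \<noteq> 0" for n using vc(2)[of n] by auto
    obtain z k where zk: "\<And>n. X (z n) = k n *s v n" using all[OF v0] by metis
    define F where "F = (\<lambda>w. lf (axis 1 1) (X w))"
    have F: "F \<in> sect d c0" unfolding F_def by (rule lf_sect)
    have F0: "F \<noteq> (\<lambda>_. 0)" unfolding F_def by (rule nondegenerate) (simp add: axis_eq_0_iff)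
    have "F (z n) = 0" for n by (simp add: F_def zk lf_commute[of "axis 1 1"] vc)
    hence sub: "range (\<lambda>n. pt \<tau> (z n)) \<subseteq> set_mset (dv F)" using in_dv_iff[OF F F0] by auto
    have "inj (\<lambda>n. pt \<tau> (z n))"
    proof (rule injI)
      fix m n assume "pt \<tau> (z m) = pt \<tau> (z n)"
      hence "vec.span {X (z m)} = vec.span {X (z n)}" using \<Phi>_X by metis
      then obtain l where "X (z m) = l *s X (z n)" by (rule span_eqD) (rule X_nonzero)
      hence eq: "k m *s v m = (l * k n) *s v n" by (simp add: zk)
      have "k m = l * k n" "k m * of_nat m = l * k n * of_nat n"
        using arg_cong[OF eq, of "\<lambda>x :: complex ^ 3. x $ 2"] arg_cong[OF eq, of "\<lambda>x :: complex ^ 3. x $ 3"] by (simp_all add: vc)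
      moreover have "k m \<noteq> 0" using zk[of m] X_nonzero[of "z m"] by auto
      ultimately show "m = n" by auto
    qed
    hence "infinite (range (\<lambda>n. pt \<tau> (z n)))" by (rule range_inj_infinite)
    thus False using sub finite_subset by blast
  qed
  with that show ?thesis by blast
qed

text \<open>Differentiating the multiplier adds the same multiple of \<open>F * G\<close> to both
  products, and these terms cancel in the difference.\<close>

lemma wronskian_sect:
  assumes F: "F \<in> sect n c" and G: "G \<in> sect n c"
  shows "(\<lambda>z. deriv F z * G z - F z * deriv G z) \<in> sect (n + n) (c * c)"
proof -
  have d1: "deriv E (z + 1) = deriv E z"
    and d2: "deriv E (z + \<tau>) = c * ee (- (of_int n * z)) * (deriv E z - 2 * of_real pi * \<i> * of_int n * E z)"
    if E: "E \<in> sect n c" for E z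
  proof -
    have der: "(E has_field_derivative deriv E w) (at w)" for w
      using sectD(2)[OF E] by (auto intro: holomorphic_derivI)
    have "((\<lambda>z. E (z + w)) has_field_derivative deriv E (z + w)) (at z)" for w
      using der[of "z + w"] by (subst DERIV_shift[symmetric])
    note sh = this
    have "((\<lambda>z. E (z + 1)) has_field_derivative deriv E z) (at z)"
      using der[of z] by (simp add: sectD(3)[OF E])
    thus "deriv E (z + 1) = deriv E z" using sh[of 1] DERIV_unique by blast
    have "((\<lambda>z. c * ee (- (of_int n * z)) * E z) has_field_derivative
            c * ee (- (of_int n * z)) * (deriv E z - 2 * of_real pi * \<i> * of_int n * E z)) (at z)"
      by (auto intro!: derivative_eq_intros der simp: algebra_simps)
    hence "((\<lambda>z. E (z + \<tau>)) has_field_derivative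
            c * ee (- (of_int n * z)) * (deriv E z - 2 * of_real pi * \<i> * of_int n * E z)) (at z)"
      by (simp add: sectD(4)[OF E])
    thus "deriv E (z + \<tau>) = c * ee (- (of_int n * z)) * (deriv E z - 2 * of_real pi * \<i> * of_int n * E z)"
      using sh[of \<tau>] DERIV_unique by blast
  qed
  have "ee (- (of_int (n + n) * z)) = ee (- (of_int n * z)) * ee (- (of_int n * z))" for z
    by (simp add: ee_add[symmetric] algebra_simps)
  thus ?thesis
    unfolding sect_def using sectD(1)[OF F]
    by (auto simp: d1[OF F] d1[OF G] d2[OF F] d2[OF G] sectD(3,4)[OF F] sectD(3,4)[OF G] algebra_simps
        intro!: holomorphic_intros sectD(2)[OF F] sectD(2)[OF G])
qed

lemma degree_pos: "d \<ge> 1"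
proof -
  obtain a where a: "a \<noteq> 0" "lf a (X 0) = 0" by (rule form_vanishing_at)
  have "pt \<tau> 0 \<in># dv (\<lambda>z. lf a (X z))"
    using in_dv_iff[OF lf_sect nondegenerate[OF a(1)]] a(2) by simp
  hence "size (dv (\<lambda>z. lf a (X z))) \<noteq> 0" by auto
  thus ?thesis using size_dv[OF lf_sect nondegenerate[OF a(1)]] by linarith
qed

text \<open>
  A generic line through a point off the curve meets the curve in \<open>d\<close> distinct points, all of which
  are zeros of the cubic form restricted to this line.
\<close>
lemma degree_le_3: "d \<le> 3"
proof -
  obtain v where v: "v \<noteq> 0" "\<And>z k. X z \<noteq> k *s v" by (rule point_off_curve) blast
  obtain c where C: "\<Phi> ` carrier (elliptic_curve \<tau>) = {p \<in> proj_plane. \<forall>x\<in>p. cubic_form c x = 0}"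
    using cubic by (auto simp: plane_cubic_def)
  have cubic_X: "cubic_form c (X z) = 0" for z
  proof -
    have "\<Phi> (pt \<tau> z) \<in> \<Phi> ` carrier (elliptic_curve \<tau>)" by (simp add: carrier_elliptic_curve)
    hence "\<forall>x\<in>vec.span {X z}. cubic_form c x = 0" unfolding C \<Phi>_X by blast
    thus ?thesis by (simp add: vec.span_base)
  qed
  \<comment> \<open>This uses that the image is the whole zero locus of the cubic form, not merely
    contained in it.\<close>
  have cubic_v: "cubic_form c v \<noteq> 0"
  proof
    assume "cubic_form c v = 0"
    hence "\<forall>x\<in>vec.span {v}. cubic_form c x = 0" by (auto simp: span_singleton_iff cubic_form_scale)
    moreover have "vec.span {v} \<in> proj_plane" using v(1) by (auto simp: proj_plane_def)
    ultimately have "vec.span {v} \<in> \<Phi> ` carrier (elliptic_curve \<tau>)" unfolding C by blast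
    then obtain z where "vec.span {X z} = vec.span {v}" by (auto simp: carrier_elliptic_curve \<Phi>_X)
    then obtain k where "X z = k *s v" by (rule span_eqD) (rule X_nonzero)
    with v(2) show False by blast
  qed
  obtain a where a: "a \<noteq> 0" "lf a v = 0" by (rule form_vanishing_at)
  obtain b where b: "b \<noteq> 0" "lf b v = 0" "\<And>k. a \<noteq> k *s b"
    "\<And>x. lf a x = 0 \<Longrightarrow> lf b x = 0 \<Longrightarrow> \<exists>k. x = k *s v"
    by (rule independent_form[OF a(1) v(1) a(2)]) blast
  define f1 f2 where "f1 = (\<lambda>z. lf a (X z))" and "f2 = (\<lambda>z. lf b (X z))"
  have f: "f1 \<in> sect d c0" "f2 \<in> sect d c0" "f1 \<noteq> (\<lambda>_. 0)" "f2 \<noteq> (\<lambda>_. 0)"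
    unfolding f1_def f2_def by (intro lf_sect nondegenerate a b)+
  have no_common: "f2 z \<noteq> 0" if "f1 z = 0" for z
    using b(4)[of "X z"] v(2) that by (auto simp: f1_def f2_def)
  define W where "W = (\<lambda>z. deriv f1 z * f2 z - f1 z * deriv f2 z)"
  obtain p where p: "f1 p = 0" using sect_has_zero[OF f(1)] degree_pos by auto
  have W: "W \<in> sect (d + d) (c0 * c0)" unfolding W_def by (rule wronskian_sect[OF f(1,2)])
  have W0: "W \<noteq> (\<lambda>_. 0)"
    unfolding W_def by (rule wronskian_nonzero[OF sectD(2)[OF f(1)] sectD(2)[OF f(2)] f(3) p no_common[OF p]])
  define g where "g x = f1 (SOME w. w \<in> x) / f2 (SOME w. w \<in> x)" for x
  have g_pt: "g (pt \<tau> z) = f1 z / f2 z" for z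
  proof -
    define w where "w = (SOME w. w \<in> pt \<tau> z)"
    have "w - z \<in> \<Lambda>" unfolding w_def by (rule some_representative)
    hence "vec.span {X w} = vec.span {X z}" using \<Phi>_X pt_eq_iff by metis
    then obtain k where "k \<noteq> 0" "X w = k *s X z" by (rule span_eqD) (rule X_nonzero)
    thus ?thesis by (simp add: g_def w_def[symmetric] f1_def f2_def)
  qed
  have "finite (g ` set_mset (dv W))" by simp
  \<comment> \<open>A value that \<open>f1 / f2\<close> does not take at any zero of the Wronskian,
    so that \<open>f1 - l * f2\<close> has only simple zeros.\<close>
  then obtain l where l: "l \<notin> g ` set_mset (dv W)"
    using ex_new_if_finite infinite_UNIV_char_0 by blast
  define e where "e = a - l *s b"
  define G where "G = (\<lambda>z. lf e (X z))"
  have Geq: "G z = f1 z - l * f2 z" for z by (simp add: G_def e_def f1_def f2_def)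
  have e0: "e \<noteq> 0" using b(3)[of l] by (auto simp: e_def)
  have ev: "lf e v = 0" using a b by (simp add: e_def)
  have G: "G \<in> sect d c0" "G \<noteq> (\<lambda>_. 0)" unfolding G_def by (intro lf_sect nondegenerate e0)+
  have simple: "count (dv G) (pt \<tau> z) = 1" if Gz: "G z = 0" for z
  proof (rule simple_zero[OF G Gz])
    have f2z: "f2 z \<noteq> 0" using no_common[of z] Gz Geq[of z] by auto
    hence l_eq: "l = f1 z / f2 z" using Gz Geq[of z] by (simp add: field_simps)
    have "W z \<noteq> 0"
    proof
      assume "W z = 0"
      hence "pt \<tau> z \<in># dv W" using in_dv_iff[OF W W0] by simp
      with l l_eq g_pt[of z] show False by (metis image_eqI)
    qed
    have "(f1 has_field_derivative deriv f1 z) (at z)" "(f2 has_field_derivative deriv f2 z) (at z)"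
      using sectD(2)[OF f(1)] sectD(2)[OF f(2)] by (auto intro: holomorphic_derivI)
    hence "((\<lambda>z. f1 z - l * f2 z) has_field_derivative deriv f1 z - l * deriv f2 z) (at z)"
      by (auto intro!: derivative_eq_intros)
    hence "deriv G z = deriv f1 z - l * deriv f2 z"
      unfolding Geq[symmetric] by (rule DERIV_imp_deriv)
    also have "\<dots> = W z / f2 z" using f2z by (simp add: W_def l_eq field_simps)
    finally show "deriv G z \<noteq> 0" using \<open>W z \<noteq> 0\<close> f2z by simp
  qed
  have "size (dv G) = (\<Sum>x\<in>set_mset (dv G). count (dv G) x)" by (rule size_multiset_overloaded_eq)
  also have "\<dots> = (\<Sum>x\<in>set_mset (dv G). 1)"
    by (intro sum.cong refl) (metis in_dvE[OF G] simple)
  finally have card: "size (dv G) = card (set_mset (dv G))" by simp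
  obtain b' where b': "\<And>x. lf e x = 0 \<Longrightarrow> lf b' x = 0 \<Longrightarrow> \<exists>k. x = k *s v"
    "lf b' v = 0"
    by (rule independent_form[OF e0 v(1) ev]) blast
  have b'X: "lf b' (X z) \<noteq> 0" if "G z = 0" for z
    using b'(1)[of "X z"] that v(2) by (auto simp: G_def)
  obtain z1 where z1: "G z1 = 0" using sect_has_zero[OF G(1)] degree_pos by auto
  \<comment> \<open>Normalised by \<open>lf b' q = 1\<close>, so that \<open>q + s *s v\<close>
    parametrises the line \<open>e = 0\<close> apart from the point \<open>v\<close>, which is off
    the curve.\<close>
  define q where "q = (1 / lf b' (X z1)) *s X z1"
  have q: "lf e q = 0" "lf b' q = 1" using z1 b'X[OF z1] by (simp_all add: q_def G_def)
  have param: "\<exists>s. X z = lf b' (X z) *s (q + s *s v)" if "G z = 0" for z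
  proof -
    define m where "m = lf b' (X z)"
    have m: "m \<noteq> 0" unfolding m_def by (rule b'X[OF that])
    have "lf e ((1 / m) *s X z - q) = 0" using q that by (simp add: G_def)
    moreover have "lf b' ((1 / m) *s X z - q) = 0" using q m by (simp add: m_def)
    ultimately obtain s where "(1 / m) *s X z - q = s *s v" using b'(1) by blast
    hence "(1 / m) *s X z = q + s *s v" by (simp add: algebra_simps)
    hence "m *s ((1 / m) *s X z) = m *s (q + s *s v)" by simp
    hence "X z = m *s (q + s *s v)" using m by simp
    thus ?thesis unfolding m_def by blast
  qed
  define R where "R = {s. cubic_form c (q + s *s v) = 0}"
  have R: "finite R" "card R \<le> 3" unfolding R_def by (rule cubic_form_line_roots[OF cubic_v])+
  have "\<exists>s z. x = pt \<tau> z \<and> G z = 0 \<and> X z = lf b' (X z) *s (q + s *s v)" if "x \<in># dv G" for x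
    using in_dvE[OF G that] param by metis
  then obtain \<sigma> \<zeta> where \<sigma>: "\<And>x. x \<in># dv G \<Longrightarrow> x = pt \<tau> (\<zeta> x)" "\<And>x. x \<in># dv G \<Longrightarrow> G (\<zeta> x) = 0"
     "\<And>x. x \<in># dv G \<Longrightarrow> X (\<zeta> x) = lf b' (X (\<zeta> x)) *s (q + \<sigma> x *s v)"
    by metis
  have "card (set_mset (dv G)) \<le> card R"
  proof (rule card_inj_on_le[of \<sigma>])
    show "inj_on \<sigma> (set_mset (dv G))"
    proof (rule inj_onI)
      fix x y assume xy: "x \<in># dv G" "y \<in># dv G" "\<sigma> x = \<sigma> y"
      define m m' where "m = lf b' (X (\<zeta> x))" and "m' = lf b' (X (\<zeta> y))"
      have m': "m' \<noteq> 0" unfolding m'_def by (rule b'X[OF \<sigma>(2)[OF xy(2)]])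
      have eqs: "X (\<zeta> x) = m *s (q + \<sigma> x *s v)" "X (\<zeta> y) = m' *s (q + \<sigma> x *s v)"
        using \<sigma>(3)[OF xy(1)] \<sigma>(3)[OF xy(2)] xy(3) by (simp_all add: m_def m'_def)
      have "X (\<zeta> x) = (m / m') *s X (\<zeta> y)" unfolding eqs using m' by simp
      hence "\<zeta> x - \<zeta> y \<in> \<Lambda>" by (rule X_inj)
      thus "x = y" using \<sigma>(1)[OF xy(1)] \<sigma>(1)[OF xy(2)] pt_eq_iff by metis
    qed
    show "\<sigma> ` set_mset (dv G) \<subseteq> R"
    proof safe
      fix x assume x: "x \<in># dv G"
      define m where "m = lf b' (X (\<zeta> x))"
      have m: "m \<noteq> 0" unfolding m_def by (rule b'X[OF \<sigma>(2)[OF x]])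
      have "X (\<zeta> x) = m *s (q + \<sigma> x *s v)" using \<sigma>(3)[OF x] by (simp add: m_def)
      hence "m ^ 3 * cubic_form c (q + \<sigma> x *s v) = 0"
        using cubic_X[of "\<zeta> x"] by (simp only: cubic_form_scale)
      thus "\<sigma> x \<in> R" using m by (simp add: R_def)
    qed
  qed (rule R)
  with R(2) card size_dv[OF G] show ?thesis by linarith
qed

text \<open>Two independent forms vanish at \<open>X 0\<close>. Divided by \<open>theta\<close> they
  have degree at most 1 and the same multiplier, and such sections are proportional; nondegeneracy
  carries this back to the forms.\<close>

lemma degree_ge_3: "d \<ge> 3"
proof (rule ccontr)
  assume "\<not> d \<ge> 3"
  hence d: "d - 1 = 0 \<or> d - 1 = 1" using degree_pos by linarith
  obtain a where a: "a \<noteq> 0" "lf a (X 0) = 0" by (rule form_vanishing_at)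
  obtain b where b: "b \<noteq> 0" "lf b (X 0) = 0" "\<And>k. a \<noteq> k *s b"
    by (rule independent_form[OF a(1) X_nonzero a(2)]) blast
  obtain f where f: "f \<in> sect (d - 1) (c0 / - ee 0)" "(\<lambda>z. lf a (X z)) = (\<lambda>z. theta (z - 0) * f z)"
    by (rule sect_divide_theta[OF lf_sect a(2)])
  obtain g where g: "g \<in> sect (d - 1) (c0 / - ee 0)" "(\<lambda>z. lf b (X z)) = (\<lambda>z. theta (z - 0) * g z)"
    by (rule sect_divide_theta[OF lf_sect b(2)])
  have f0: "f \<noteq> (\<lambda>_. 0)" using nondegenerate[OF a(1)] f(2) by auto
  have g0: "g \<noteq> (\<lambda>_. 0)" using nondegenerate[OF b(1)] g(2) by auto
  have "dv f = dv g"
  proof (cases "d - 1 = 0")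
    case True
    hence "size (dv f) = 0" "size (dv g) = 0" using size_dv[OF f(1) f0] size_dv[OF g(1) g0] by linarith+
    thus ?thesis by simp
  next
    case False
    hence "d - 1 = 1" using d by blast
    with f(1) g(1) f0 g0 show ?thesis by (intro dv_eq_degree_1[of f "c0 / - ee 0"]) auto
  qed
  from sect_proportional[OF f(1) g(1) f0 g0 this] obtain k where k: "f = (\<lambda>z. k * g z)" by blast
  have "a = k *s b"
  proof (rule lf_eqI)
    fix z
    show "lf a (X z) = lf (k *s b) (X z)"
      using fun_cong[OF f(2), of z] fun_cong[OF g(2), of z] by (simp add: k)
  qed
  with b(3) show False by blast
qed

lemma degree_eq_3: "d = 3"
  using degree_le_3 degree_ge_3 by simp

text \<open>The forms through \<open>X p\<close> make up a pencil, and one member also matches the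
  second zero \<open>q\<close>. What is left has degree 1 and is determined by its multiplier up to
  a scalar.\<close>

lemma sect_3_is_form:
  assumes F: "F \<in> sect 3 c0" "F \<noteq> (\<lambda>_. 0)"
  obtains h where "h \<noteq> 0" "F = (\<lambda>z. lf h (X z))"
proof -
  have lf3: "(\<lambda>z. lf a (X z)) \<in> sect 3 c0" for a using lf_sect[of a] degree_eq_3 by simp
  obtain p where p: "F p = 0" using sect_has_zero[OF F(1)] by auto
  obtain F1 where F1: "F1 \<in> sect (3 - 1) (c0 / - ee p)" "F = (\<lambda>z. theta (z - p) * F1 z)"
    by (rule sect_divide_theta[OF F(1) p])
  obtain q where q: "F1 q = 0" using sect_has_zero[OF F1(1)] by auto
  obtain F2 where F2: "F2 \<in> sect (3 - 1 - 1) (c0 / - ee p / - ee q)" "F1 = (\<lambda>z. theta (z - q) * F2 z)"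
    by (rule sect_divide_theta[OF F1(1) q])
  obtain a where a: "a \<noteq> 0" "lf a (X p) = 0" by (rule form_vanishing_at)
  obtain b where b: "b \<noteq> 0" "lf b (X p) = 0" "\<And>k. a \<noteq> k *s b"
    by (rule independent_form[OF a(1) X_nonzero a(2)]) blast
  obtain f where f: "f \<in> sect (3 - 1) (c0 / - ee p)" "(\<lambda>z. lf a (X z)) = (\<lambda>z. theta (z - p) * f z)"
    by (rule sect_divide_theta[OF lf3 a(2)])
  obtain g where g: "g \<in> sect (3 - 1) (c0 / - ee p)" "(\<lambda>z. lf b (X z)) = (\<lambda>z. theta (z - p) * g z)"
    by (rule sect_divide_theta[OF lf3 b(2)])
  \<comment> \<open>Vanishing at \<open>q\<close> is imposed after division by
    \<open>theta (z - p)\<close>, so tangency is included when \<open>p\<close> and \<open>q\<close>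
    are equivalent.\<close>
  obtain h e where h: "h \<noteq> 0" "(\<lambda>z. lf h (X z)) = (\<lambda>z. theta (z - p) * e z)" "e \<in> sect (3 - 1) (c0 / - ee p)" "e q = 0"
  proof (cases "g q = 0")
    case True
    show ?thesis by (rule that[OF b(1) g(2,1) True])
  next
    case False
    define k where "k = f q / g q"
    show ?thesis
    proof (rule that)
      show "a - k *s b \<noteq> 0" using b(3)[of k] by auto
      show "(\<lambda>z. lf (a - k *s b) (X z)) = (\<lambda>z. theta (z - p) * (f z - k * g z))"
        using fun_cong[OF f(2)] fun_cong[OF g(2)] by (auto simp: algebra_simps)
      show "(\<lambda>z. f z - k * g z) \<in> sect (3 - 1) (c0 / - ee p)" by (intro sect_diff sect_cmult f g)
      show "f q - k * g q = 0" using False by (simp add: k_def)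
    qed
  qed
  obtain e' where e': "e' \<in> sect (3 - 1 - 1) (c0 / - ee p / - ee q)" "e = (\<lambda>z. theta (z - q) * e' z)"
    by (rule sect_divide_theta[OF h(3,4)])
  have F20: "F2 \<noteq> (\<lambda>_. 0)" using F(2) F1(2) F2(2) by auto
  have e'0: "e' \<noteq> (\<lambda>_. 0)" using nondegenerate[OF h(1)] h(2) e'(2) by auto
  have "dv F2 = dv e'"
    by (rule dv_eq_degree_1[OF _ _ F20 e'0]) (use F2(1) e'(1) in auto)
  from sect_proportional[OF F2(1) e'(1) F20 e'0 this]
  obtain k where k: "k \<noteq> 0" "F2 = (\<lambda>z. k * e' z)" by blast
  show ?thesis
  proof (rule that[of "k *s h"])
    show "k *s h \<noteq> 0" using k h by (simp add: vec.scale_eq_0_iff)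
    show "F = (\<lambda>z. lf (k *s h) (X z))"
      using fun_cong[OF h(2)] by (auto simp: F1(2) F2(2) k(2) e'(2) mult_ac)
  qed
qed

end

section \<open>The cubic relations come from lines\<close>

context torus
begin

text \<open>For \<open>n \<noteq> 0\<close> the additional factor takes every nonzero value as
  \<open>t\<close> varies, which allows a change to any prescribed multiplier.\<close>

lemma sect_translate:
  assumes "F \<in> sect n c" shows "(\<lambda>z. F (z - t)) \<in> sect n (c * ee (of_int n * t))"
proof -
  note F = sectD[OF assms]
  have "(\<lambda>z. z - t) holomorphic_on UNIV" by (intro holomorphic_intros)
  from holomorphic_on_compose_gen[OF this F(2)] have "(\<lambda>z. F (z - t)) holomorphic_on UNIV"
    by (simp add: o_def)
  moreover have "F (z + 1 - t) = F (z - t)" for z using F(3)[of "z - t"] by (simp add: algebra_simps)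
  moreover have "F (z + \<tau> - t) = c * ee (of_int n * t) * ee (- (of_int n * z)) * F (z - t)" for z
  proof -
    have "F (z + \<tau> - t) = c * ee (- (of_int n * (z - t))) * F (z - t)"
      using F(4)[of "z - t"] by (simp add: algebra_simps)
    also have "ee (- (of_int n * (z - t))) = ee (of_int n * t) * ee (- (of_int n * z))"
      by (simp add: ee_add[symmetric] algebra_simps)
    finally show ?thesis by (simp add: mult_ac)
  qed
  ultimately show ?thesis using F(1) by (simp add: sect_def)
qed

lemma theta_rep_translate:
  assumes "theta_rep F A" shows "theta_rep (\<lambda>z. F (z - t)) (image_mset (\<lambda>a. a + t) A)"
proof -
  obtain K k where K: "K \<noteq> 0" "F = (\<lambda>z. K * ee (of_int k * z) * tprod A z)"
    by (rule theta_repE[OF assms])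
  have tp: "tprod A (z - t) = tprod (image_mset (\<lambda>a. a + t) A) z" for z
    by (induction A) (simp_all add: algebra_simps)
  have "ee (of_int k * (z - t)) = ee (- (of_int k * t)) * ee (of_int k * z)" for z
    by (simp add: ee_add[symmetric] algebra_simps)
  thus ?thesis
    unfolding theta_rep_def K(2) tp using K(1)
    by (intro exI[of _ "K * ee (- (of_int k * t))"] exI[of _ k]) (auto simp: mult_ac)
qed

lemma bloch_form_translate:
  "bloch_form (mfrag (image_mset (\<lambda>a. pt \<tau> (a + t)) A)) (mfrag (image_mset (\<lambda>a. pt \<tau> (a + t)) B)) =
     bloch_form (mfrag (image_mset (pt \<tau>) A)) (mfrag (image_mset (pt \<tau>) B))"
proof (induction A)
  case empty
  show ?case by (simp add: bloch_form_simps)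
next
  case (add a A)
  have "bloch_form (frag_of (pt \<tau> (a + t))) (mfrag (image_mset (\<lambda>a. pt \<tau> (a + t)) B)) =
          bloch_form (frag_of (pt \<tau> a)) (mfrag (image_mset (pt \<tau>) B))"
    by (induction B) (simp_all add: bloch_form_simps bloch_form_frag_of point_diff_pt)
  with add show ?case by (simp add: bloch_form_simps)
qed

text \<open>Only differences of zeros enter \<open>bloch_form\<close>.\<close>

lemma Tform_translate:
  assumes "steinberg n c F G K"
  shows "Tform (\<lambda>z. F (z - t)) (\<lambda>z. G (z - t)) (\<lambda>z. K (z - t)) = Tform F G K"
proof -
  note S = steinbergD[OF assms]
  obtain A where A: "theta_rep F A" using theta_rep_exists[OF S(1,4)] by blast
  obtain B where B: "theta_rep G B" using theta_rep_exists[OF S(2,5)] by blast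
  obtain C where C: "theta_rep K C" using theta_rep_exists[OF S(3,6)] by blast
  show ?thesis
    by (simp add: Tform_def dv_eq[OF A] dv_eq[OF B] dv_eq[OF C] dv_eq[OF theta_rep_translate[OF A]]
        dv_eq[OF theta_rep_translate[OF B]] dv_eq[OF theta_rep_translate[OF C]]
        image_mset.compositionality o_def bloch_form_simps bloch_form_translate)
qed

end

context lifted_cubic
begin

text \<open>After a translation the three terms are linear forms. Disjointness of the zeros is what
  makes the three lines distinct and puts their common point off the curve.\<close>

lemma cubic_relation_from_line:
  assumes st: "steinberg 3 c F G K" and disj: "\<And>z. F z = 0 \<Longrightarrow> G z \<noteq> 0"
  shows "\<exists>\<phi>\<in>line_functions \<tau> \<Phi>.
           bloch_beta \<tau> \<phi> (\<lambda>z. 1 - \<phi> z) = antisymmetry_relations \<tau> #>\<^bsub>ZE \<tau>\<^esub> Tform F G K"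
proof -
  note S = steinbergD[OF st]
  obtain t where t: "c * ee (of_int 3 * t) = c0"
  proof -
    have "c0 / c \<noteq> 0" using sectD(1)[OF S(1)] sectD(1)[OF coords] by simp
    then obtain s where "ee s = c0 / c" using ee_surj by blast
    thus ?thesis using sectD(1)[OF S(1)] by (intro that[of "s / 3"]) simp
  qed
  define F' G' K' where "F' = (\<lambda>z. F (z - t))" and "G' = (\<lambda>z. G (z - t))" and "K' = (\<lambda>z. K (z - t))"
  have nz: "(\<lambda>z. E (z - t)) \<noteq> (\<lambda>_. 0)" if "E \<noteq> (\<lambda>_. 0)" for E :: "complex \<Rightarrow> complex"
  proof
    assume *: "(\<lambda>z. E (z - t)) = (\<lambda>_. 0)"
    have "E z = 0" for z using fun_cong[OF *, of "z + t"] by simp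
    with that show False by auto
  qed
  have st': "steinberg 3 c0 F' G' K'"
    unfolding steinberg_def F'_def G'_def K'_def
    using sect_translate[OF S(1), of t] sect_translate[OF S(2), of t] sect_translate[OF S(3), of t] t
      nz[OF S(4)] nz[OF S(5)] nz[OF S(6)] S(7) by simp
  note S' = steinbergD[OF st']
  have nc: "F' z \<noteq> 0 \<or> G' z \<noteq> 0" "F' z \<noteq> 0 \<or> K' z \<noteq> 0" "G' z \<noteq> 0 \<or> K' z \<noteq> 0" for z
    using disj[of "z - t"] S'(7)[of z] by (auto simp: F'_def G'_def)
  \<comment> \<open>The sign turns \<open>F' + G' + K' = 0\<close> into the normalisation
    \<open>hm = hn + hl\<close> of the line equations.\<close>
  have neg: "(\<lambda>z. - K' z) \<noteq> (\<lambda>_. 0)" using S'(6) by (auto simp: fun_eq_iff)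
  obtain l where l: "l \<noteq> 0" "F' = (\<lambda>z. lf l (X z))" by (rule sect_3_is_form[OF S'(1,4)])
  obtain n where n: "n \<noteq> 0" "G' = (\<lambda>z. lf n (X z))" by (rule sect_3_is_form[OF S'(2,5)])
  obtain m where m: "m \<noteq> 0" "(\<lambda>z. - K' z) = (\<lambda>z. lf m (X z))"
    by (rule sect_3_is_form[OF sect_uminus[OF S'(3)] neg])
  have m_eq: "m = n + l"
  proof (rule lf_eqI)
    fix z
    have "- K' z = G' z + F' z" using S'(7)[of z] by (simp add: neg_eq_iff_add_eq_0 algebra_simps)
    thus "lf m (X z) = lf (n + l) (X z)"
      using fun_cong[OF m(2), of z] by (simp add: l(2) n(2))
  qed
  have m_zero: "lf m (X z) = 0 \<longleftrightarrow> K' z = 0" for z using fun_cong[OF m(2), of z] by (metis neg_equal_0_iff_equal)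
  define line where "line a = {p \<in> proj_plane. \<forall>x\<in>p. lf a x = 0}" for a
  have line: "line_equation (lf a) (line a)" if a: "a \<noteq> 0" for a
  proof -
    obtain i where "a $ i \<noteq> 0" using a by (auto simp: vec_eq_iff)
    hence "\<exists>x. lf a x \<noteq> 0" by (intro exI[of _ "axis i 1"]) simp
    thus ?thesis unfolding line_equation_def line_def using linear_lf by blast
  qed
  have in_line: "vec.span {v} \<in> line a \<longleftrightarrow> lf a v = 0" if "v \<noteq> 0" for a v
  proof -
    have "vec.span {v} \<in> proj_plane" using that unfolding proj_plane_def by blast
    moreover have "v \<in> vec.span {v}" by (simp add: vec.span_base)
    hence "(\<forall>x\<in>vec.span {v}. lf a x = 0) \<longleftrightarrow> lf a v = 0" by (auto simp: span_singleton_iff)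
    ultimately show ?thesis by (simp add: line_def)
  qed
  \<comment> \<open>The point of the curve over a zero of \<open>F'\<close> lies on the first line
    only; likewise \<open>zK\<close> distinguishes the remaining two.\<close>
  obtain zF where zF: "F' zF = 0" using sect_has_zero[OF S'(1)] by auto
  obtain zK where zK: "K' zK = 0" using sect_has_zero[OF S'(3)] by auto
  have "line l \<noteq> line m" "line l \<noteq> line n"
    using in_line[OF X_nonzero, of zF] m_zero[of zF] nc[of zF] zF l(2) n(2) by auto
  moreover have "line m \<noteq> line n"
    using in_line[OF X_nonzero, of zK] m_zero[of zK] nc[of zK] zK n(2) by auto
  moreover obtain v where v: "v \<noteq> 0" "lf l v = 0" "lf n v = 0" by (rule common_zero_of_forms[OF l(1)])
  have "vec.span {v} \<in> line l" "vec.span {v} \<in> line m" "vec.span {v} \<in> line n"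
    using v by (simp_all add: in_line m_eq)
  moreover have "vec.span {v} \<notin> \<Phi> ` carrier (elliptic_curve \<tau>)"
  proof
    assume "vec.span {v} \<in> \<Phi> ` carrier (elliptic_curve \<tau>)"
    then obtain z where "vec.span {X z} = vec.span {v}" by (auto simp: carrier_elliptic_curve \<Phi>_X)
    then obtain k where "X z = k *s v" by (rule span_eqD) (rule X_nonzero)
    hence "F' z = 0" "G' z = 0" using v by (simp_all add: l(2) n(2))
    with nc(1) show False by blast
  qed
  moreover have "\<forall>x. lf m x = lf n x + lf l x" by (simp add: m_eq)
  ultimately have in_fun: "form_ratio \<tau> \<Phi> (lf l) (lf m) \<in> line_functions \<tau> \<Phi>"
    unfolding line_functions_def using line[OF l(1)] line[OF m(1)] line[OF n(1)] by blast
  have "form_ratio \<tau> \<Phi> (lf l) (lf m) z = - F' z / K' z" for z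
  proof -
    obtain k where k: "k \<noteq> 0" "hom_coords (vec.span {X z}) = k *s X z"
      by (rule hom_coords_span[OF X_nonzero])
    have "form_ratio \<tau> \<Phi> (lf l) (lf m) z = lf l (X z) / lf m (X z)"
      using k by (simp add: form_ratio_def \<Phi>_X)
    also have "\<dots> = F' z / (- K' z)" using fun_cong[OF m(2), of z] by (simp add: l(2))
    finally show ?thesis by simp
  qed
  hence "bloch_beta \<tau> (form_ratio \<tau> \<Phi> (lf l) (lf m)) (\<lambda>z. 1 - form_ratio \<tau> \<Phi> (lf l) (lf m) z) =
      antisymmetry_relations \<tau> #>\<^bsub>ZE \<tau>\<^esub> Tform F' G' K'"
    by (intro bloch_beta_eq_Tform[OF st']) simp
  also have "Tform F' G' K' = Tform F G K"
    unfolding F'_def G'_def K'_def by (rule Tform_translate[OF st])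
  finally show ?thesis using in_fun by blast
qed

end

section \<open>Supports on the curve and the generated subgroup\<close>

context torus
begin

lemma keys_mfrag: "Poly_Mapping.keys (mfrag M) \<subseteq> set_mset M"
proof
  fix x assume "x \<in> Poly_Mapping.keys (mfrag M)"
  hence "int (count M x) \<noteq> 0" unfolding in_keys_iff lookup_mfrag .
  thus "x \<in># M" by (metis not_in_iff of_nat_0)
qed

lemma bloch_form_carrier:
  assumes "Poly_Mapping.keys u \<subseteq> range (pt \<tau>)" "Poly_Mapping.keys v \<subseteq> range (pt \<tau>)"
  shows "bloch_form u v \<in> carrier (ZE \<tau>)"
proof -
  have "Poly_Mapping.keys (frag_extend (\<lambda>y. frag_of (point_diff \<tau> x y)) v) \<subseteq> range (pt \<tau>)"
    if "x \<in> range (pt \<tau>)" for x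
    using keys_frag_extend[of "\<lambda>y. frag_of (point_diff \<tau> x y)" v] assms(2) that
    by (fastforce simp: point_diff_pt)
  hence "Poly_Mapping.keys (bloch_form u v) \<subseteq> range (pt \<tau>)"
    unfolding bloch_form_def
    using keys_frag_extend[of "\<lambda>x. frag_extend (\<lambda>y. frag_of (point_diff \<tau> x y)) v" u] assms(1) by blast
  thus ?thesis by (simp add: ZE_def carrier_elliptic_curve)
qed

text \<open>Stated for every function, so that each generator is seen to be an element of the
  quotient group without any knowledge of its zeros and poles; an infinite sum is 0 by
  convention.\<close>

lemma keys_divisor: "Poly_Mapping.keys (divisor \<tau> \<phi>) \<subseteq> range (pt \<tau>)"
proof -
  define A where "A = {x \<in> carrier (elliptic_curve \<tau>). ord_at \<phi> x \<noteq> 0}"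
  have "Poly_Mapping.keys (\<Sum>x\<in>A. frag_cmul (ord_at \<phi> x) (frag_of x)) \<subseteq>
          (\<Union>x\<in>A. Poly_Mapping.keys (frag_cmul (ord_at \<phi> x) (frag_of x)))"
    by (rule keys_sum)
  also have "\<dots> \<subseteq> range (pt \<tau>)" by (auto simp: A_def carrier_elliptic_curve)
  finally show ?thesis unfolding divisor_def A_def .
qed

lemma Tform_carrier:
  assumes "steinberg n c F G K" shows "Tform F G K \<in> carrier (ZE \<tau>)"
proof -
  note S = steinbergD[OF assms]
  have supp: "set_mset (dv E) \<subseteq> range (pt \<tau>)" if "E \<in> sect n c" "E \<noteq> (\<lambda>_. 0)" for E
    using in_dvE[OF that] by blast
  have diff: "Poly_Mapping.keys (mfrag M - mfrag N) \<subseteq> range (pt \<tau>)"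
    if "set_mset M \<subseteq> range (pt \<tau>)" "set_mset N \<subseteq> range (pt \<tau>)" for M N
    using keys_diff[of "mfrag M" "mfrag N"] keys_mfrag[of M] keys_mfrag[of N] that by blast
  show ?thesis
    unfolding Tform_def by (intro bloch_form_carrier diff supp S)
qed

end

theorem theorem1:
  fixes \<tau> :: complex
    and \<Phi> :: "complex set \<Rightarrow> (complex ^ 3) set"
    and f :: "complex \<Rightarrow> complex"
  assumes "Im \<tau> > 0"
    and "plane_cubic_embedding \<tau> \<Phi>"
    and "f \<in> function_field \<tau>"
    and "f \<noteq> (\<lambda>z. 0)" and "f \<noteq> (\<lambda>z. 1)"
  shows "bloch_beta \<tau> f (\<lambda>z. 1 - f z) \<in>
    generate (ZE_minus \<tau>) {bloch_beta \<tau> \<phi> (\<lambda>z. 1 - \<phi> z) | \<phi>. \<phi> \<in> line_functions \<tau> \<Phi>}"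
proof -
  interpret torus \<tau> by unfold_locales (rule assms(1))
  have emb: "holomorphic_embedding \<tau> \<Phi>" "plane_cubic (\<Phi> ` carrier (elliptic_curve \<tau>))"
    "inj_on \<Phi> (carrier (elliptic_curve \<tau>))"
    using assms(2) by (auto simp: plane_cubic_embedding_def holomorphic_embedding_def)
  obtain d c0 and X :: "complex \<Rightarrow> complex ^ 3" where X: "\<And>i. (\<lambda>z. X z $ i) \<in> sect d c0" "\<And>z. X z \<noteq> 0"
    "\<And>z. \<Phi> (pt \<tau> z) = vec.span {X z}" "\<And>z. (\<chi> i. deriv (\<lambda>w. X w $ i) z) \<notin> vec.span {X z}"
    by (rule global_lift[OF emb(1)]) blast
  interpret lifted_cubic \<tau> \<Phi> d c0 X
    by unfold_locales (fact X emb)+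
  define S where "S = {bloch_beta \<tau> \<phi> (\<lambda>z. 1 - \<phi> z) | \<phi>. \<phi> \<in> line_functions \<tau> \<Phi>}"
  define N where "N = antisymmetry_relations \<tau>"
  \<comment> \<open>The preimage of the target subgroup under the quotient map. It contains the
    antisymmetry relations because these map to the identity.\<close>
  define H where "H = {x \<in> carrier (ZE \<tau>). N #>\<^bsub>ZE \<tau>\<^esub> x \<in> generate (ZE_minus \<tau>) S}"
  define gens where "gens = {frag_of \<xi> + frag_of (inv\<^bsub>elliptic_curve \<tau>\<^esub> \<xi>) | \<xi>. \<xi> \<in> carrier (elliptic_curve \<tau>)}"
  interpret ZE: comm_group "ZE \<tau>" unfolding ZE_def by (rule abelian_free_Abelian_group)
  have carrier_ZE: "x \<in> carrier (ZE \<tau>) \<longleftrightarrow> Poly_Mapping.keys x \<subseteq> range (pt \<tau>)" for x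
    by (simp add: ZE_def carrier_elliptic_curve)
  have gens: "gens \<subseteq> carrier (ZE \<tau>)"
    unfolding gens_def carrier_ZE subset_iff
    by (auto simp: carrier_elliptic_curve pt_inv dest!: subsetD[OF keys_add])
  have N_eq: "N = generate (ZE \<tau>) gens" by (simp add: N_def antisymmetry_relations_def gens_def)
  have N: "N \<lhd> ZE \<tau>"
    unfolding N_eq by (rule ZE.subgroup_imp_normal[OF ZE.generate_is_subgroup[OF gens]])
  have ZEm: "ZE_minus \<tau> = ZE \<tau> Mod N" by (simp add: ZE_minus_def N_def)
  have hom: "(\<lambda>x. N #>\<^bsub>ZE \<tau>\<^esub> x) \<in> hom (ZE \<tau>) (ZE_minus \<tau>)"
    unfolding ZEm by (rule normal.r_coset_hom_Mod[OF N])
  interpret Q: group "ZE_minus \<tau>" unfolding ZEm by (rule normal.factorgroup_is_group[OF N])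
  interpret h: group_hom "ZE \<tau>" "ZE_minus \<tau>" "\<lambda>x. N #>\<^bsub>ZE \<tau>\<^esub> x"
    by unfold_locales (rule hom)
  have S_carrier: "S \<subseteq> carrier (ZE_minus \<tau>)"
  proof
    fix x assume "x \<in> S"
    then obtain \<phi> where "x = N #>\<^bsub>ZE \<tau>\<^esub> bloch_form (divisor \<tau> \<phi>) (divisor \<tau> (\<lambda>z. 1 - \<phi> z))"
      by (auto simp: S_def bloch_beta_def bloch_form_def N_def)
    thus "x \<in> carrier (ZE_minus \<tau>)"
      using h.hom_closed[OF bloch_form_carrier[OF keys_divisor keys_divisor]] by simp
  qed
  have sub: "subgroup (generate (ZE_minus \<tau>) S) (ZE_minus \<tau>)"
    by (rule Q.generate_is_subgroup[OF S_carrier])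
  interpret bloch_subgroup \<tau> H
  proof unfold_locales
    fix a b assume ab: "a \<in> H" "b \<in> H"
    hence c: "a \<in> carrier (ZE \<tau>)" "b \<in> carrier (ZE \<tau>)" by (auto simp: H_def)
    have eq: "a - b = a \<otimes>\<^bsub>ZE \<tau>\<^esub> inv\<^bsub>ZE \<tau>\<^esub> b"
      using c(2) by (simp add: ZE_def)
    have "N #>\<^bsub>ZE \<tau>\<^esub> (a - b) = (N #>\<^bsub>ZE \<tau>\<^esub> a) \<otimes>\<^bsub>ZE_minus \<tau>\<^esub> inv\<^bsub>ZE_minus \<tau>\<^esub> (N #>\<^bsub>ZE \<tau>\<^esub> b)"
      unfolding eq using c by simp
    also have "\<dots> \<in> generate (ZE_minus \<tau>) S"
      using ab sub by (intro subgroup.m_closed[OF sub] subgroup.m_inv_closed[OF sub]) (auto simp: H_def)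
    finally show "a - b \<in> H" unfolding H_def using c eq by simp
  next
    fix z
    have in_gens: "frag_of (pt \<tau> z) + frag_of (pt \<tau> (- z)) \<in> gens"
      unfolding gens_def by (rule CollectI, rule exI[of _ "pt \<tau> z"]) (simp add: pt_inv carrier_elliptic_curve)
    hence "N #>\<^bsub>ZE \<tau>\<^esub> (frag_of (pt \<tau> z) + frag_of (pt \<tau> (- z))) = N"
      using normal_imp_subgroup[OF N] gens
      by (intro ZE.coset_join2) (auto simp: N_eq intro: generate.incl)
    also have "N = \<one>\<^bsub>ZE_minus \<tau>\<^esub>" by (simp add: ZEm FactGroup_def)
    also have "\<dots> \<in> generate (ZE_minus \<tau>) S" by (rule generate.one)
    finally show "frag_of (pt \<tau> z) + frag_of (pt \<tau> (- z)) \<in> H"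
      unfolding H_def using in_gens gens by blast
  next
    fix c F G K assume st: "steinberg 3 c F G K" and "\<And>z. F z = 0 \<Longrightarrow> G z \<noteq> 0"
    then obtain \<phi> where "\<phi> \<in> line_functions \<tau> \<Phi>"
      "bloch_beta \<tau> \<phi> (\<lambda>z. 1 - \<phi> z) = N #>\<^bsub>ZE \<tau>\<^esub> Tform F G K"
      using cubic_relation_from_line unfolding N_def by blast
    hence "N #>\<^bsub>ZE \<tau>\<^esub> Tform F G K \<in> S" unfolding S_def by (metis (mono_tags, lifting) mem_Collect_eq)
    hence "N #>\<^bsub>ZE \<tau>\<^esub> Tform F G K \<in> generate (ZE_minus \<tau>) S" by (rule generate.incl)
    thus "Tform F G K \<in> H" unfolding H_def using Tform_carrier[OF st] by blast
  qed
  obtain n c F C where FC: "F \<in> sect n c" "C \<in> sect n c" "C \<noteq> (\<lambda>_. 0)"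
    "\<And>z. \<not> is_pole f z \<Longrightarrow> C z \<noteq> 0 \<and> f z = F z / C z"
    by (rule function_field_quotient[OF assms(3)]) blast
  have nice: "f nicely_meromorphic_on UNIV" using assms(3) by (simp add: function_field_def)
  have no_pole: "eventually (\<lambda>w. \<not> is_pole f w) (at z)" for z
  proof -
    have "f meromorphic_on UNIV" using nice by (simp add: nicely_meromorphic_on_def)
    hence "f meromorphic_on {z}" by (rule meromorphic_on_subset) simp
    thus ?thesis by (intro eventually_not_pole meromorphic_on_isolated_singularity)
  qed
  \<comment> \<open>The hypotheses on \<open>f\<close> compare functions at every point. The
    normalisation in \<open>function_field\<close> lets equality off the poles near 0 spread to the
    whole plane.\<close>
  have const: "F \<noteq> (\<lambda>z. k * C z)" if f_k: "f \<noteq> (\<lambda>_. k)" for k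
  proof
    assume F: "F = (\<lambda>z. k * C z)"
    have "eventually (\<lambda>w. f w = k) (at 0)"
      using no_pole[of 0] by eventually_elim (use FC(4) F in auto)
    hence "frequently (\<lambda>w. f w = k) (at 0)" by (rule eventually_frequently[rotated]) simp
    hence "f w = k" for w
      using frequently_eq_meromorphic_imp_constant[OF _ nice open_UNIV connected_UNIV] by blast
    with f_k show False by auto
  qed
  \<comment> \<open>With third term \<open>- C\<close> the quotient \<open>- F / - C\<close> is
    \<open>f\<close>, and the middle term accounts for \<open>1 - f\<close>.\<close>
  have "steinberg n c F (\<lambda>z. C z - F z) (\<lambda>z. - C z)"
    unfolding steinberg_def
  proof (intro conjI allI)
    show "F \<noteq> (\<lambda>_. 0)" using const[of 0] assms(4) by simp
    show "(\<lambda>z. C z - F z) \<noteq> (\<lambda>_. 0)"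
    proof
      assume "(\<lambda>z. C z - F z) = (\<lambda>_. 0)"
      hence "F z = 1 * C z" for z using fun_cong[of "\<lambda>z. C z - F z" _ z] by simp
      with const[OF assms(5)] show False by blast
    qed
    show "(\<lambda>z. - C z) \<noteq> (\<lambda>_. 0)" using FC(3) by (auto simp: fun_eq_iff)
  qed (auto intro: FC sect_diff sect_uminus)
  note st = this
  have "bloch_beta \<tau> f (\<lambda>z. 1 - f z) = N #>\<^bsub>ZE \<tau>\<^esub> Tform F (\<lambda>z. C z - F z) (\<lambda>z. - C z)"
    unfolding N_def
  proof (rule bloch_beta_eq_Tform[OF st])
    show "eventually (\<lambda>w. - C w \<noteq> 0 \<longrightarrow> f w = - F w / - C w) (at z)" for z
      using no_pole[of z] by eventually_elim (use FC(4) in auto)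
  qed
  also have "\<dots> \<in> generate (ZE_minus \<tau>) S"
    using Tform_in_H[OF st] by (simp add: H_def)
  finally show ?thesis unfolding S_def .
qed

end
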